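(* Let a vacuum pp-wave with $\alpha\neq0$ be given. It is a solution with invariant count $(0,2,2)$ (and hence a 2-dimensional local isometry group) if and only if both of the following hold: (a) there exists a real vector field $V=V^1\delta+V^2\delta^*+V^3\Delta+V^4D$ such that $\mathcal L_V\omega^1=\mathcal L_V\omega^3=0$ and $V^1\neq0$ or $V^3\neq0$; (b) $d\alpha\wedge d\alpha^*\neq0$ and $d\alpha\wedge d\alpha^*\wedge d\nu=0$.
   Context: Setting. Everything is local, on a small connected coordinate domain with coordinates $(\zeta,\zeta^*,u,v)$, $\zeta$ complex, $u,v$ real; $^*$ (or a bar) is complex conjugation. A (non-flat) vacuum pp-wave is a metric $ds^2=2\,d\zeta\,d\bar\zeta-2\,du\,dv-2(f+\bar f)\,du^2$ with $f=f(\zeta,u)$ complex analytic in $\zeta$, smooth in $u$, $f_{\zeta\zeta}\neq0$ everywhere. Conditions "$\ne0$" are meant at every point, conditions "$=0$" identically. $\mathcal L_V$ is the Lie derivative. A real vector field $V$ has $V^2=(V^1)^*$ and $V^3,V^4$ real. Normalized tetrad and scalars. Let $a=\tfrac14\log f_{\zeta\zeta}$ and $\alpha=e^{a-a^*}(a_\zeta)^*$. If $\alpha\neq0$, write $\zeta=Z(a,u)$, $L=\log Z_a$ (functions of $(a,u)$), and let $\omega^1=(\alpha^* )^{-1}da=e^{a-a^*}(d\zeta-Z_u\,du)$, $\omega^2=(\omega^1)^*$, $\omega^3=e^{a+a^*}du$, $\omega^4=e^{-a-a^*}\big((f+f^*+Z_uZ_u^* )du+dv-Z_u\,d\zeta^*-Z_u^*\,d\zeta\big)$,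 so the metric is $2\omega^1\omega^2-2\omega^3\omega^4$. Let $(\delta,\delta^*,\Delta,D)$ be the frame dual to $(\omega^1,\omega^2,\omega^3,\omega^4)$; this is the null tetrad normalized by $\Psi_4=1$, $\gamma=0$ (Newman–Penrose notation). On functions of $(a,a^*,u)$: $\delta Q=\alpha^*Q_a$, $\delta^*Q=\alpha Q_{a^*}$, $\Delta Q=e^{-a-a^*}Q_u$ ($a,a^*$ fixed), $DQ=0$. The remaining spin coefficients are $\mu=e^{-a-a^*}L_u$ and $\nu=e^{-a-3a^*}(Z_{uu}+(f_\zeta)^* )$. Invariant count. For $\alpha\ne0$ the invariant tetrad above is used from order 1 on. $t_0=0$, and for $q\ge1$, $t_q$ is the number of functionally independent functions (rank of the differentials, assumed constant) among the components, in this tetrad, of the Riemann tensor and its covariant derivatives up to order $q$. The first-order invariants are generated by $\alpha,\alpha^*$; those up to second order by $\alpha$, $\delta^*\alpha$, $\mu$, $\nu$ and conjugates; those up to third order by these together with $(\delta^* )^2\alpha,\delta\mu,\Delta\mu,\Delta\nu$ and conjugates. The invariant count is $(t_0,\ldots,t_q)$ where $q\ge2$ is the first order with $t_q=t_{q-1}$; the local isometry group then has dimension $4-t_q$. *)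

theory Defs
  imports "HOL-Analysis.Analysis"
begin

subsection \<open>Smooth functions\<close>

fun C_diff_on :: "nat \<Rightarrow> 'a set \<Rightarrow> ('a::euclidean_space \<Rightarrow> 'b::real_normed_vector) \<Rightarrow> bool" where
  "C_diff_on 0 S F = continuous_on S F"
| "C_diff_on (Suc k) S F =
     (F differentiable_on S \<and>
      (\<forall>b\<in>Basis. C_diff_on k S (\<lambda>x. frechet_derivative F (at x) b)))"

text \<open>Used for open sets \<open>S\<close> only.\<close>

definition smooth_on :: "'a set \<Rightarrow> ('a::euclidean_space \<Rightarrow> 'b::real_normed_vector) \<Rightarrow> bool" where
  "smooth_on S F \<longleftrightarrow> (\<forall>k. C_diff_on k S F)"


subsection \<open>Tensor calculus in the coordinates \<open>(\<zeta>, \<zeta>\<^sup>*, u, v)\<close>\<close>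

text \<open>
  A point is \<open>(\<zeta>, u, v)\<close>. The complexified tangent space has the coordinate basis
  \<open>\<partial>\<^sub>\<zeta>, \<partial>\<^sub>\<zeta>\<^sub>*, \<partial>\<^sub>u, \<partial>\<^sub>v\<close>, indexed by 1, 2, 3, 4 of the numeral type 4 (in which 4 = 0);
  the first two are the Wirtinger operators. Vector fields and 1-forms are given by their
  components, covariant tensors by their components indexed by lists of indices.
\<close>

type_synonym pt = "complex \<times> real \<times> real"
type_synonym field4 = "4 \<Rightarrow> pt \<Rightarrow> complex"
type_synonym tensor = "4 list \<Rightarrow> pt \<Rightarrow> complex"

definition pd :: "4 \<Rightarrow> (pt \<Rightarrow> complex) \<Rightarrow> pt \<Rightarrow> complex" where
  "pd i F p =
     (let d = frechet_derivative F (at p) in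
      if i = 1 then (d (1, 0, 0) - \<i> * d (\<i>, 0, 0)) / 2
      else if i = 2 then (d (1, 0, 0) + \<i> * d (\<i>, 0, 0)) / 2
      else if i = 3 then d (0, 1, 0)
      else d (0, 0, 1))"

definition real_field_on :: "pt set \<Rightarrow> field4 \<Rightarrow> bool" where
  "real_field_on S X \<longleftrightarrow>
     (\<forall>p\<in>S. X 2 p = cnj (X 1 p) \<and> X 3 p \<in> \<real> \<and> X 4 p \<in> \<real>)"

definition lie_form :: "field4 \<Rightarrow> field4 \<Rightarrow> field4" where
  "lie_form X \<omega> i p = (\<Sum>j\<in>UNIV. X j p * pd j (\<omega> i) p + \<omega> j p * pd i (X j) p)"

definition d_fun :: "(pt \<Rightarrow> complex) \<Rightarrow> field4" where
  "d_fun F = (\<lambda>i. pd i F)"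

definition wedge11 :: "field4 \<Rightarrow> field4 \<Rightarrow> 4 \<Rightarrow> 4 \<Rightarrow> pt \<Rightarrow> complex" where
  "wedge11 \<phi> \<psi> i j p = \<phi> i p * \<psi> j p - \<phi> j p * \<psi> i p"

definition wedge12 :: "field4 \<Rightarrow> (4 \<Rightarrow> 4 \<Rightarrow> pt \<Rightarrow> complex) \<Rightarrow> 4 \<Rightarrow> 4 \<Rightarrow> 4 \<Rightarrow> pt \<Rightarrow> complex" where
  "wedge12 \<phi> \<Psi> i j k p = \<phi> i p * \<Psi> j k p - \<phi> j p * \<Psi> i k p + \<phi> k p * \<Psi> i j p"


subsection \<open>The metric and its curvature\<close>

text \<open>The function \<open>f\<close> of \<open>(\<zeta>, u)\<close> is curried; \<open>base U\<close> is the set of \<open>(\<zeta>, u)\<close> occurring in \<open>U\<close>.\<close>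

definition base :: "pt set \<Rightarrow> (complex \<times> real) set" where
  "base U = (\<lambda>(z, u, v). (z, u)) ` U"

definition pp_metric :: "(complex \<Rightarrow> real \<Rightarrow> complex) \<Rightarrow> pt \<Rightarrow> complex^4^4" where
  "pp_metric f = (\<lambda>(z, u, v).
     vector [vector [0, 1, 0, 0],
             vector [1, 0, 0, 0],
             vector [0, 0, - 2 * (f z u + cnj (f z u)), - 1],
             vector [0, 0, - 1, 0]])"

definition christoffel :: "(pt \<Rightarrow> complex^4^4) \<Rightarrow> 4 \<Rightarrow> 4 \<Rightarrow> 4 \<Rightarrow> pt \<Rightarrow> complex" where
  "christoffel g m i j p =
     (\<Sum>l\<in>UNIV. matrix_inv (g p) $ m $ l *
        (pd i (\<lambda>q. g q $ l $ j) p + pd j (\<lambda>q. g q $ l $ i) p - pd l (\<lambda>q. g q $ i $ j) p)) / 2"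

definition riemann_up :: "(pt \<Rightarrow> complex^4^4) \<Rightarrow> 4 \<Rightarrow> 4 \<Rightarrow> 4 \<Rightarrow> 4 \<Rightarrow> pt \<Rightarrow> complex" where
  "riemann_up g m j k l p =
     pd k (christoffel g m l j) p - pd l (christoffel g m k j) p
     + (\<Sum>n\<in>UNIV. christoffel g m k n p * christoffel g n l j p
                  - christoffel g m l n p * christoffel g n k j p)"

fun riemann :: "(pt \<Rightarrow> complex^4^4) \<Rightarrow> tensor" where
  "riemann g [i, j, k, l] p = (\<Sum>m\<in>UNIV. g p $ i $ m * riemann_up g m j k l p)"
| "riemann g _ p = 0"

text \<open>The derivative index comes first: \<open>cov_deriv g T (l # is)\<close> is \<open>\<nabla>\<^sub>l T\<close> evaluated at \<open>is\<close>.\<close>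

fun cov_deriv :: "(pt \<Rightarrow> complex^4^4) \<Rightarrow> tensor \<Rightarrow> tensor" where
  "cov_deriv g T (l # is) p =
     pd l (T is) p
     - (\<Sum>k<length is. \<Sum>m\<in>UNIV. christoffel g m l (is ! k) p * T (is[k := m]) p)"
| "cov_deriv g T [] p = 0"

definition nabla_riemann :: "(pt \<Rightarrow> complex^4^4) \<Rightarrow> nat \<Rightarrow> tensor" where
  "nabla_riemann g r = (cov_deriv g ^^ r) (riemann g)"


subsection \<open>Vacuum pp-waves and the normalized tetrad\<close>

text \<open>
  The domain is taken simply connected (hence connected): this is the precise sense of a
  ``small'' connected domain, on which locally constant data have no monodromy.
\<close>

definition vacuum_pp_wave :: "pt set \<Rightarrow> (complex \<Rightarrow> real \<Rightarrow> complex) \<Rightarrow> bool" where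
  "vacuum_pp_wave U f \<longleftrightarrow>
     open U \<and> U \<noteq> {} \<and> simply_connected U \<and>
     smooth_on (base U) (\<lambda>(z, u). f z u) \<and>
     (\<forall>u. (\<lambda>z. f z u) holomorphic_on {z. (z, u) \<in> base U}) \<and>
     (\<forall>(z, u)\<in>base U. (deriv ^^ 2) (\<lambda>w. f w u) z \<noteq> 0)"

text \<open>A smooth branch of \<open>a = log f\<^sub>\<zeta>\<^sub>\<zeta> / 4\<close>.\<close>

definition log_branch :: "pt set \<Rightarrow> (complex \<Rightarrow> real \<Rightarrow> complex) \<Rightarrow> (complex \<Rightarrow> real \<Rightarrow> complex) \<Rightarrow> bool" where
  "log_branch U f a \<longleftrightarrow>
     smooth_on (base U) (\<lambda>(z, u). a z u) \<and>
     (\<forall>(z, u)\<in>base U. exp (4 * a z u) = (deriv ^^ 2) (\<lambda>w. f w u) z)"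

text \<open>The function \<open>Z\<close> with \<open>\<zeta> = Z(a, u)\<close>. Only its values on the range of \<open>(a, u)\<close> matter.\<close>

definition inverse_fun :: "pt set \<Rightarrow> (complex \<Rightarrow> real \<Rightarrow> complex) \<Rightarrow> (complex \<Rightarrow> real \<Rightarrow> complex) \<Rightarrow> bool" where
  "inverse_fun U a Z \<longleftrightarrow>
     smooth_on ((\<lambda>(z, u). (a z u, u)) ` base U) (\<lambda>(b, u). Z b u) \<and>
     (\<forall>(z, u)\<in>base U. Z (a z u) u = z)"

definition Z_u :: "(complex \<Rightarrow> real \<Rightarrow> complex) \<Rightarrow> complex \<Rightarrow> real \<Rightarrow> complex" where
  "Z_u Z b u = vector_derivative (\<lambda>s. Z b s) (at u)"

definition alpha :: "(complex \<Rightarrow> real \<Rightarrow> complex) \<Rightarrow> pt \<Rightarrow> complex" where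
  "alpha a = (\<lambda>(z, u, v). exp (a z u - cnj (a z u)) * cnj (deriv (\<lambda>w. a w u) z))"

definition nu :: "(complex \<Rightarrow> real \<Rightarrow> complex) \<Rightarrow> (complex \<Rightarrow> real \<Rightarrow> complex) \<Rightarrow>
    (complex \<Rightarrow> real \<Rightarrow> complex) \<Rightarrow> pt \<Rightarrow> complex" where
  "nu f a Z = (\<lambda>(z, u, v).
     exp (- a z u - 3 * cnj (a z u)) *
     (Z_u (Z_u Z) (a z u) u + cnj (deriv (\<lambda>w. f w u) z)))"

text \<open>Row \<open>b\<close> holds the components of \<open>\<omega>\<^sup>b\<close> with respect to \<open>d\<zeta>, d\<zeta>\<^sup>*, du, dv\<close>.\<close>

definition coframe_matrix :: "(complex \<Rightarrow> real \<Rightarrow> complex) \<Rightarrow> (complex \<Rightarrow> real \<Rightarrow> complex) \<Rightarrow>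
    (complex \<Rightarrow> real \<Rightarrow> complex) \<Rightarrow> pt \<Rightarrow> complex^4^4" where
  "coframe_matrix f a Z = (\<lambda>(z, u, v).
     let b = a z u; Zu = Z_u Z b u;
         e = exp (b - cnj b); h = exp (b + cnj b); k = exp (- b - cnj b) in
     vector [vector [e, 0, - e * Zu, 0],
             vector [0, cnj e, - cnj (e * Zu), 0],
             vector [0, 0, h, 0],
             vector [- k * cnj Zu, - k * Zu, k * (f z u + cnj (f z u) + Zu * cnj Zu), k]])"

definition coframe :: "(complex \<Rightarrow> real \<Rightarrow> complex) \<Rightarrow> (complex \<Rightarrow> real \<Rightarrow> complex) \<Rightarrow>
    (complex \<Rightarrow> real \<Rightarrow> complex) \<Rightarrow> 4 \<Rightarrow> field4" where
  "coframe f a Z b i p = coframe_matrix f a Z p $ b $ i"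

text \<open>The dual frame \<open>(\<delta>, \<delta>\<^sup>*, \<Delta>, D)\<close>: \<open>frame f a Z c\<close> is its \<open>c\<close>-th vector field.\<close>

definition frame :: "(complex \<Rightarrow> real \<Rightarrow> complex) \<Rightarrow> (complex \<Rightarrow> real \<Rightarrow> complex) \<Rightarrow>
    (complex \<Rightarrow> real \<Rightarrow> complex) \<Rightarrow> 4 \<Rightarrow> field4" where
  "frame f a Z c i p = matrix_inv (coframe_matrix f a Z p) $ i $ c"

text \<open>The vector field \<open>V\<^sup>1 \<delta> + V\<^sup>2 \<delta>\<^sup>* + V\<^sup>3 \<Delta> + V\<^sup>4 D\<close>.\<close>

definition of_frame :: "(complex \<Rightarrow> real \<Rightarrow> complex) \<Rightarrow> (complex \<Rightarrow> real \<Rightarrow> complex) \<Rightarrow>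
    (complex \<Rightarrow> real \<Rightarrow> complex) \<Rightarrow> field4 \<Rightarrow> field4" where
  "of_frame f a Z V i p = (\<Sum>c\<in>UNIV. V c p * frame f a Z c i p)"

definition tetrad_comp :: "(complex \<Rightarrow> real \<Rightarrow> complex) \<Rightarrow> (complex \<Rightarrow> real \<Rightarrow> complex) \<Rightarrow>
    (complex \<Rightarrow> real \<Rightarrow> complex) \<Rightarrow> tensor \<Rightarrow> tensor" where
  "tetrad_comp f a Z T cs p =
     (\<Sum>is | length is = length cs. T is p * (\<Prod>k<length cs. frame f a Z (cs ! k) (is ! k) p))"


subsection \<open>Invariant count\<close>

definition curvature_invariants :: "(complex \<Rightarrow> real \<Rightarrow> complex) \<Rightarrow> (complex \<Rightarrow> real \<Rightarrow> complex) \<Rightarrow>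
    (complex \<Rightarrow> real \<Rightarrow> complex) \<Rightarrow> nat \<Rightarrow> (pt \<Rightarrow> complex) set" where
  "curvature_invariants f a Z q =
     {tetrad_comp f a Z (nabla_riemann (pp_metric f) r) cs | r cs. r \<le> q \<and> length cs = 4 + r}"

text \<open>
  The set of invariants is closed under conjugation, so the complex rank of the differentials
  equals the real rank of the differentials of the real and imaginary parts.
\<close>

definition differential_rank :: "(pt \<Rightarrow> complex) set \<Rightarrow> pt \<Rightarrow> nat" where
  "differential_rank \<F> p = vec.dim ((\<lambda>F. (\<chi> i. pd i F p) :: complex^4) ` \<F>)"

text \<open>
  \<open>invariant_count U f a Z [t\<^sub>0, \<dots>, t\<^sub>q]\<close>: the ranks are constant on \<open>U\<close> with these values, and
  \<open>q \<ge> 2\<close> is the first order with \<open>t\<^sub>q = t\<^sub>q\<^sub>-\<^sub>1\<close>.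
\<close>

definition invariant_count :: "pt set \<Rightarrow> (complex \<Rightarrow> real \<Rightarrow> complex) \<Rightarrow> (complex \<Rightarrow> real \<Rightarrow> complex) \<Rightarrow>
    (complex \<Rightarrow> real \<Rightarrow> complex) \<Rightarrow> nat list \<Rightarrow> bool" where
  "invariant_count U f a Z ts \<longleftrightarrow>
     (let q = length ts - 1 in
      2 \<le> q \<and> ts ! 0 = 0 \<and>
      (\<forall>r\<in>{1..q}. \<forall>p\<in>U. differential_rank (curvature_invariants f a Z r) p = ts ! r) \<and>
      ts ! q = ts ! (q - 1) \<and>
      (\<forall>r. 2 \<le> r \<and> r < q \<longrightarrow> ts ! r \<noteq> ts ! (r - 1)))"


subsection \<open>Local isometries\<close>

definition killing_on :: "(pt \<Rightarrow> complex^4^4) \<Rightarrow> pt set \<Rightarrow> field4 \<Rightarrow> bool" where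
  "killing_on g N X \<longleftrightarrow>
     (\<forall>i. smooth_on N (X i)) \<and> real_field_on N X \<and>
     (\<forall>p\<in>N. \<forall>i j. (\<Sum>l\<in>UNIV. X l p * pd l (\<lambda>q. g q $ i $ j) p
                          + g p $ l $ j * pd i (X l) p + g p $ i $ l * pd j (X l) p) = 0)"

text \<open>
  The dimension of the local isometry group at \<open>p\<close> is the dimension of its Lie algebra, the real
  vector space of germs at \<open>p\<close> of Killing vector fields; \<open>B\<close> is a basis of it.
\<close>

definition local_isometry_dim :: "(pt \<Rightarrow> complex^4^4) \<Rightarrow> pt set \<Rightarrow> pt \<Rightarrow> nat \<Rightarrow> bool" where
  "local_isometry_dim g U p n \<longleftrightarrow>
     (\<exists>N B. open N \<and> p \<in> N \<and> N \<subseteq> U \<and> (\<forall>j<n. killing_on g N (B j)) \<and>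
        (\<forall>c :: nat \<Rightarrow> real.
           (\<forall>\<^sub>F x in nhds p. \<forall>i. (\<Sum>j<n. complex_of_real (c j) * B j i x) = 0)
           \<longrightarrow> (\<forall>j<n. c j = 0)) \<and>
        (\<forall>M X. open M \<and> p \<in> M \<and> M \<subseteq> U \<and> killing_on g M X \<longrightarrow>
           (\<exists>c :: nat \<Rightarrow> real.
              \<forall>\<^sub>F x in nhds p. \<forall>i. X i x = (\<Sum>j<n. complex_of_real (c j) * B j i x))))"

end

theory Submission
  imports Defs
begin

text \<open>
  In the coordinates \<open>(a, a\<^sup>*, u)\<close> put \<open>x = V a\<close> and \<open>Y = V u\<close>. If \<open>V\<close> preserves \<open>\<omega>\<^sup>1\<close> and
  \<open>\<omega>\<^sup>3\<close>, then \<open>x\<close> is constant, \<open>Y = \<rho> - 2 Re x u\<close> and \<open>V\<close> annihilates \<open>\<alpha>\<close>, \<open>\<delta>\<^sup>*\<alpha>\<close> and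
  \<open>\<mu>\<close>; since all invariants up to second order live on the three-dimensional space of \<open>(\<zeta>, u)\<close>,
  condition (b) then bounds their rank by 2. Conversely, a count \<open>(0, 2, 2)\<close> means that the common
  kernel direction \<open>k\<close> of \<open>d\<alpha>\<close> and \<open>d\<alpha>\<^sup>*\<close>, which is an explicit cross product, also annihilates
  the second-order invariants. Differentiating \<open>k \<alpha> = 0\<close> shows that, in the components
  \<open>(x, x\<^sup>*, Y + 2 Re x u)\<close>, every derivative of \<open>k\<close> is a multiple of \<open>k\<close>. So its direction is constant,
  which yields \<open>V\<close> globally on \<open>U\<close>, also across the points where \<open>Y = 0\<close>.

  The Riemann tensor is \<open>f\<^sub>\<zeta>\<^sub>\<zeta> (d\<zeta> \<and> du)\<^sup>2\<close> plus its conjugate with \<open>d\<zeta> \<and> du\<close> parallel, so its covariant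
  derivatives amount to those of the scalar \<open>f\<^sub>\<zeta>\<^sub>\<zeta> = exp (4 a)\<close>. The same pair \<open>(x, Y)\<close> determines a Killing
  field up to a multiple of \<open>\<partial>\<^sub>v\<close>, and its \<open>\<partial>\<^sub>v\<close> component exists because \<open>V \<nu> = 0\<close>.
\<close>

subsection \<open>Calculus of smooth functions\<close>

text \<open>All computing is done in the coordinates (\<zeta>, u): \<open>r\<close> and
  \<open>q\<close> are the pullbacks of Z_a and Z_u, so the inverse function enters through a few
  identities only. With L = log Z_a one has L_a = \<open>pd 1 r\<close>, L_u = \<open>pd 1 q\<close>
  and cnj \<alpha> = exp (cnj a - a - L). Hence V \<alpha> = 0 is the linear equation V L = cnj x -
  x, and its derivatives govern L_a and \<mu>. The shift by 2 Re x u stems from \<omega>^3 = exp (a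
  + cnj a) du, whose invariance makes the u-derivative of Y equal to - 2 Re x. Neither x nor Y can
  serve as a normalising factor, since either may vanish. Constancy of the direction is therefore
  read off from quotients of quadratic expressions by a positive norm square. For Killing fields
  f_\<zeta>\<zeta> is cancelled twice: first to see that X u depends on u alone, then that X a is
  constant. The upper bound 2 comes from the kernel line at a single point together with
  \<partial>_v. Existence is only local, because the \<partial>_v component requires an integration
  in u over a box.\<close>

lemma has_derivative_frechet:
  assumes "open S" "x \<in> S" "F differentiable_on S"
  shows "(F has_derivative frechet_derivative F (at x)) (at x)"
  using assms frechet_derivative_works differentiable_on_eq_differentiable_at by metis

lemma frechet_derivative_eqI:
  "(F has_derivative F') (at x) \<Longrightarrow> frechet_derivative F (at x) = F'"
  by (metis frechet_derivative_at)

lemma frechet_derivative_cong: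
  assumes "open S" "x \<in> S" "\<And>y. y \<in> S \<Longrightarrow> F y = G y"
  shows "frechet_derivative F (at x) = frechet_derivative G (at x)"
proof -
  have "(F has_derivative f') (at x) \<longleftrightarrow> (G has_derivative f') (at x)" for f'
    using has_derivative_transform_within_open[OF _ assms(1,2)] assms(3) by metis
  then show ?thesis by (simp add: frechet_derivative_def)
qed

lemma differentiable_on_cong:
  assumes "\<And>y. y \<in> S \<Longrightarrow> F y = G y"
  shows "F differentiable_on S \<longleftrightarrow> G differentiable_on S"
  unfolding differentiable_on_def using assms
  by (metis (no_types, lifting) differentiable_transform_within zero_less_one)

lemma C_diff_on_cong:
  assumes "open S" "\<And>y. y \<in> S \<Longrightarrow> F y = G y"
  shows "C_diff_on k S F \<longleftrightarrow> C_diff_on k S G"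
  using assms(2)
proof (induction k arbitrary: F G)
  case 0
  then show ?case by (simp cong: continuous_on_cong)
next
  case (Suc k)
  have "C_diff_on k S (\<lambda>x. frechet_derivative F (at x) b) \<longleftrightarrow>
        C_diff_on k S (\<lambda>x. frechet_derivative G (at x) b)" for b
    by (rule Suc.IH) (metis Suc.prems assms(1) frechet_derivative_cong)
  with differentiable_on_cong[of S F G, OF Suc.prems] show ?case by simp
qed

lemma C_diff_on_Suc_down: "C_diff_on (Suc k) S F \<Longrightarrow> C_diff_on k S F"
proof (induction k arbitrary: F)
  case 0
  then show ?case by (simp add: differentiable_imp_continuous_on)
next
  case (Suc k)
  then show ?case by auto
qed

lemma C_diff_on_SucI:
  assumes "open S" "\<And>x. x \<in> S \<Longrightarrow> (F has_derivative F' x) (at x)"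
    and "\<And>b. b \<in> Basis \<Longrightarrow> C_diff_on k S (\<lambda>x. F' x b)"
  shows "C_diff_on (Suc k) S F"
proof -
  have "F differentiable_on S"
    using assms(1,2) by (auto simp: differentiable_on_eq_differentiable_at differentiable_def)
  moreover have "C_diff_on k S (\<lambda>x. frechet_derivative F (at x) b)" if "b \<in> Basis" for b
    using assms(3)[OF that] frechet_derivative_eqI[OF assms(2)]
    by (subst C_diff_on_cong[OF assms(1), of _ "\<lambda>x. F' x b"]) auto
  ultimately show ?thesis by simp
qed

lemma C_diff_on_SucD:
  assumes "open S" "C_diff_on (Suc k) S F"
  shows "x \<in> S \<Longrightarrow> (F has_derivative frechet_derivative F (at x)) (at x)"
    and "b \<in> Basis \<Longrightarrow> C_diff_on k S (\<lambda>x. frechet_derivative F (at x) b)"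
    and "C_diff_on k S F"
  using assms C_diff_on_Suc_down[of k S F] by (auto intro: has_derivative_frechet)

lemma C_diff_on_const: "open S \<Longrightarrow> C_diff_on k S (\<lambda>x. c)"
proof (induction k arbitrary: c)
  case (Suc k)
  then show ?case by (intro C_diff_on_SucI[where F' = "\<lambda>_ _. 0"]) auto
qed simp

lemma C_diff_on_add:
  "open S \<Longrightarrow> C_diff_on k S F \<Longrightarrow> C_diff_on k S G \<Longrightarrow> C_diff_on k S (\<lambda>x. F x + G x)"
proof (induction k arbitrary: F G)
  case 0
  then show ?case by (simp add: continuous_on_add)
next
  case (Suc k)
  note d = C_diff_on_SucD[OF Suc.prems(1,2)] C_diff_on_SucD[OF Suc.prems(1,3)]
  show ?case
    by (rule C_diff_on_SucI[OF Suc.prems(1) has_derivative_add[OF d(1) d(4)]])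
      (auto intro!: Suc.IH Suc.prems(1) d)
qed

lemma C_diff_on_bounded_linear:
  "bounded_linear T \<Longrightarrow> open S \<Longrightarrow> C_diff_on k S F \<Longrightarrow> C_diff_on k S (\<lambda>x. T (F x))"
proof (induction k arbitrary: F)
  case 0
  then show ?case by (simp add: bounded_linear.continuous_on)
next
  case (Suc k)
  note d = C_diff_on_SucD[OF Suc.prems(2,3)]
  show ?case
    by (rule C_diff_on_SucI[OF Suc.prems(2) bounded_linear.has_derivative[OF Suc.prems(1) d(1)]])
      (auto intro!: Suc.IH Suc.prems(1,2) d)
qed

lemma C_diff_on_mult:
  fixes F G :: "'a::euclidean_space \<Rightarrow> 'b::real_normed_algebra"
  shows "open S \<Longrightarrow> C_diff_on k S F \<Longrightarrow> C_diff_on k S G \<Longrightarrow> C_diff_on k S (\<lambda>x. F x * G x)"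
proof (induction k arbitrary: F G)
  case 0
  then show ?case by (simp add: continuous_on_mult)
next
  case (Suc k)
  note d = C_diff_on_SucD[OF Suc.prems(1,2)] C_diff_on_SucD[OF Suc.prems(1,3)]
  show ?case
    by (rule C_diff_on_SucI[OF Suc.prems(1) has_derivative_mult[OF d(1) d(4)]])
      (auto intro!: C_diff_on_add Suc.IH Suc.prems(1) d)
qed

lemma C_diff_on_inverse:
  fixes F :: "'a::euclidean_space \<Rightarrow> 'b::real_normed_div_algebra"
  shows "open S \<Longrightarrow> (\<And>x. x \<in> S \<Longrightarrow> F x \<noteq> 0) \<Longrightarrow> C_diff_on k S F \<Longrightarrow> C_diff_on k S (\<lambda>x. inverse (F x))"
proof (induction k arbitrary: F)
  case 0
  then show ?case by (simp add: continuous_on_inverse)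
next
  case (Suc k)
  note d = C_diff_on_SucD[OF Suc.prems(1,3)]
  have i: "C_diff_on k S (\<lambda>x. inverse (F x))"
    using Suc.IH[OF Suc.prems(1,2) d(3)] by simp
  have "C_diff_on k S (\<lambda>x. - (inverse (F x) * frechet_derivative F (at x) b * inverse (F x)))"
    if "b \<in> Basis" for b
    by (intro C_diff_on_bounded_linear[OF bounded_linear_minus[OF bounded_linear_ident]]
        C_diff_on_mult Suc.prems(1) i d(2) that)
  then show ?case
    using Deriv.has_derivative_inverse[OF Suc.prems(2) d(1)]
    by (intro C_diff_on_SucI[OF Suc.prems(1)])
qed

lemma C_diff_on_exp:
  fixes F :: "'a::euclidean_space \<Rightarrow> complex"
  shows "open S \<Longrightarrow> C_diff_on k S F \<Longrightarrow> C_diff_on k S (\<lambda>x. exp (F x))"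
proof (induction k arbitrary: F)
  case 0
  then show ?case by (simp add: continuous_on_exp)
next
  case (Suc k)
  note d = C_diff_on_SucD[OF Suc.prems]
  have "((\<lambda>x. exp (F x)) has_derivative (\<lambda>h. frechet_derivative F (at x) h * exp (F x))) (at x)"
    if "x \<in> S" for x
    using has_derivative_compose[OF d(1)[OF that]
        DERIV_exp[of "F x", unfolded has_field_derivative_def]]
    by (simp add: mult.commute)
  moreover have "C_diff_on k S (\<lambda>x. frechet_derivative F (at x) b * exp (F x))" if "b \<in> Basis" for b
    by (intro C_diff_on_mult Suc.prems(1) Suc.IH d(2,3) that)
  ultimately show ?case by (intro C_diff_on_SucI[OF Suc.prems(1)])
qed

lemma C_diff_on_subset:
  "open T \<Longrightarrow> T \<subseteq> S \<Longrightarrow> C_diff_on k S F \<Longrightarrow> C_diff_on k T F"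
proof (induction k arbitrary: F)
  case 0
  then show ?case using continuous_on_subset by auto
next
  case (Suc k)
  then show ?case using differentiable_on_subset by auto
qed

text \<open>\<open>C_diff_on\<close> differentiates only along basis vectors, so the chain rule
  stays within the definition when the linear map sends each basis vector to a basis vector or to 0.
  The projection that forgets v is of this kind.\<close>

lemma C_diff_on_compose_linear:
  fixes \<pi> :: "'a::euclidean_space \<Rightarrow> 'b::euclidean_space"
  assumes "bounded_linear \<pi>" "open S" "\<And>b. b \<in> Basis \<Longrightarrow> \<pi> b \<in> insert 0 Basis"
  shows "C_diff_on k S G \<Longrightarrow> C_diff_on k (\<pi> -` S) (\<lambda>x. G (\<pi> x))"
proof (induction k arbitrary: G)
  case 0
  then show ?case
    using continuous_on_compose2[of S G "\<pi> -` S" \<pi>] linear_continuous_on[OF assms(1)] by auto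
next
  case (Suc k)
  note d = C_diff_on_SucD[OF assms(2) Suc.prems]
  have op: "open (\<pi> -` S)"
    using assms(1,2) by (simp add: continuous_open_vimage linear_continuous_at)
  have lin: "linear (frechet_derivative G (at y))" if "y \<in> S" for y
    using d(1)[OF that] has_derivative_linear by blast
  show ?case
  proof (rule C_diff_on_SucI[OF op])
    show "((\<lambda>x. G (\<pi> x)) has_derivative (\<lambda>h. frechet_derivative G (at (\<pi> x)) (\<pi> h))) (at x)"
      if "x \<in> \<pi> -` S" for x
      using has_derivative_compose[OF bounded_linear_imp_has_derivative[OF assms(1)] d(1)] that by auto
    fix b :: 'a assume b: "b \<in> Basis"
    show "C_diff_on k (\<pi> -` S) (\<lambda>x. frechet_derivative G (at (\<pi> x)) (\<pi> b))"
    proof (cases "\<pi> b = 0")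
      case True
      then show ?thesis using lin
        by (subst C_diff_on_cong[OF op, of _ "\<lambda>x. 0"]) (auto simp: linear_0 C_diff_on_const op)
    next
      case False
      then have "\<pi> b \<in> Basis" using assms(3)[OF b] by auto
      then show ?thesis using Suc.IH d(2) by blast
    qed
  qed
qed

lemma smooth_on_const [simp, intro]: "open S \<Longrightarrow> smooth_on S (\<lambda>x. c)"
  by (simp add: smooth_on_def C_diff_on_const)

lemma smooth_on_add [intro]:
  "open S \<Longrightarrow> smooth_on S F \<Longrightarrow> smooth_on S G \<Longrightarrow> smooth_on S (\<lambda>x. F x + G x)"
  by (simp add: smooth_on_def C_diff_on_add)

lemma smooth_on_bounded_linear:
  "bounded_linear T \<Longrightarrow> open S \<Longrightarrow> smooth_on S F \<Longrightarrow> smooth_on S (\<lambda>x. T (F x))"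
  by (simp add: smooth_on_def C_diff_on_bounded_linear)

lemma smooth_on_uminus [intro]: "open S \<Longrightarrow> smooth_on S F \<Longrightarrow> smooth_on S (\<lambda>x. - F x)"
  by (rule smooth_on_bounded_linear[OF bounded_linear_minus[OF bounded_linear_ident]])

lemma smooth_on_diff [intro]:
  "open S \<Longrightarrow> smooth_on S F \<Longrightarrow> smooth_on S G \<Longrightarrow> smooth_on S (\<lambda>x. F x - G x)"
  using smooth_on_add[OF _ _ smooth_on_uminus, of S F G] by simp

lemma smooth_on_cnj [intro]: "open S \<Longrightarrow> smooth_on S F \<Longrightarrow> smooth_on S (\<lambda>x. cnj (F x))"
  by (rule smooth_on_bounded_linear[OF bounded_linear_cnj])

lemma smooth_on_mult [intro]:
  fixes F G :: "'a::euclidean_space \<Rightarrow> 'b::real_normed_algebra"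
  shows "open S \<Longrightarrow> smooth_on S F \<Longrightarrow> smooth_on S G \<Longrightarrow> smooth_on S (\<lambda>x. F x * G x)"
  by (simp add: smooth_on_def C_diff_on_mult)

lemma smooth_on_inverse:
  fixes F :: "'a::euclidean_space \<Rightarrow> 'b::real_normed_div_algebra"
  shows "open S \<Longrightarrow> smooth_on S F \<Longrightarrow> (\<And>x. x \<in> S \<Longrightarrow> F x \<noteq> 0) \<Longrightarrow> smooth_on S (\<lambda>x. inverse (F x))"
  by (simp add: smooth_on_def C_diff_on_inverse)

lemma smooth_on_divide:
  fixes F G :: "'a::euclidean_space \<Rightarrow> 'b::real_normed_field"
  shows "open S \<Longrightarrow> smooth_on S F \<Longrightarrow> smooth_on S G \<Longrightarrow> (\<And>x. x \<in> S \<Longrightarrow> G x \<noteq> 0)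
    \<Longrightarrow> smooth_on S (\<lambda>x. F x / G x)"
  by (simp add: divide_inverse smooth_on_mult smooth_on_inverse)

lemma smooth_on_exp [intro]:
  fixes F :: "'a::euclidean_space \<Rightarrow> complex"
  shows "open S \<Longrightarrow> smooth_on S F \<Longrightarrow> smooth_on S (\<lambda>x. exp (F x))"
  by (simp add: smooth_on_def C_diff_on_exp)

lemma smooth_on_power [intro]:
  fixes F :: "'a::euclidean_space \<Rightarrow> complex"
  shows "open S \<Longrightarrow> smooth_on S F \<Longrightarrow> smooth_on S (\<lambda>x. F x ^ n)"
  by (induction n) auto

lemma smooth_on_subset: "open T \<Longrightarrow> T \<subseteq> S \<Longrightarrow> smooth_on S F \<Longrightarrow> smooth_on T F"
  unfolding smooth_on_def using C_diff_on_subset by blast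

lemma smooth_on_cong:
  "open S \<Longrightarrow> (\<And>y. y \<in> S \<Longrightarrow> F y = G y) \<Longrightarrow> smooth_on S F \<longleftrightarrow> smooth_on S G"
  unfolding smooth_on_def using C_diff_on_cong by blast

lemma smooth_on_compose_linear:
  fixes \<pi> :: "'a::euclidean_space \<Rightarrow> 'b::euclidean_space"
  assumes "bounded_linear \<pi>" "open S" "\<And>b. b \<in> Basis \<Longrightarrow> \<pi> b \<in> insert 0 Basis"
    and "smooth_on S G"
  shows "smooth_on (\<pi> -` S) (\<lambda>x. G (\<pi> x))"
  using assms C_diff_on_compose_linear[OF assms(1-3)] unfolding smooth_on_def by blast

lemma smooth_on_imp_differentiable_on: "smooth_on S F \<Longrightarrow> F differentiable_on S"
  unfolding smooth_on_def by (metis C_diff_on.simps(2))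

lemma smooth_on_imp_differentiable: "open S \<Longrightarrow> x \<in> S \<Longrightarrow> smooth_on S F \<Longrightarrow> F differentiable (at x)"
  using smooth_on_imp_differentiable_on differentiable_on_eq_differentiable_at by blast

lemma smooth_on_imp_continuous_on: "smooth_on S F \<Longrightarrow> continuous_on S F"
  unfolding smooth_on_def by (metis C_diff_on.simps(1))

lemma smooth_on_frechet_derivative:
  "smooth_on S F \<Longrightarrow> b \<in> Basis \<Longrightarrow> smooth_on S (\<lambda>x. frechet_derivative F (at x) b)"
  unfolding smooth_on_def by (metis C_diff_on.simps(2))

lemma smooth_onI:
  assumes "open S" "\<And>x. x \<in> S \<Longrightarrow> (F has_derivative F' x) (at x)"
    and "\<And>b. b \<in> Basis \<Longrightarrow> smooth_on S (\<lambda>x. F' x b)"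
  shows "smooth_on S F"
  unfolding smooth_on_def
proof
  fix k
  have "C_diff_on (Suc k) S F"
    using assms by (intro C_diff_on_SucI[of S F F']) (auto simp: smooth_on_def)
  then show "C_diff_on k S F" by (rule C_diff_on_Suc_down)
qed

subsection \<open>Symmetry of second derivatives\<close>

lemma DERIV_along_line:
  fixes F :: "'a::euclidean_space \<Rightarrow> real"
  assumes "(F has_derivative F') (at (p + \<sigma> *\<^sub>R b))"
  shows "((\<lambda>s. F (p + s *\<^sub>R b)) has_real_derivative F' b) (at \<sigma>)"
proof -
  have "((\<lambda>s. p + s *\<^sub>R b) has_derivative (\<lambda>h. h *\<^sub>R b)) (at \<sigma>)"
    by (auto intro!: derivative_eq_intros)
  from has_derivative_compose[OF this assms]
  have "((\<lambda>s. F (p + s *\<^sub>R b)) has_derivative (\<lambda>h. F' (h *\<^sub>R b))) (at \<sigma>)" .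
  moreover have "F' (h *\<^sub>R b) = F' b * h" for h
    using has_derivative_linear[OF assms] by (simp add: linear_cmul)
  ultimately show ?thesis by (simp add: has_field_derivative_def)
qed

text \<open>The mean value theorem is applied twice, first along \<open>b\<close> to the difference
  of \<open>F\<close> on two parallel lines, then along \<open>c\<close> to the derivative. The
  second difference on the left is symmetric in \<open>b\<close> and \<open>c\<close>, which is the
  source of the symmetry of second derivatives.\<close>

lemma second_difference_mean_value:
  fixes F :: "'a::euclidean_space \<Rightarrow> real"
  assumes S: "open S" and s: "0 < s"
    and box: "\<And>\<sigma> \<tau>. 0 \<le> \<sigma> \<Longrightarrow> \<sigma> \<le> s \<Longrightarrow> 0 \<le> \<tau> \<Longrightarrow> \<tau> \<le> s \<Longrightarrow> p + \<sigma> *\<^sub>R b + \<tau> *\<^sub>R c \<in> S"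
    and F: "F differentiable_on S" and Fb: "(\<lambda>x. frechet_derivative F (at x) b) differentiable_on S"
  shows "\<exists>\<sigma> \<tau>. 0 \<le> \<sigma> \<and> \<sigma> \<le> s \<and> 0 \<le> \<tau> \<and> \<tau> \<le> s \<and>
    F (p + s *\<^sub>R b + s *\<^sub>R c) - F (p + s *\<^sub>R b) - F (p + s *\<^sub>R c) + F p
    = s * s * frechet_derivative (\<lambda>x. frechet_derivative F (at x) b) (at (p + \<sigma> *\<^sub>R b + \<tau> *\<^sub>R c)) c"
proof -
  define Db where "Db = (\<lambda>x. frechet_derivative F (at x) b)"
  have box0: "p + \<sigma> *\<^sub>R b \<in> S" if "0 \<le> \<sigma>" "\<sigma> \<le> s" for \<sigma>
    using box[OF that, of 0] s by simp
  have "\<exists>\<sigma>>0. \<sigma> < s \<and> (F ((p + s *\<^sub>R c) + s *\<^sub>R b) - F (p + s *\<^sub>R b)) - (F ((p + s *\<^sub>R c) + 0 *\<^sub>R b) - F (p + 0 *\<^sub>R b))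
      = (s - 0) * (Db ((p + s *\<^sub>R c) + \<sigma> *\<^sub>R b) - Db (p + \<sigma> *\<^sub>R b))"
  proof (rule MVT2[OF s])
    fix x assume x: "0 \<le> x" "x \<le> s"
    have "(p + s *\<^sub>R c) + x *\<^sub>R b \<in> S" using box[OF x, of s] s by (simp add: algebra_simps)
    then show "((\<lambda>x. F ((p + s *\<^sub>R c) + x *\<^sub>R b) - F (p + x *\<^sub>R b)) has_real_derivative
        Db ((p + s *\<^sub>R c) + x *\<^sub>R b) - Db (p + x *\<^sub>R b)) (at x)"
      unfolding Db_def using box0[OF x]
      by (intro DERIV_diff DERIV_along_line has_derivative_frechet[OF S _ F])
  qed
  then obtain \<sigma> where \<sigma>: "0 < \<sigma>" "\<sigma> < s"
    and e1: "F (p + s *\<^sub>R b + s *\<^sub>R c) - F (p + s *\<^sub>R b) - F (p + s *\<^sub>R c) + F p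
      = s * (Db ((p + \<sigma> *\<^sub>R b) + s *\<^sub>R c) - Db ((p + \<sigma> *\<^sub>R b) + 0 *\<^sub>R c))"
    by (auto simp: algebra_simps)
  have "\<exists>\<tau>>0. \<tau> < s \<and> Db ((p + \<sigma> *\<^sub>R b) + s *\<^sub>R c) - Db ((p + \<sigma> *\<^sub>R b) + 0 *\<^sub>R c)
      = (s - 0) * frechet_derivative Db (at ((p + \<sigma> *\<^sub>R b) + \<tau> *\<^sub>R c)) c"
  proof (rule MVT2[OF s])
    fix x assume x: "0 \<le> x" "x \<le> s"
    have "(p + \<sigma> *\<^sub>R b) + x *\<^sub>R c \<in> S" using box[of \<sigma>] \<sigma> x by auto
    then show "((\<lambda>x. Db ((p + \<sigma> *\<^sub>R b) + x *\<^sub>R c)) has_real_derivative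
        frechet_derivative Db (at ((p + \<sigma> *\<^sub>R b) + x *\<^sub>R c)) c) (at x)"
      by (rule DERIV_along_line[OF has_derivative_frechet[OF S _ Fb[folded Db_def]]])
  qed
  then obtain \<tau> where "0 < \<tau>" "\<tau> < s" "Db ((p + \<sigma> *\<^sub>R b) + s *\<^sub>R c) - Db ((p + \<sigma> *\<^sub>R b) + 0 *\<^sub>R c)
      = s * frechet_derivative Db (at ((p + \<sigma> *\<^sub>R b) + \<tau> *\<^sub>R c)) c"
    by auto
  with e1 \<sigma> show ?thesis
    by (intro exI[of _ \<sigma>] exI[of _ \<tau>]) (simp add: Db_def)
qed

text \<open>Both mixed derivatives arise from the same second difference, so on each small
  parallelogram at \<open>p\<close> they take a common value, at possibly different points.
  Continuity carries this to \<open>p\<close> itself.\<close>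

lemma frechet_derivative_commute_real:
  fixes F :: "'a::euclidean_space \<Rightarrow> real"
  assumes S: "open S" and p: "p \<in> S" and F: "F differentiable_on S"
    and Fb: "(\<lambda>x. frechet_derivative F (at x) b) differentiable_on S"
    and Fc: "(\<lambda>x. frechet_derivative F (at x) c) differentiable_on S"
    and cb: "continuous_on S (\<lambda>y. frechet_derivative (\<lambda>x. frechet_derivative F (at x) b) (at y) c)"
    and bc: "continuous_on S (\<lambda>y. frechet_derivative (\<lambda>x. frechet_derivative F (at x) c) (at y) b)"
  shows "frechet_derivative (\<lambda>x. frechet_derivative F (at x) b) (at p) c
       = frechet_derivative (\<lambda>x. frechet_derivative F (at x) c) (at p) b"
proof -
  define Q1 where "Q1 = (\<lambda>y. frechet_derivative (\<lambda>x. frechet_derivative F (at x) b) (at y) c)"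
  define Q2 where "Q2 = (\<lambda>y. frechet_derivative (\<lambda>x. frechet_derivative F (at x) c) (at y) b)"
  have "\<bar>Q1 p - Q2 p\<bar> \<le> e" if e: "0 < e" for e
  proof -
    obtain d0 where d0: "d0 > 0" "ball p d0 \<subseteq> S" using S p openE by blast
    obtain d1 where d1: "d1 > 0" "\<And>y. y \<in> S \<Longrightarrow> dist y p < d1 \<Longrightarrow> dist (Q1 y) (Q1 p) < e / 2"
      using cb p e unfolding continuous_on_iff Q1_def by (meson half_gt_zero)
    obtain d2 where d2: "d2 > 0" "\<And>y. y \<in> S \<Longrightarrow> dist y p < d2 \<Longrightarrow> dist (Q2 y) (Q2 p) < e / 2"
      using bc p e unfolding continuous_on_iff Q2_def by (meson half_gt_zero)
    define d where "d = min d0 (min d1 d2)"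
    have d: "d > 0" using d0 d1 d2 by (simp add: d_def)
    \<comment> \<open>The summand 1 keeps the denominator positive even for b = c = 0 and makes the
      parallelogram lie strictly within distance \<open>d\<close> of \<open>p\<close>.\<close>
    define s where "s = d / (norm b + norm c + 1)"
    have nb: "norm b + norm c + 1 > 0" by (smt (verit) norm_ge_zero)
    have s: "s > 0" using d nb by (simp add: s_def)
    have sd: "s * (norm b + norm c) < d"
      using d nb unfolding s_def by (simp add: divide_simps)
    have near: "dist (p + \<sigma> *\<^sub>R b + \<tau> *\<^sub>R c) p < d" if "0 \<le> \<sigma>" "\<sigma> \<le> s" "0 \<le> \<tau>" "\<tau> \<le> s" for \<sigma> \<tau>
    proof -
      have "dist (p + \<sigma> *\<^sub>R b + \<tau> *\<^sub>R c) p = norm (\<sigma> *\<^sub>R b + \<tau> *\<^sub>R c)"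
        by (simp add: dist_norm algebra_simps)
      also have "\<dots> \<le> \<sigma> * norm b + \<tau> * norm c"
        using that norm_triangle_ineq[of "\<sigma> *\<^sub>R b" "\<tau> *\<^sub>R c"] by simp
      also have "\<dots> \<le> s * norm b + s * norm c"
        using that by (intro add_mono mult_right_mono) auto
      finally show ?thesis using sd by (simp add: algebra_simps)
    qed
    have inS: "p + \<sigma> *\<^sub>R b + \<tau> *\<^sub>R c \<in> S" if "0 \<le> \<sigma>" "\<sigma> \<le> s" "0 \<le> \<tau>" "\<tau> \<le> s" for \<sigma> \<tau>
      using near[OF that] d0 by (auto simp: d_def dist_commute)
    have inS': "p + \<sigma> *\<^sub>R c + \<tau> *\<^sub>R b \<in> S" if "0 \<le> \<sigma>" "\<sigma> \<le> s" "0 \<le> \<tau>" "\<tau> \<le> s" for \<sigma> \<tau>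
      using inS[OF that(3,4,1,2)] by (simp add: algebra_simps)
    obtain \<sigma> \<tau> where 1: "0 \<le> \<sigma>" "\<sigma> \<le> s" "0 \<le> \<tau>" "\<tau> \<le> s"
      "F (p + s *\<^sub>R b + s *\<^sub>R c) - F (p + s *\<^sub>R b) - F (p + s *\<^sub>R c) + F p
        = s * s * Q1 (p + \<sigma> *\<^sub>R b + \<tau> *\<^sub>R c)"
      using second_difference_mean_value[OF S s inS F Fb] unfolding Q1_def by blast
    obtain \<sigma>' \<tau>' where 2: "0 \<le> \<sigma>'" "\<sigma>' \<le> s" "0 \<le> \<tau>'" "\<tau>' \<le> s"
      "F (p + s *\<^sub>R c + s *\<^sub>R b) - F (p + s *\<^sub>R c) - F (p + s *\<^sub>R b) + F p
        = s * s * Q2 (p + \<sigma>' *\<^sub>R c + \<tau>' *\<^sub>R b)"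
      using second_difference_mean_value[OF S s inS' F Fc] unfolding Q2_def by blast
    have "s * s * Q1 (p + \<sigma> *\<^sub>R b + \<tau> *\<^sub>R c) = s * s * Q2 (p + \<sigma>' *\<^sub>R c + \<tau>' *\<^sub>R b)"
      using 1(5) 2(5) by (simp add: algebra_simps)
    then have eq: "Q1 (p + \<sigma> *\<^sub>R b + \<tau> *\<^sub>R c) = Q2 (p + \<tau>' *\<^sub>R b + \<sigma>' *\<^sub>R c)"
      using s by (simp add: algebra_simps)
    have "dist (Q1 (p + \<sigma> *\<^sub>R b + \<tau> *\<^sub>R c)) (Q1 p) < e / 2"
      using d1(2)[OF inS[OF 1(1-4)]] near[OF 1(1-4)] by (simp add: d_def)
    moreover have "dist (Q2 (p + \<tau>' *\<^sub>R b + \<sigma>' *\<^sub>R c)) (Q2 p) < e / 2"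
      using d2(2)[OF inS[OF 2(3,4,1,2)]] near[OF 2(3,4,1,2)] by (simp add: d_def)
    ultimately show ?thesis unfolding eq dist_real_def by linarith
  qed
  then have "\<bar>Q1 p - Q2 p\<bar> \<le> 0" by (rule field_le_epsilon[of _ 0, simplified])
  then show ?thesis by (simp add: Q1_def Q2_def)
qed

lemma frechet_derivative_bounded_linear:
  assumes "bounded_linear T" "open S" "x \<in> S" "F differentiable_on S"
  shows "frechet_derivative (\<lambda>x. T (F x)) (at x) b = T (frechet_derivative F (at x) b)"
  using frechet_derivative_eqI[OF bounded_linear.has_derivative[OF assms(1) has_derivative_frechet[OF assms(2-4)]]]
  by simp

text \<open>The mean value theorem needs real values, so the real case is applied to
  \<open>Re\<close> and \<open>Im\<close>, both treated as a bounded linear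
  \<open>T\<close>.\<close>

lemma frechet_derivative_commute:
  fixes F :: "'a::euclidean_space \<Rightarrow> complex"
  assumes S: "open S" and p: "p \<in> S" and F: "smooth_on S F" and b: "b \<in> Basis" and c: "c \<in> Basis"
  shows "frechet_derivative (\<lambda>x. frechet_derivative F (at x) b) (at p) c
       = frechet_derivative (\<lambda>x. frechet_derivative F (at x) c) (at p) b"
proof -
  have main: "T (frechet_derivative (\<lambda>x. frechet_derivative F (at x) b) (at p) c)
      = T (frechet_derivative (\<lambda>x. frechet_derivative F (at x) c) (at p) b)"
    if T: "bounded_linear T" for T :: "complex \<Rightarrow> real"
  proof -
    have sT: "smooth_on S (\<lambda>x. T (F x))" using smooth_on_bounded_linear[OF T S F] .
    have 2: "frechet_derivative (\<lambda>x. frechet_derivative (\<lambda>x. T (F x)) (at x) b') (at p) c'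
        = T (frechet_derivative (\<lambda>x. frechet_derivative F (at x) b') (at p) c')"
      if "b' \<in> Basis" for b' c'
    proof -
      have "frechet_derivative (\<lambda>x. frechet_derivative (\<lambda>x. T (F x)) (at x) b') (at p)
         = frechet_derivative (\<lambda>x. T (frechet_derivative F (at x) b')) (at p)"
        by (rule frechet_derivative_cong[OF S p])
          (rule frechet_derivative_bounded_linear[OF T S _ smooth_on_imp_differentiable_on[OF F]])
      then show ?thesis
        using frechet_derivative_bounded_linear[OF T S p smooth_on_imp_differentiable_on]
          smooth_on_frechet_derivative[OF F that] by metis
    qed
    have "frechet_derivative (\<lambda>x. frechet_derivative (\<lambda>x. T (F x)) (at x) b) (at p) c
       = frechet_derivative (\<lambda>x. frechet_derivative (\<lambda>x. T (F x)) (at x) c) (at p) b"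
      by (rule frechet_derivative_commute_real[OF S p])
        (use sT b c in \<open>auto intro!: smooth_on_imp_differentiable_on smooth_on_imp_continuous_on
          smooth_on_frechet_derivative\<close>)
    then show ?thesis using 2 b c by simp
  qed
  show ?thesis
    using main[OF bounded_linear_Re] main[OF bounded_linear_Im] by (rule complex_eqI)
qed

subsection \<open>The operators \<open>\<partial>\<^sub>\<zeta>, \<partial>\<^sub>\<zeta>\<^sub>*, \<partial>\<^sub>u, \<partial>\<^sub>v\<close>\<close>

lemma index4_neq [simp]:
  "(1::4) \<noteq> 2" "(1::4) \<noteq> 3" "(1::4) \<noteq> 4" "(2::4) \<noteq> 1" "(2::4) \<noteq> 3" "(2::4) \<noteq> 4"
  "(3::4) \<noteq> 1" "(3::4) \<noteq> 2" "(3::4) \<noteq> 4" "(4::4) \<noteq> 1" "(4::4) \<noteq> 2" "(4::4) \<noteq> 3"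
  by simp_all

lemma index4_cases [case_names 1 2 3 4]:
  fixes i :: 4
  obtains "i = 1" | "i = 2" | "i = 3" | "i = 4"
  using exhaust_4[of i] by blast

lemma Basis_pt: "(Basis :: pt set) = {(1, 0, 0), (\<i>, 0, 0), (0, 1, 0), (0, 0, 1)}"
  by (simp add: Basis_prod_def Basis_complex_def zero_prod_def insert_commute)

text \<open>Turns every \<open>pd i\<close> into one fixed complex combination of directional
  derivatives, Wirtinger factors included, so that the rules of calculus can be proved for all four
  indices at once.\<close>

definition pd_coeff :: "4 \<Rightarrow> pt \<Rightarrow> complex" where
  "pd_coeff i b =
     (if i = 1 then cnj (fst b) / 2 else if i = 2 then fst b / 2
      else if i = 3 then of_real (fst (snd b)) else of_real (snd (snd b)))"

lemma pd_eq_sum: "pd i F p = (\<Sum>b\<in>Basis. pd_coeff i b * frechet_derivative F (at p) b)"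
  unfolding pd_def Basis_pt Let_def
  by (cases i rule: index4_cases) (auto simp: pd_coeff_def field_simps)

lemma pd_eq_sumI:
  "(F has_derivative F') (at p) \<Longrightarrow> pd i F p = (\<Sum>b\<in>Basis. pd_coeff i b * F' b)"
  by (simp add: pd_eq_sum frechet_derivative_eqI)

lemma has_derivative_pd:
  assumes "F differentiable (at p)"
  shows "(F has_derivative (\<lambda>h. fst h * pd 1 F p + cnj (fst h) * pd 2 F p
           + of_real (fst (snd h)) * pd 3 F p + of_real (snd (snd h)) * pd 4 F p)) (at p)"
proof -
  let ?d = "frechet_derivative F (at p)"
  have lin: "linear ?d" using assms linear_frechet_derivative by blast
  have "?d h = fst h * pd 1 F p + cnj (fst h) * pd 2 F p
           + of_real (fst (snd h)) * pd 3 F p + of_real (snd (snd h)) * pd 4 F p" for h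
  proof -
    obtain z u v where h: "h = (z, u, v)" by (cases h) auto
    have hb: "h = Re z *\<^sub>R (1, 0, 0) + Im z *\<^sub>R (\<i>, 0, 0) + u *\<^sub>R (0, 1, 0) + v *\<^sub>R (0, 0, 1)"
      by (simp add: h complex_eq_iff)
    have "?d h = Re z *\<^sub>R ?d (1, 0, 0) + Im z *\<^sub>R ?d (\<i>, 0, 0) + u *\<^sub>R ?d (0, 1, 0) + v *\<^sub>R ?d (0, 0, 1)"
      by (subst hb) (simp only: linear_add[OF lin] linear_cmul[OF lin])
    then show ?thesis
      by (simp add: pd_def Let_def h scaleR_conv_of_real)
        (simp add: complex_eq_iff field_simps)
  qed
  then have "?d = (\<lambda>h. fst h * pd 1 F p + cnj (fst h) * pd 2 F p
           + of_real (fst (snd h)) * pd 3 F p + of_real (snd (snd h)) * pd 4 F p)" by auto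
  then show ?thesis using assms frechet_derivative_works by metis
qed

lemma pd_cong:
  assumes "open S" "p \<in> S" "\<And>q. q \<in> S \<Longrightarrow> F q = G q"
  shows "pd i F p = pd i G p"
  using frechet_derivative_cong[OF assms] by (simp add: pd_eq_sum)

lemma constant_on_connected:
  assumes "open S" "connected S" "smooth_on S F" "\<And>i p. p \<in> S \<Longrightarrow> pd i F p = 0" "p \<in> S" "q \<in> S"
  shows "F p = F q"
proof (rule has_derivative_zero_unique_connected[OF assms(1,2) _ assms(5,6)])
  fix x assume x: "x \<in> S"
  show "(F has_derivative (\<lambda>_. 0)) (at x)"
    using has_derivative_pd[OF smooth_on_imp_differentiable[OF assms(1) x assms(3)]] x
    by (simp add: assms(4))
qed

locale smooth_domain =
  fixes S :: "pt set"
  assumes open_S: "open S"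
begin

lemma differentiable: "smooth_on S F \<Longrightarrow> p \<in> S \<Longrightarrow> F differentiable (at p)"
  using open_S smooth_on_imp_differentiable by blast

lemma frechet: "smooth_on S F \<Longrightarrow> p \<in> S \<Longrightarrow> (F has_derivative frechet_derivative F (at p)) (at p)"
  using differentiable frechet_derivative_works by blast

lemma pd_const [simp]: "pd i (\<lambda>x. c) p = 0"
  by (subst pd_eq_sumI[OF has_derivative_const]) simp

lemma pd_add: "smooth_on S F \<Longrightarrow> smooth_on S G \<Longrightarrow> p \<in> S \<Longrightarrow>
    pd i (\<lambda>x. F x + G x) p = pd i F p + pd i G p"
  by (subst pd_eq_sumI[OF has_derivative_add[OF frechet frechet]])
    (auto simp: pd_eq_sum distrib_left sum.distrib)

lemma pd_minus: "smooth_on S F \<Longrightarrow> p \<in> S \<Longrightarrow> pd i (\<lambda>x. - F x) p = - pd i F p"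
  by (subst pd_eq_sumI[OF has_derivative_minus[OF frechet]])
    (auto simp: pd_eq_sum sum_negf)

lemma pd_diff: "smooth_on S F \<Longrightarrow> smooth_on S G \<Longrightarrow> p \<in> S \<Longrightarrow>
    pd i (\<lambda>x. F x - G x) p = pd i F p - pd i G p"
  by (subst pd_eq_sumI[OF has_derivative_diff[OF frechet frechet]])
    (auto simp: pd_eq_sum right_diff_distrib sum_subtractf)

lemma pd_mult: "smooth_on S F \<Longrightarrow> smooth_on S G \<Longrightarrow> p \<in> S \<Longrightarrow>
    pd i (\<lambda>x. F x * G x) p = pd i F p * G p + F p * pd i G p"
  by (subst pd_eq_sumI[OF has_derivative_mult[OF frechet frechet]])
    (auto simp: pd_eq_sum sum.distrib sum_distrib_left sum_distrib_right algebra_simps)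

lemma pd_inverse:
  assumes "smooth_on S F" "p \<in> S" "F p \<noteq> 0"
  shows "pd i (\<lambda>x. inverse (F x)) p = - pd i F p / F p ^ 2"
  by (subst pd_eq_sumI[OF Deriv.has_derivative_inverse[OF assms(3) frechet[OF assms(1,2)]]])
    (simp add: pd_eq_sum sum_negf sum_divide_distrib divide_inverse power2_eq_square
      sum_distrib_left sum_distrib_right mult_ac)

lemma pd_divide:
  assumes "smooth_on S F" "smooth_on S G" "p \<in> S" "\<And>x. x \<in> S \<Longrightarrow> G x \<noteq> 0"
  shows "pd i (\<lambda>x. F x / G x) p = (pd i F p * G p - F p * pd i G p) / G p ^ 2"
proof -
  have "smooth_on S (\<lambda>x. inverse (G x))" using assms smooth_on_inverse[OF open_S] by blast
  then have "pd i (\<lambda>x. F x * inverse (G x)) p = pd i F p * inverse (G p) + F p * (- pd i G p / G p ^ 2)"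
    using assms by (simp add: pd_mult pd_inverse)
  also have "\<dots> = (pd i F p * G p - F p * pd i G p) / G p ^ 2"
    using assms(4)[OF assms(3)] by (simp add: field_simps power2_eq_square)
  finally show ?thesis by (simp add: divide_inverse)
qed

lemma pd_exp:
  assumes "smooth_on S F" "p \<in> S"
  shows "pd i (\<lambda>x. exp (F x)) p = pd i F p * exp (F p)"
  by (subst pd_eq_sumI[OF has_derivative_compose[OF frechet[OF assms]
        DERIV_exp[of "F p", unfolded has_field_derivative_def]]])
    (simp add: pd_eq_sum sum_distrib_left sum_distrib_right mult_ac)

lemma pd_power2:
  assumes "smooth_on S F" "p \<in> S"
  shows "pd i (\<lambda>x. F x ^ 2) p = 2 * F p * pd i F p"
  using assms by (simp add: power2_eq_square pd_mult)

lemma pd_cnj: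
  assumes "smooth_on S F" "p \<in> S"
  shows "pd 1 (\<lambda>x. cnj (F x)) p = cnj (pd 2 F p)" "pd 2 (\<lambda>x. cnj (F x)) p = cnj (pd 1 F p)"
    "pd 3 (\<lambda>x. cnj (F x)) p = cnj (pd 3 F p)" "pd 4 (\<lambda>x. cnj (F x)) p = cnj (pd 4 F p)"
proof -
  have "frechet_derivative (\<lambda>x. cnj (F x)) (at p) = (\<lambda>h. cnj (frechet_derivative F (at p) h))"
    by (rule frechet_derivative_eqI)
      (rule bounded_linear.has_derivative[OF bounded_linear_cnj frechet[OF assms]])
  then show "pd 1 (\<lambda>x. cnj (F x)) p = cnj (pd 2 F p)" "pd 2 (\<lambda>x. cnj (F x)) p = cnj (pd 1 F p)"
    "pd 3 (\<lambda>x. cnj (F x)) p = cnj (pd 3 F p)" "pd 4 (\<lambda>x. cnj (F x)) p = cnj (pd 4 F p)"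
    by (simp_all add: pd_def Let_def)
qed

lemma smooth_pd: "smooth_on S F \<Longrightarrow> smooth_on S (pd i F)"
  unfolding pd_eq_sum[abs_def]
  by (simp add: Basis_pt) (intro smooth_on_add smooth_on_mult smooth_on_const open_S
      smooth_on_frechet_derivative; simp add: Basis_pt)

lemmas pd_eq = pd_cong[OF open_S]

lemmas smooth = smooth_on_const[OF open_S] smooth_on_add[OF open_S] smooth_on_diff[OF open_S]
  smooth_on_uminus[OF open_S] smooth_on_mult[OF open_S] smooth_on_divide[OF open_S]
  smooth_on_exp[OF open_S] smooth_on_power[OF open_S] smooth_on_cnj[OF open_S] smooth_pd

lemmas pd_simps = pd_const pd_add pd_diff pd_minus pd_mult pd_divide pd_exp pd_power2 pd_cnj

lemma pd_commute:
  assumes "smooth_on S F" "p \<in> S"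
  shows "pd i (pd j F) p = pd j (pd i F) p"
proof -
  let ?D = "\<lambda>b x. frechet_derivative F (at x) b"
  have sD: "smooth_on S (?D b)" if "b \<in> Basis" for b
    using smooth_on_frechet_derivative[OF assms(1) that] .
  have exp2: "pd i (pd j F) p = (\<Sum>b\<in>Basis. \<Sum>c\<in>Basis. pd_coeff i b * (pd_coeff j c * frechet_derivative (?D c) (at p) b))"
    for i j
  proof -
    have "(pd j F has_derivative (\<lambda>h. \<Sum>c\<in>Basis. pd_coeff j c * frechet_derivative (?D c) (at p) h)) (at p)"
      unfolding pd_eq_sum[abs_def]
      by (intro has_derivative_sum has_derivative_mult_right frechet sD assms)
    then show ?thesis by (simp add: pd_eq_sumI sum_distrib_left)
  qed
  show ?thesis unfolding exp2
    by (subst sum.swap, intro sum.cong refl)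
      (simp add: frechet_derivative_commute[OF open_S assms(2,1)])
qed

end

subsection \<open>Holomorphic dependence on \<open>\<zeta>\<close>\<close>

lemma pd_holomorphic:
  assumes "F differentiable (at (z, u, v))" "(\<lambda>w. F (w, u, v)) field_differentiable (at z)"
  shows "pd 2 F (z, u, v) = 0" "deriv (\<lambda>w. F (w, u, v)) z = pd 1 F (z, u, v)"
proof -
  let ?p = "(z, u, v)"
  have "((\<lambda>w. (w, u, v)) has_derivative (\<lambda>h. (h, 0, 0))) (at z)"
    by (auto intro!: derivative_eq_intros simp: zero_prod_def)
  from has_derivative_compose[OF this has_derivative_pd[OF assms(1)]]
  have 1: "((\<lambda>w. F (w, u, v)) has_derivative (\<lambda>h. h * pd 1 F ?p + cnj h * pd 2 F ?p)) (at z)"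
    by simp
  have "((\<lambda>w. F (w, u, v)) has_derivative (\<lambda>h. deriv (\<lambda>w. F (w, u, v)) z * h)) (at z)"
    using assms(2) field_differentiable_derivI has_field_derivative_def by blast
  from has_derivative_unique[OF 1 this]
  have e: "h * pd 1 F ?p + cnj h * pd 2 F ?p = deriv (\<lambda>w. F (w, u, v)) z * h" for h by metis
  show "pd 2 F (z, u, v) = 0" "deriv (\<lambda>w. F (w, u, v)) z = pd 1 F (z, u, v)"
    using e[of 1] e[of \<i>] by (auto simp: complex_eq_iff)
qed

lemma has_field_derivative_pd:
  assumes "F differentiable (at (z, u, v))" "pd 2 F (z, u, v) = 0"
  shows "((\<lambda>w. F (w, u, v)) has_field_derivative pd 1 F (z, u, v)) (at z)"
proof -
  have "((\<lambda>w. (w, u, v)) has_derivative (\<lambda>h. (h, 0, 0))) (at z)"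
    by (auto intro!: derivative_eq_intros simp: zero_prod_def)
  from has_derivative_compose[OF this has_derivative_pd[OF assms(1)]]
  show ?thesis using assms(2) by (simp add: has_field_derivative_def mult.commute[of _ "pd 1 F _"])
qed

subsection \<open>The functions \<open>Z\<^sub>a\<close> and \<open>Z\<^sub>u\<close> in the coordinates \<open>(\<zeta>, u)\<close>\<close>

text \<open>The cylinder over \<open>base U\<close>: unlike \<open>U\<close> it is a product in the \<open>v\<close> direction.\<close>

definition cyl :: "pt set \<Rightarrow> pt set" where
  "cyl U = (\<lambda>p. (fst p, fst (snd p))) -` base U"

definition lift :: "(complex \<Rightarrow> real \<Rightarrow> complex) \<Rightarrow> pt \<Rightarrow> complex" where
  "lift g = (\<lambda>(z, u, v). g z u)"

lemma lift_apply [simp]: "lift g (z, u, v) = g z u"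
  by (simp add: lift_def)

lemma bounded_linear_proj: "bounded_linear (\<lambda>p :: pt. (fst p, fst (snd p)))"
  by (intro bounded_linear_Pair bounded_linear_fst bounded_linear_fst_comp bounded_linear_snd)

lemma open_base: "open U \<Longrightarrow> open (base U)"
proof -
  assume "open U"
  moreover have "linear (\<lambda>p :: pt. (fst p, fst (snd p)))"
    using bounded_linear_proj bounded_linear.linear by blast
  moreover have "surj (\<lambda>p :: pt. (fst p, fst (snd p)))"
    by (auto simp: surj_def)
  ultimately have "open ((\<lambda>p :: pt. (fst p, fst (snd p))) ` U)"
    by (rule open_surjective_linear_image)
  then show ?thesis by (simp add: base_def case_prod_unfold)
qed

lemma open_cyl: "open U \<Longrightarrow> open (cyl U)"
  unfolding cyl_def using open_base bounded_linear_proj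
  by (simp add: continuous_open_vimage linear_continuous_at)

lemma cyl_iff: "(z, u, v) \<in> cyl U \<longleftrightarrow> (z, u) \<in> base U"
  by (simp add: cyl_def)

lemma subset_cyl: "U \<subseteq> cyl U"
  by (force simp: cyl_def base_def)

lemma smooth_lift:
  assumes "open U" "smooth_on (base U) (\<lambda>(z, u). g z u)"
  shows "smooth_on (cyl U) (lift g)"
proof -
  have "smooth_on (cyl U) (\<lambda>p. (\<lambda>(z, u). g z u) (fst p, fst (snd p)))"
    unfolding cyl_def
    by (rule smooth_on_compose_linear[OF bounded_linear_proj open_base[OF assms(1)] _ assms(2)])
      (auto simp: Basis_pt Basis_prod_def Basis_complex_def zero_prod_def)
  moreover have "(\<lambda>p. (\<lambda>(z, u). g z u) (fst p, fst (snd p))) = lift g"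
    by (auto simp: lift_def)
  ultimately show ?thesis by simp
qed

lemma pd4_lift:
  assumes "open U" "smooth_on (base U) (\<lambda>(z, u). g z u)" "p \<in> cyl U"
  shows "pd 4 (lift g) p = 0"
proof -
  let ?G = "\<lambda>(z, u). g z u"
  let ?x = "(fst p, fst (snd p))"
  have x: "?x \<in> base U" using assms(3) by (simp add: cyl_def)
  have d: "(?G has_derivative frechet_derivative ?G (at ?x)) (at ?x)"
    using has_derivative_frechet[OF open_base[OF assms(1)] x] assms(2)
      smooth_on_imp_differentiable_on by blast
  have e: "lift g = (\<lambda>p. ?G (fst p, fst (snd p)))" by (auto simp: lift_def)
  have "(lift g has_derivative (\<lambda>h. frechet_derivative ?G (at ?x) (fst h, fst (snd h)))) (at p)"
    unfolding e
    by (rule has_derivative_compose[OF bounded_linear_imp_has_derivative[OF bounded_linear_proj] d])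
  from frechet_derivative_eqI[OF this]
  have "frechet_derivative (lift g) (at p) (0, 0, 1) = frechet_derivative ?G (at ?x) 0"
    by (simp add: zero_prod_def)
  then show ?thesis
    using linear_0[OF has_derivative_linear[OF d]] by (simp add: pd_def Let_def)
qed

locale pp_wave =
  fixes U :: "pt set" and f a Z :: "complex \<Rightarrow> real \<Rightarrow> complex"
  assumes wave: "vacuum_pp_wave U f" and branch: "log_branch U f a"
    and inv: "inverse_fun U a Z" and alpha_neq: "\<forall>p\<in>U. alpha a p \<noteq> 0"
begin

abbreviation "C \<equiv> cyl U"

definition "A = lift a"
definition "F = lift f"
text \<open>\<open>r\<close> and \<open>q\<close> are \<open>Z\<^sub>a\<close> and \<open>Z\<^sub>u\<close> as functions of \<open>(\<zeta>, u)\<close>, read off from \<open>Z (a \<zeta> u) u = \<zeta>\<close>.\<close>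

definition "r p = 1 / pd 1 A p"
definition "q p = - (pd 3 A p * r p)"

lemma open_U: "open U" using wave by (simp add: vacuum_pp_wave_def)

sublocale C: smooth_domain C
  by unfold_locales (rule open_cyl[OF open_U])

lemma smooth_F: "smooth_on C F" and pd4_F: "p \<in> C \<Longrightarrow> pd 4 F p = 0"
  using wave smooth_lift[OF open_U, of f] pd4_lift[OF open_U, of f] open_U
  by (auto simp: vacuum_pp_wave_def F_def)

lemma smooth_A: "smooth_on C A" and pd4_A: "p \<in> C \<Longrightarrow> pd 4 A p = 0"
  using branch smooth_lift[OF open_U, of a] pd4_lift[OF open_U, of a]
  by (auto simp: log_branch_def A_def)

lemma deriv_f:
  assumes "(z, u, v) \<in> C"
  shows "pd 2 F (z, u, v) = 0" "deriv (\<lambda>w. f w u) z = pd 1 F (z, u, v)"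
proof -
  have o: "open {z. (z, u) \<in> base U}"
  proof -
    have "{z. (z, u) \<in> base U} = (\<lambda>z. (z, u)) -` base U" by auto
    then show ?thesis using open_base[OF open_U]
      by (simp add: open_vimage continuous_on_Pair)
  qed
  have "(\<lambda>w. f w u) holomorphic_on {z. (z, u) \<in> base U}"
    using wave by (simp add: vacuum_pp_wave_def)
  from holomorphic_on_imp_differentiable_at[OF this o]
  have "(\<lambda>w. F (w, u, v)) field_differentiable (at z)"
    using assms by (simp add: cyl_iff F_def)
  from pd_holomorphic[OF C.differentiable[OF smooth_F assms] this]
  show "pd 2 F (z, u, v) = 0" "deriv (\<lambda>w. f w u) z = pd 1 F (z, u, v)"
    by (simp_all add: F_def)
qed

lemma pd2_F: "p \<in> C \<Longrightarrow> pd 2 F p = 0"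
  using deriv_f(1) by (cases p) auto

lemma pd_zero_pd:
  assumes "smooth_on C G" "\<And>x. x \<in> C \<Longrightarrow> pd j G x = 0" "p \<in> C"
  shows "pd j (pd i G) p = 0"
proof -
  have "pd j (pd i G) p = pd i (pd j G) p" by (rule C.pd_commute[OF assms(1,3)])
  also have "\<dots> = pd i (\<lambda>_. 0) p" by (rule C.pd_eq) (use assms in auto)
  finally show ?thesis by simp
qed

lemma exp_A: "p \<in> C \<Longrightarrow> exp (4 * A p) = pd 1 (pd 1 F) p"
proof -
  assume p: "p \<in> C"
  obtain z u v where p_eq: "p = (z, u, v)" by (cases p) auto
  have o: "open ((\<lambda>w. (w, u, v)) -` C)"
    using C.open_S by (intro open_vimage continuous_intros) auto
  have "((\<lambda>w. pd 1 F (w, u, v)) has_field_derivative pd 1 (pd 1 F) (z, u, v)) (at z)"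
    by (rule has_field_derivative_pd)
      (use p p_eq C.differentiable[OF C.smooth_pd[OF smooth_F]] pd_zero_pd[OF smooth_F pd2_F]
        in auto)
  then have "(deriv (\<lambda>w. f w u) has_field_derivative pd 1 (pd 1 F) (z, u, v)) (at z)"
    by (rule DERIV_cong_ev[THEN iffD1, OF refl _ refl, rotated])
      (use p p_eq o deriv_f(2) in \<open>auto simp: eventually_nhds intro!: exI[of _ "(\<lambda>w. (w, u, v)) -` C"]\<close>)
  then have "(deriv ^^ 2) (\<lambda>w. f w u) z = pd 1 (pd 1 F) p"
    by (simp add: DERIV_imp_deriv p_eq numeral_2_eq_2)
  then show ?thesis using branch p by (auto simp: log_branch_def p_eq A_def cyl_iff)
qed

text \<open>The branch \<open>a\<close> is only assumed smooth; its holomorphy in \<zeta> follows by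
  differentiating exp (4 a) = f_\<zeta>\<zeta> and cancelling the exponential.\<close>

lemma pd2_A: "p \<in> C \<Longrightarrow> pd 2 A p = 0"
proof -
  assume p: "p \<in> C"
  have "pd 2 (\<lambda>p. exp (4 * A p)) p = pd 2 (pd 1 (pd 1 F)) p"
    by (rule C.pd_eq[OF p exp_A])
  also have "\<dots> = 0"
    by (intro pd_zero_pd C.smooth_pd smooth_F pd2_F p)
  finally show ?thesis
    using p smooth_A by (simp add: C.pd_exp C.pd_mult C.open_S smooth_on_mult)
qed

lemma deriv_a: "(z, u, v) \<in> C \<Longrightarrow> deriv (\<lambda>w. a w u) z = pd 1 A (z, u, v)"
  using DERIV_imp_deriv[OF has_field_derivative_pd[OF C.differentiable[OF smooth_A] pd2_A]]
  by (simp add: A_def)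

lemma alpha_eq: "p \<in> C \<Longrightarrow> alpha a p = exp (A p - cnj (A p)) * cnj (pd 1 A p)"
  by (cases p) (simp add: alpha_def deriv_a A_def)

lemma pd1_A_neq: "p \<in> C \<Longrightarrow> pd 1 A p \<noteq> 0"
proof -
  assume p: "p \<in> C"
  obtain z u v where p_eq: "p = (z, u, v)" by (cases p) auto
  obtain v' where v': "(z, u, v') \<in> U" using p by (auto simp: p_eq cyl_iff base_def)
  then have "deriv (\<lambda>w. a w u) z \<noteq> 0" using alpha_neq by (force simp: alpha_def)
  then show ?thesis using deriv_a p by (simp add: p_eq)
qed

lemma r_neq: "p \<in> C \<Longrightarrow> r p \<noteq> 0"
  using pd1_A_neq by (simp add: r_def)

lemma pd1_A: "p \<in> C \<Longrightarrow> pd 1 A p = 1 / r p" and pd3_A: "p \<in> C \<Longrightarrow> pd 3 A p = - (q p / r p)"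
  using pd1_A_neq by (auto simp: r_def q_def)

lemma smooth_r: "smooth_on C r"
  unfolding r_def[abs_def] by (simp add: C.smooth smooth_A pd1_A_neq)

lemma smooth_q: "smooth_on C q"
  unfolding q_def[abs_def] by (simp add: C.smooth smooth_A smooth_r)

lemmas sm = C.smooth smooth_F smooth_A smooth_r smooth_q

lemma pd_r: "p \<in> C \<Longrightarrow> pd 2 r p = 0" "p \<in> C \<Longrightarrow> pd 4 r p = 0"
  using pd_zero_pd[OF smooth_A pd2_A] pd_zero_pd[OF smooth_A pd4_A] pd1_A_neq
  by (simp_all add: r_def[abs_def] C.pd_simps sm)

lemma pd_q: "p \<in> C \<Longrightarrow> pd 2 q p = 0" "p \<in> C \<Longrightarrow> pd 4 q p = 0"
  using pd_zero_pd[OF smooth_A pd2_A] pd_zero_pd[OF smooth_A pd4_A] pd_r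
  by (simp_all add: q_def[abs_def] C.pd_simps sm)

text \<open>The integrability condition \<open>Z\<^sub>a\<^sub>u = Z\<^sub>u\<^sub>a\<close>.\<close>

lemma Z_mixed: "p \<in> C \<Longrightarrow> r p * pd 1 q p = pd 3 r p + q p * pd 1 r p"
proof -
  assume p: "p \<in> C"
  have "pd 3 (\<lambda>p. 1 / r p) p = pd 3 (pd 1 A) p" by (rule C.pd_eq[OF p, symmetric]) (rule pd1_A)
  also have "\<dots> = pd 1 (pd 3 A) p" by (rule C.pd_commute[OF smooth_A p])
  also have "\<dots> = pd 1 (\<lambda>p. - (q p / r p)) p" by (rule C.pd_eq[OF p pd3_A])
  finally have "pd 3 (\<lambda>p. 1 / r p) p * r p ^ 2 = pd 1 (\<lambda>p. - (q p / r p)) p * r p ^ 2" by simp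
  then show ?thesis using p r_neq by (simp add: C.pd_simps sm) (simp add: algebra_simps)
qed

text \<open>Smoothness of \<open>Z\<close> yields derivatives only on an open set. The map from
  (\<zeta>, u) to (a, u) is continuous and injective, with a left inverse built from
  \<open>Z\<close>, so invariance of domain applies.\<close>

lemma Z_image_open: "open ((\<lambda>(z, u). (a z u, u)) ` base U)"
proof (rule invariance_of_domain)
  have "continuous_on (base U) (\<lambda>(z, u). a z u)"
    using branch smooth_on_imp_continuous_on by (auto simp: log_branch_def)
  then show "continuous_on (base U) (\<lambda>(z, u). (a z u, u))"
    by (auto simp: case_prod_unfold intro!: continuous_intros)
  show "open (base U)" by (rule open_base[OF open_U])
  show "inj_on (\<lambda>(z, u). (a z u, u)) (base U)"
    by (rule inj_on_inverseI[where g = "\<lambda>(b, u). (Z b u, u)"])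
      (use inv in \<open>auto simp: inverse_fun_def\<close>)
qed

lemma Z_vector_derivative:
  assumes "(z, u, v) \<in> C"
  shows "((\<lambda>s. Z (a z u) s) has_vector_derivative q (z, u, v)) (at u)"
proof -
  let ?p = "(z, u, v)" and ?G = "\<lambda>(b, s). Z b s" and ?I = "(\<lambda>(z, u). (a z u, u)) ` base U"
  have x: "(a z u, u) \<in> ?I" using assms by (force simp: cyl_iff)
  have "?G differentiable (at (a z u, u))"
    by (rule smooth_on_imp_differentiable[OF Z_image_open x])
      (use inv in \<open>simp add: inverse_fun_def\<close>)
  then obtain G' where G': "(?G has_derivative G') (at (a z u, u))"
    by (auto simp: differentiable_def)
  have "((\<lambda>p. (A p, fst (snd p))) has_derivative
      (\<lambda>h. (fst h * pd 1 A ?p + of_real (fst (snd h)) * pd 3 A ?p, fst (snd h)))) (at ?p)"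
    using has_derivative_pd[OF C.differentiable[OF smooth_A assms]] assms
    by (auto simp: pd2_A pd4_A intro!: derivative_eq_intros)
  moreover have "(A ?p, fst (snd ?p)) = (a z u, u)" by (simp add: A_def)
  ultimately have "((\<lambda>p. ?G (A p, fst (snd p))) has_derivative
      (\<lambda>h. G' (fst h * pd 1 A ?p + of_real (fst (snd h)) * pd 3 A ?p, fst (snd h)))) (at ?p)"
    using has_derivative_compose[of "\<lambda>p. (A p, fst (snd p))" _ ?p UNIV ?G] G' by simp
  moreover have "?G (A p, fst (snd p)) = fst p" if "p \<in> C" for p
    using inv that by (cases p) (auto simp: inverse_fun_def A_def cyl_iff)
  ultimately have "(fst has_derivative
      (\<lambda>h. G' (fst h * pd 1 A ?p + of_real (fst (snd h)) * pd 3 A ?p, fst (snd h)))) (at ?p)"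
    by (rule has_derivative_transform_within_open[OF _ C.open_S assms])
  from has_derivative_unique[OF this has_derivative_fst[OF has_derivative_ident]]
  have "G' (fst h * pd 1 A ?p + of_real (fst (snd h)) * pd 3 A ?p, fst (snd h)) = fst h" for h :: pt
    by (rule fun_cong)
  \<comment> \<open>This direction leaves a fixed, since da takes the value q / r - q / r = 0 on it.
    Moving along it is thus the u-derivative of \<open>Z\<close> at constant first argument.\<close>
  from this[of "(q ?p, 1, 0)"] have G'1: "G' (0, 1) = q ?p"
    using pd1_A_neq[OF assms] by (simp add: q_def r_def)
  have "((\<lambda>s. (a z u, s)) has_derivative (\<lambda>h. (0, h))) (at u)"
    by (auto intro!: derivative_eq_intros)
  from has_derivative_compose[OF this G']
  have "((\<lambda>s. Z (a z u) s) has_derivative (\<lambda>h. G' (0, h))) (at u)" by simp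
  moreover have "G' (0, h) = h *\<^sub>R q ?p" for h
    using G'1 linear_cmul[OF has_derivative_linear[OF G'], of h "(0, 1)"] by simp
  ultimately show ?thesis by (simp add: has_vector_derivative_def)
qed

lemma Z_u_eq: "(z, u, v) \<in> C \<Longrightarrow> Z_u Z (a z u) u = q (z, u, v)"
  using Z_vector_derivative by (simp add: Z_u_def vector_derivative_at)

lemma Z_uu_eq:
  assumes "(z, u, v) \<in> C"
  shows "Z_u (Z_u Z) (a z u) u = pd 3 q (z, u, v) + q (z, u, v) * pd 1 q (z, u, v)"
proof -
  let ?p = "(z, u, v)" and ?I = "(\<lambda>(z, u). (a z u, u)) ` base U"
  let ?J = "(\<lambda>s. (a z u, s)) -` ?I"
  have J: "open ?J" "u \<in> ?J"
    using assms Z_image_open by (auto intro!: open_vimage continuous_intros simp: cyl_iff)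
  \<comment> \<open>\<open>Z_u Z\<close> is to be differentiated once more, so its formula is needed
    along the curve of constant a near u. Points of the curve keep the given v and may leave
    \<open>U\<close>, but they stay in the cylinder.\<close>
  have ZJ: "Z_u Z (a z u) s = q (Z (a z u) s, s, v)" if "s \<in> ?J" for s
  proof -
    obtain w where w: "(w, s) \<in> base U" "a z u = a w s" using \<open>s \<in> ?J\<close> by auto
    moreover have "Z (a w s) s = w" using inv w(1) by (auto simp: inverse_fun_def)
    ultimately show ?thesis using Z_u_eq[of w s v] by (simp add: cyl_iff)
  qed
  have Zp: "Z (a z u) u = z" using inv assms by (auto simp: inverse_fun_def cyl_iff)
  have "((\<lambda>s. (Z (a z u) s, s, v)) has_derivative (\<lambda>h. (h *\<^sub>R q ?p, h, 0))) (at u)"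
    using Z_vector_derivative[OF assms]
    by (auto simp: has_vector_derivative_def intro!: derivative_eq_intros)
  moreover have "(q has_derivative (\<lambda>h. fst h * pd 1 q ?p + of_real (fst (snd h)) * pd 3 q ?p))
      (at (Z (a z u) u, u, v))"
    using has_derivative_pd[OF C.differentiable[OF smooth_q assms]] assms by (simp add: pd_q Zp)
  ultimately have "((\<lambda>s. q (Z (a z u) s, s, v)) has_derivative
      (\<lambda>h. (h *\<^sub>R q ?p) * pd 1 q ?p + of_real h * pd 3 q ?p)) (at u)"
    using has_derivative_compose[of "\<lambda>s. (Z (a z u) s, s, v)" _ u UNIV q] by fastforce
  then have "((\<lambda>s. q (Z (a z u) s, s, v)) has_vector_derivative
      pd 3 q ?p + q ?p * pd 1 q ?p) (at u)"
    by (simp add: has_vector_derivative_def scaleR_conv_of_real algebra_simps)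
  then have "((\<lambda>s. Z_u Z (a z u) s) has_vector_derivative pd 3 q ?p + q ?p * pd 1 q ?p) (at u)"
    by (rule has_vector_derivative_transform_within_open[OF _ J]) (simp add: ZJ)
  then show ?thesis unfolding Z_u_def[of "Z_u Z"] by (rule vector_derivative_at)
qed

lemma nu_eq:
  "p \<in> C \<Longrightarrow> nu f a Z p = exp (- A p - 3 * cnj (A p)) * (pd 3 q p + q p * pd 1 q p + cnj (pd 1 F p))"
  by (cases p) (simp add: nu_def Z_uu_eq deriv_f A_def)

end

subsection \<open>The tetrad in coordinates\<close>

lemma vector_4:
  "(vector [w, x, y, z] :: 'a::zero^4) $ 1 = w" "(vector [w, x, y, z] :: 'a^4) $ 2 = x"
  "(vector [w, x, y, z] :: 'a^4) $ 3 = y" "(vector [w, x, y, z] :: 'a^4) $ 4 = z"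
  unfolding vector_def by simp_all

lemma matrix_inv_eqI:
  fixes M N :: "'a::semiring_1^'n^'n"
  assumes "M ** N = mat 1" "N ** M = mat 1"
  shows "matrix_inv M = N"
proof -
  have *: "M ** matrix_inv M = mat 1 \<and> matrix_inv M ** M = mat 1"
    unfolding matrix_inv_def by (rule someI[of _ N]) (use assms in simp)
  have "matrix_inv M = matrix_inv M ** (M ** N)" using assms by simp
  also have "\<dots> = N" using * by (simp add: matrix_mul_assoc)
  finally show ?thesis .
qed

context pp_wave
begin

abbreviation "fr \<equiv> frame f a Z"

sublocale U: smooth_domain U
  by unfold_locales (rule open_U)

lemma inC: "p \<in> U \<Longrightarrow> p \<in> C"
  using subset_cyl by blast

lemma smooth_U: "smooth_on C G \<Longrightarrow> smooth_on U G"
  using smooth_on_subset[OF open_U subset_cyl] .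

definition "e p = exp (A p - cnj (A p))"
definition "h p = exp (A p + cnj (A p))"

lemma e_neq [simp]: "e p \<noteq> 0" and h_neq [simp]: "h p \<noteq> 0"
  by (simp_all add: e_def h_def)

lemma cnj_e: "cnj (e p) = 1 / e p" and cnj_h: "cnj (h p) = h p"
  by (simp_all add: e_def h_def exp_cnj exp_minus[symmetric] inverse_eq_divide[symmetric] add.commute)

lemma smooth_e: "smooth_on C e" and smooth_h: "smooth_on C h"
  unfolding e_def[abs_def] h_def[abs_def] by (simp_all add: sm)

lemmas sm_C = sm smooth_e smooth_h
lemmas sm_U = sm_C[THEN smooth_U] U.smooth

lemma pd_A:
  assumes "p \<in> C"
  shows "pd 1 A p = 1 / r p" "pd 2 A p = 0" "pd 3 A p = - (q p / r p)" "pd 4 A p = 0"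
  using assms by (simp_all add: pd1_A pd2_A pd3_A pd4_A)

lemma pd_e:
  assumes "p \<in> C"
  shows "pd 1 e p = e p / r p" "pd 2 e p = - (e p / cnj (r p))"
    "pd 3 e p = e p * (cnj (q p) / cnj (r p) - q p / r p)" "pd 4 e p = 0"
  using assms unfolding e_def[abs_def]
  by (simp_all add: C.pd_simps sm pd_A algebra_simps)

lemma pd_h:
  assumes "p \<in> C"
  shows "pd 1 h p = h p / r p" "pd 2 h p = h p / cnj (r p)"
    "pd 3 h p = - (h p * (cnj (q p) / cnj (r p) + q p / r p))" "pd 4 h p = 0"
  using assms unfolding h_def[abs_def]
  by (simp_all add: C.pd_simps sm pd_A algebra_simps)

lemma coframe_matrix_eq:
  assumes "p \<in> C"
  shows "coframe_matrix f a Z p =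
    vector [vector [e p, 0, - e p * q p, 0],
            vector [0, 1 / e p, - (cnj (q p) / e p), 0],
            vector [0, 0, h p, 0],
            vector [- (cnj (q p) / h p), - (q p / h p),
              (F p + cnj (F p) + q p * cnj (q p)) / h p, 1 / h p]]"
proof -
  obtain z u v where p: "p = (z, u, v)" by (cases p) auto
  have k: "exp (- A p - cnj (A p)) = 1 / h p"
    by (simp add: h_def exp_minus[symmetric] inverse_eq_divide[symmetric])
  have e: "exp (a z u - cnj (a z u)) = e p" and h: "exp (a z u + cnj (a z u)) = h p"
    and A: "a z u = A p" and F: "f z u = F p"
    by (simp_all add: e_def h_def A_def F_def p)
  have Zu: "Z_u Z (a z u) u = q p" using Z_u_eq assms by (simp add: p)
  show ?thesis
    unfolding coframe_matrix_def p prod.case Let_def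
    unfolding Zu e h F unfolding A p[symmetric] k by (simp add: cnj_e)
qed

lemma coframe_eq:
  assumes "p \<in> C"
  shows "coframe f a Z 1 1 p = e p" "coframe f a Z 1 2 p = 0" "coframe f a Z 1 3 p = - (e p * q p)"
    "coframe f a Z 1 4 p = 0" "coframe f a Z 3 1 p = 0" "coframe f a Z 3 2 p = 0"
    "coframe f a Z 3 3 p = h p" "coframe f a Z 3 4 p = 0"
  using assms by (simp_all add: coframe_def coframe_matrix_eq vector_4)

lemma frame_matrix_eq:
  assumes "p \<in> C"
  shows "matrix_inv (coframe_matrix f a Z p) =
    vector [vector [1 / e p, 0, q p / h p, 0],
            vector [0, e p, cnj (q p) / h p, 0],
            vector [0, 0, 1 / h p, 0],
            vector [cnj (q p) / e p, e p * q p, (q p * cnj (q p) - F p - cnj (F p)) / h p, h p]]"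
  unfolding coframe_matrix_eq[OF assms]
  by (rule matrix_inv_eqI)
    (simp_all add: vec_eq_iff forall_4 matrix_matrix_mult_def sum_4 vector_4 mat_def field_simps)

lemma frame_eq:
  assumes "p \<in> C"
  shows
    "fr 1 1 p = 1 / e p" "fr 1 2 p = 0" "fr 1 3 p = 0"
    "fr 1 4 p = cnj (q p) / e p"
    "fr 2 1 p = 0" "fr 2 2 p = e p" "fr 2 3 p = 0"
    "fr 2 4 p = e p * q p"
    "fr 3 1 p = q p / h p" "fr 3 2 p = cnj (q p) / h p" "fr 3 3 p = 1 / h p"
    "fr 3 4 p = (q p * cnj (q p) - F p - cnj (F p)) / h p"
    "fr 4 1 p = 0" "fr 4 2 p = 0" "fr 4 3 p = 0" "fr 4 4 p = h p"
  using assms by (simp_all add: frame_def frame_matrix_eq vector_4)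

subsection \<open>Fields preserving \<open>\<omega>\<^sup>1\<close> and \<open>\<omega>\<^sup>3\<close>\<close>

text \<open>Here \<open>x = X a\<close> and \<open>Y = X u\<close>, so that the \<open>\<partial>\<^sub>\<zeta>\<close> component of \<open>X\<close> is \<open>x Z\<^sub>a + Y Z\<^sub>u\<close>.\<close>

lemma lie_form_coframe:
  assumes p: "p \<in> U" and x: "smooth_on U x" and Y: "smooth_on U Y" and Yr: "\<And>p. p \<in> U \<Longrightarrow> cnj (Y p) = Y p"
    and X: "\<And>p. p \<in> U \<Longrightarrow> X 1 p = x p * r p + Y p * q p"
      "\<And>p. p \<in> U \<Longrightarrow> X 2 p = cnj (X 1 p)" "\<And>p. p \<in> U \<Longrightarrow> X 3 p = Y p"
  shows "lie_form X (coframe f a Z 1) 1 p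
      = e p * (pd 1 x p * r p + x p * pd 1 r p + Y p * pd 1 q p + x p - cnj (x p))"
    "lie_form X (coframe f a Z 1) 2 p = e p * (pd 2 x p * r p)"
    "lie_form X (coframe f a Z 1) 3 p = e p * (r p * (pd 3 x p + q p * pd 1 x p)
        - q p * (pd 1 x p * r p + x p * pd 1 r p + Y p * pd 1 q p + x p - cnj (x p)))"
    "lie_form X (coframe f a Z 1) 4 p = e p * (pd 4 x p * r p)"
    "lie_form X (coframe f a Z 3) 1 p = h p * pd 1 Y p"
    "lie_form X (coframe f a Z 3) 2 p = h p * pd 2 Y p"
    "lie_form X (coframe f a Z 3) 3 p = h p * (pd 3 Y p + x p + cnj (x p))"
    "lie_form X (coframe f a Z 3) 4 p = h p * pd 4 Y p"
proof -
  note pC = inC[OF p]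
  have c1: "pd j (coframe f a Z 1 1) p = pd j e p" "pd j (coframe f a Z 1 2) p = 0"
    "pd j (coframe f a Z 1 3) p = pd j (\<lambda>p. - (e p * q p)) p" "pd j (coframe f a Z 1 4) p = 0"
    "pd j (coframe f a Z 3 1) p = 0" "pd j (coframe f a Z 3 2) p = 0"
    "pd j (coframe f a Z 3 3) p = pd j h p" "pd j (coframe f a Z 3 4) p = 0" for j
    using C.pd_eq[OF pC coframe_eq(1), where i = j] C.pd_eq[OF pC coframe_eq(2), where i = j]
      C.pd_eq[OF pC coframe_eq(3), where i = j] C.pd_eq[OF pC coframe_eq(4), where i = j]
      C.pd_eq[OF pC coframe_eq(5), where i = j] C.pd_eq[OF pC coframe_eq(6), where i = j]
      C.pd_eq[OF pC coframe_eq(7), where i = j] C.pd_eq[OF pC coframe_eq(8), where i = j] by simp_all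
  have eq: "pd j (\<lambda>p. - (e p * q p)) p = - (pd j e p * q p + e p * pd j q p)" for j
    using pC by (simp add: C.pd_simps sm_C)
  have X1: "pd j (X 1) p = pd j x p * r p + x p * pd j r p + pd j Y p * q p + Y p * pd j q p" for j
  proof -
    have "pd j (X 1) p = pd j (\<lambda>p. x p * r p + Y p * q p) p" by (rule U.pd_eq[OF p X(1)])
    then show ?thesis using p x Y by (simp add: U.pd_simps sm_U)
  qed
  have X3: "pd j (X 3) p = pd j Y p" for j by (rule U.pd_eq[OF p X(3)])
  \<comment> \<open>Eliminates the u-derivative of Z_a, so that the du component of the first form
    reduces to its d\<zeta> component and derivatives of \<open>x\<close>.\<close>
  have mix: "pd 3 r p = r p * pd 1 q p - q p * pd 1 r p" using Z_mixed[OF pC] by simp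
  note simps = lie_form_def sum_4 coframe_eq[OF pC] c1 X1 X3 X[OF p] pd_e[OF pC] pd_h[OF pC] Yr[OF p]
    eq pd_q[OF pC] pd_r[OF pC] mix
  have rn: "r p \<noteq> 0" "cnj (r p) \<noteq> 0" using r_neq[OF pC] by auto
  show "lie_form X (coframe f a Z 1) 1 p
      = e p * (pd 1 x p * r p + x p * pd 1 r p + Y p * pd 1 q p + x p - cnj (x p))"
    using rn by (simp add: simps) (simp add: field_simps)
  show "lie_form X (coframe f a Z 1) 2 p = e p * (pd 2 x p * r p)"
    using rn by (simp add: simps) (simp add: field_simps)
  show "lie_form X (coframe f a Z 1) 3 p = e p * (r p * (pd 3 x p + q p * pd 1 x p)
        - q p * (pd 1 x p * r p + x p * pd 1 r p + Y p * pd 1 q p + x p - cnj (x p)))"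
    using rn by (simp add: simps) (simp add: field_simps)
  show "lie_form X (coframe f a Z 1) 4 p = e p * (pd 4 x p * r p)"
    using rn by (simp add: simps) (simp add: field_simps)
  show "lie_form X (coframe f a Z 3) 1 p = h p * pd 1 Y p"
    "lie_form X (coframe f a Z 3) 2 p = h p * pd 2 Y p"
    "lie_form X (coframe f a Z 3) 4 p = h p * pd 4 Y p"
    by (simp_all add: simps)
  show "lie_form X (coframe f a Z 3) 3 p = h p * (pd 3 Y p + x p + cnj (x p))"
    using rn by (simp add: simps) (simp add: field_simps)
qed

text \<open>The fields of condition (a) have constant \<open>x\<close> and \<open>Y = \<rho> - 2 Re x u\<close>.\<close>

definition symmetry_at :: "complex \<Rightarrow> real \<Rightarrow> pt \<Rightarrow> bool" where
  "symmetry_at x \<rho> p \<longleftrightarrow>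
     x * pd 1 r p + of_real (\<rho> - 2 * Re x * fst (snd p)) * pd 1 q p = cnj x - x"

text \<open>A condition on the constants makes V nonzero at every point: if \<open>x\<close> is
  nonzero then V^1 has no zero, and if \<open>x\<close> is 0 then Y is the constant
  \<open>\<rho>\<close>.\<close>

definition symmetry :: "complex \<Rightarrow> real \<Rightarrow> bool" where
  "symmetry x \<rho> \<longleftrightarrow> (x \<noteq> 0 \<or> \<rho> \<noteq> 0) \<and> (\<forall>p\<in>U. symmetry_at x \<rho> p)"

definition tetrad_symmetry :: "field4 \<Rightarrow> bool" where
  "tetrad_symmetry V \<longleftrightarrow> (\<forall>i. smooth_on U (V i)) \<and> real_field_on U V \<and>
         (\<forall>p\<in>U. \<forall>i. lie_form (of_frame f a Z V) (coframe f a Z 1) i p = 0) \<and>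
         (\<forall>p\<in>U. \<forall>i. lie_form (of_frame f a Z V) (coframe f a Z 3) i p = 0) \<and>
         (\<forall>p\<in>U. V 1 p \<noteq> 0 \<or> V 3 p \<noteq> 0)"

lemma of_frame_eq:
  assumes "p \<in> C"
  shows "of_frame f a Z V 1 p = V 1 p / e p + V 3 p * q p / h p"
    "of_frame f a Z V 2 p = V 2 p * e p + V 3 p * cnj (q p) / h p"
    "of_frame f a Z V 3 p = V 3 p / h p"
  using assms by (simp_all add: of_frame_def sum_4 frame_eq)

lemma connected_U: "connected U" and U_nonempty: "U \<noteq> {}"
  using wave by (auto simp: vacuum_pp_wave_def simply_connected_imp_connected)

definition uc :: "pt \<Rightarrow> complex" where "uc p = of_real (fst (snd p))"

lemma has_derivative_uc: "(uc has_derivative (\<lambda>h. of_real (fst (snd h)))) (at p)"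
  unfolding uc_def[abs_def] by (auto intro!: derivative_eq_intros)

lemma pd_uc: "pd 1 uc p = 0" "pd 2 uc p = 0" "pd 3 uc p = 1" "pd 4 uc p = 0"
  by (simp_all add: pd_def Let_def frechet_derivative_eqI[OF has_derivative_uc])

lemma smooth_uc: "open S \<Longrightarrow> smooth_on S uc"
  by (rule smooth_onI[OF _ has_derivative_uc]) auto

lemma tetrad_symmetry_imp_symmetry:
  assumes "tetrad_symmetry V"
  shows "\<exists>x \<rho>. symmetry x \<rho>"
proof -
  \<comment> \<open>Evaluating the coframe on V gives V^1 = e Z_a x and V^3 = h Y; this line and the
    next invert these relations.\<close>
  define x where "x = (\<lambda>p. V 1 p / (e p * r p))"
  define Y where "Y = (\<lambda>p. V 3 p / h p)"
  have V: "smooth_on U (V i)" for i using assms by (simp add: tetrad_symmetry_def)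
  have Vr: "V 2 p = cnj (V 1 p)" "cnj (V 3 p) = V 3 p" if "p \<in> U" for p
    using assms that by (auto simp: tetrad_symmetry_def real_field_on_def Reals_cnj_iff)
  have sx: "smooth_on U x" and sY: "smooth_on U Y"
    unfolding x_def Y_def using V by (simp_all add: sm_U r_neq inC)
  have Yr: "cnj (Y p) = Y p" if "p \<in> U" for p using Vr[OF that] by (simp add: Y_def cnj_h)
  let ?X = "of_frame f a Z V"
  have X: "?X 1 p = x p * r p + Y p * q p" "?X 2 p = cnj (?X 1 p)" "?X 3 p = Y p" if p: "p \<in> U" for p
    using Vr[OF p] r_neq[OF inC[OF p]] of_frame_eq[OF inC[OF p]]
    by (simp_all add: x_def Y_def cnj_e cnj_h)
  note L = lie_form_coframe[OF _ sx sY Yr X]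
  have 1: "lie_form ?X (coframe f a Z 1) i p = 0" and 3: "lie_form ?X (coframe f a Z 3) i p = 0"
    if "p \<in> U" for p i
    using assms that by (simp_all add: tetrad_symmetry_def)
  have Y0: "pd 1 Y p = 0" "pd 2 Y p = 0" "pd 4 Y p = 0" "pd 3 Y p = - (x p + cnj (x p))" if "p \<in> U" for p
  proof -
    show "pd 1 Y p = 0" "pd 2 Y p = 0" "pd 4 Y p = 0"
      using 3[OF that, of 1] 3[OF that, of 2] 3[OF that, of 4] L(5,6,8)[OF that] by simp_all
    have "pd 3 Y p + x p + cnj (x p) = 0"
      using 3[OF that, of 3] L(7)[OF that] by simp
    then show "pd 3 Y p = - (x p + cnj (x p))" by algebra
  qed
  have x24: "pd 2 x p = 0" "pd 4 x p = 0" if "p \<in> U" for p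
    using 1[OF that, of 2] 1[OF that, of 4] L(2,4)[OF that] r_neq[OF inC[OF that]] by simp_all
  \<comment> \<open>The d\<zeta> component mixes this derivative with other terms. It is isolated by
    integrability of Y: as Y is independent of \<zeta>, so is its u-derivative - (x + cnj x), and
    \<open>cnj x\<close> has no \<zeta>-derivative because \<open>pd 2 x\<close> vanishes.\<close>
  have x1: "pd 1 x p = 0" if p: "p \<in> U" for p
  proof -
    have "pd 1 (pd 3 Y) p = pd 3 (pd 1 Y) p" by (rule U.pd_commute[OF sY p])
    also have "\<dots> = pd 3 (\<lambda>_. 0) p" by (rule U.pd_eq[OF p]) (rule Y0)
    finally have "pd 1 (pd 3 Y) p = 0" by simp
    moreover have "pd 1 (pd 3 Y) p = pd 1 (\<lambda>p. - (x p + cnj (x p))) p"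
      by (rule U.pd_eq[OF p]) (rule Y0)
    ultimately show ?thesis using p sx x24 by (simp add: U.pd_simps sm_U)
  qed
  have eqn: "x p * pd 1 r p + Y p * pd 1 q p = cnj (x p) - x p" if p: "p \<in> U" for p
  proof -
    have "x p * pd 1 r p + Y p * pd 1 q p + x p - cnj (x p) = 0"
      using 1[OF p, of 1] L(1)[OF p] x1[OF p] by simp
    then show ?thesis by algebra
  qed
  have x3: "pd 3 x p = 0" if p: "p \<in> U" for p
    using 1[OF p, of 3] L(3)[OF p] x1[OF p] eqn[OF p] r_neq[OF inC[OF p]] by simp
  obtain p0 where p0: "p0 \<in> U" using U_nonempty by blast
  have xc: "x p = x p0" if p: "p \<in> U" for p
  proof (rule constant_on_connected[OF open_U connected_U sx _ p p0])
    fix i p assume "p \<in> U"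
    then show "pd i x p = 0" using x1 x24 x3 by (cases i rule: index4_cases) auto
  qed
  \<comment> \<open>The value of Y + 2 Re x u at \<open>p0\<close>; the combination is constant
    because Y has slope - 2 Re x, and it is real, so \<open>Re\<close> loses nothing.\<close>
  define \<rho> where "\<rho> = Re (Y p0 + 2 * of_real (Re (x p0)) * uc p0)"
  have Yc: "Y p = of_real (\<rho> - 2 * Re (x p0) * fst (snd p))" if p: "p \<in> U" for p
  proof -
    have s: "smooth_on U (\<lambda>p. Y p + 2 * of_real (Re (x p0)) * uc p)"
      using sY smooth_uc[OF open_U] by (simp add: sm_U)
    have "Y p + 2 * of_real (Re (x p0)) * uc p = Y p0 + 2 * of_real (Re (x p0)) * uc p0"
    proof (rule constant_on_connected[OF open_U connected_U s _ p p0])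
      fix i p assume p: "p \<in> U"
      have "x p0 + cnj (x p0) = 2 * of_real (Re (x p0))" by (simp add: complex_add_cnj)
      then show "pd i (\<lambda>p. Y p + 2 * of_real (Re (x p0)) * uc p) p = 0"
        using p Y0[OF p] sY smooth_uc[OF open_U] xc[OF p]
        by (cases i rule: index4_cases) (auto simp: U.pd_simps sm_U pd_uc)
    qed
    moreover have "Y p0 = of_real (Re (Y p0))"
      using Yr[OF p0] by (simp add: complex_eq_iff)
    ultimately show ?thesis
      by (simp add: \<rho>_def uc_def complex_eq_iff)
  qed
  have "x p0 \<noteq> 0 \<or> \<rho> \<noteq> 0"
  proof (rule ccontr)
    assume "\<not> ?thesis"
    then have "V 1 p0 = 0" "V 3 p0 = 0"
      using Yc[OF p0] r_neq[OF inC[OF p0]] by (auto simp: x_def Y_def)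
    then show False using assms p0 by (auto simp: tetrad_symmetry_def)
  qed
  moreover have "symmetry_at (x p0) \<rho> p" if "p \<in> U" for p
    using eqn[OF that] xc[OF that] Yc[OF that] by (simp add: symmetry_at_def)
  ultimately show ?thesis unfolding symmetry_def by blast
qed

lemma symmetry_imp_tetrad_symmetry:
  assumes "symmetry x \<rho>"
  shows "\<exists>V. tetrad_symmetry V"
proof -
  define Y where "Y = (\<lambda>p. of_real \<rho> - 2 * of_real (Re x) * uc p)"
  \<comment> \<open>The forms \<omega>^1 and \<omega>^3 neither contain dv nor depend on v, so every
    real fourth component preserves them; 0 is the simplest choice.\<close>
  define V where "V = (\<lambda>(i::4) p. if i = 1 then x * (e p * r p) else if i = 2 then cnj (x * (e p * r p))
     else if i = 3 then h p * Y p else 0)"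
  have sY: "smooth_on U Y" unfolding Y_def using smooth_uc[OF open_U] by (simp add: sm_U)
  have Yr: "cnj (Y p) = Y p" for p by (simp add: Y_def uc_def)
  have sV: "smooth_on U (V i)" for i
    using sY by (cases i rule: index4_cases) (simp_all add: V_def sm_U)
  have Vr: "real_field_on U V"
    using Yr by (simp add: real_field_on_def V_def Reals_cnj_iff cnj_h)
  let ?X = "of_frame f a Z V"
  have X: "?X 1 p = x * r p + Y p * q p" "?X 2 p = cnj (?X 1 p)" "?X 3 p = Y p" if p: "p \<in> U" for p
    using of_frame_eq[OF inC[OF p], of V] Yr[of p] by (simp_all add: V_def cnj_e)
  have Y0: "pd 1 Y p = 0" "pd 2 Y p = 0" "pd 4 Y p = 0" "pd 3 Y p = - (x + cnj x)" if "p \<in> U" for p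
    unfolding Y_def using that smooth_uc[OF open_U]
    by (simp_all add: U.pd_simps sm_U pd_uc complex_add_cnj)
  have eqn: "x * pd 1 r p + Y p * pd 1 q p + x - cnj x = 0" if "p \<in> U" for p
    using assms that by (auto simp: symmetry_def symmetry_at_def Y_def uc_def)
  note L = lie_form_coframe[OF _ smooth_on_const[OF open_U, of x] sY Yr X]
  have "lie_form ?X (coframe f a Z 1) i p = 0" "lie_form ?X (coframe f a Z 3) i p = 0" if p: "p \<in> U" for p i
    using L[OF p] Y0[OF p] eqn[OF p] by (cases i rule: index4_cases; simp)+
  moreover have "V 1 p \<noteq> 0 \<or> V 3 p \<noteq> 0" if p: "p \<in> U" for p
    using assms r_neq[OF inC[OF p]] by (auto simp: V_def symmetry_def Y_def)
  ultimately have "tetrad_symmetry V" using sV Vr unfolding tetrad_symmetry_def by blast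
  then show ?thesis by blast
qed

end

subsection \<open>Constancy of the symmetry direction\<close>

text \<open>The two equations say that (y1, y2, y3) is orthogonal to (m, -1, l) and to (-1, m', l').
  The triple multiplied by \<open>s\<close> is the cross product of these, and since it is nonzero
  the solutions form a line.\<close>

lemma kernel_parallel:
  fixes m l m' l' y1 y2 y3 :: complex
  assumes "y2 = y1 * m + y3 * l" "y1 = y2 * m' + y3 * l'"
    and "- l' - l * m' \<noteq> 0 \<or> - l - m * l' \<noteq> 0 \<or> m * m' - 1 \<noteq> 0"
  shows "\<exists>s. y1 = s * (- l' - l * m') \<and> y2 = s * (- l - m * l') \<and> y3 = s * (m * m' - 1)"
proof -
  define k1 k2 k3 where k: "k1 = - l' - l * m'" "k2 = - l - m * l'" "k3 = m * m' - 1"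
  have 13: "y1 * k3 = y3 * k1" and 23: "y2 * k3 = y3 * k2" and 12: "y1 * k2 = y2 * k1"
    unfolding k using assms(1,2) by algebra+
  have "k1 \<noteq> 0 \<or> k2 \<noteq> 0 \<or> k3 \<noteq> 0" using assms(3) by (simp add: k)
  then have "\<exists>s. y1 = s * k1 \<and> y2 = s * k2 \<and> y3 = s * k3"
  proof (elim disjE)
    assume "k1 \<noteq> 0" then show ?thesis using 13 12 by (intro exI[of _ "y1 / k1"]) (simp add: field_simps)
  next
    assume "k2 \<noteq> 0" then show ?thesis using 23 12 by (intro exI[of _ "y2 / k2"]) (simp add: field_simps)
  next
    assume "k3 \<noteq> 0" then show ?thesis using 23 13 by (intro exI[of _ "y3 / k3"]) (simp add: field_simps)
  qed
  then show ?thesis by (simp add: k)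
qed

context pp_wave
begin

text \<open>The derivation \<open>x \<partial>\<^sub>a + x' \<partial>\<^sub>a\<^sub>* + \<rho> \<partial>\<^sub>u\<close> in the coordinates \<open>(a, a\<^sup>*, u)\<close>.\<close>

definition along :: "complex \<Rightarrow> complex \<Rightarrow> complex \<Rightarrow> (pt \<Rightarrow> complex) \<Rightarrow> pt \<Rightarrow> complex" where
  "along x x' \<rho> G p = (x * r p + \<rho> * q p) * pd 1 G p
     + (x' * cnj (r p) + \<rho> * cnj (q p)) * pd 2 G p + \<rho> * pd 3 G p"

text \<open>This is cnj \<alpha> = exp (cnj a - a - L) with L = log Z_a. The conjugate is taken as
  basic because its logarithmic derivative contains L_a and L_u unconjugated.\<close>

definition "al p = 1 / (e p * r p)"

lemma alpha_al: "p \<in> C \<Longrightarrow> alpha a p = cnj (al p)"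
  using r_neq by (simp add: alpha_eq al_def e_def[symmetric] pd1_A cnj_e)

lemma al_neq: "p \<in> C \<Longrightarrow> al p \<noteq> 0"
  using r_neq by (simp add: al_def)

lemma smooth_al: "smooth_on C al"
  unfolding al_def[abs_def] by (simp add: sm_C r_neq)

lemma pd2_pd1: "p \<in> C \<Longrightarrow> pd 2 (pd i r) p = 0" "p \<in> C \<Longrightarrow> pd 2 (pd i q) p = 0"
  "p \<in> C \<Longrightarrow> pd 4 (pd i r) p = 0" "p \<in> C \<Longrightarrow> pd 4 (pd i q) p = 0"
  by (simp_all add: pd_zero_pd smooth_r smooth_q pd_r pd_q)

text \<open>The \<zeta>-derivative of \<open>Z_mixed\<close>; in the coordinates (a, u) it reads
  L_au = L_ua for L = log Z_a.\<close>

lemma Z_mixed_deriv: "p \<in> C \<Longrightarrow> r p * pd 1 (pd 1 q) p = pd 3 (pd 1 r) p + q p * pd 1 (pd 1 r) p"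
proof -
  assume p: "p \<in> C"
  have "pd 1 (\<lambda>p. r p * pd 1 q p) p = pd 1 (\<lambda>p. pd 3 r p + q p * pd 1 r p) p"
    by (rule C.pd_eq[OF p Z_mixed])
  moreover have "pd 1 (pd 3 r) p = pd 3 (pd 1 r) p" by (rule C.pd_commute[OF smooth_r p])
  ultimately show ?thesis using p by (simp add: C.pd_simps sm_C algebra_simps)
qed

text \<open>Logarithmic differentiation of exp (cnj a - a - L): the last two terms are the
  derivative of L, since \<open>pd 1 r\<close> = L_a and \<open>pd 1 q\<close> = L_u.\<close>

lemma along_al: "p \<in> C \<Longrightarrow> along x x' \<rho> al p = al p * (x' - x - x * pd 1 r p - \<rho> * pd 1 q p)"
  and along_cnj_al: "p \<in> C \<Longrightarrow> along x x' \<rho> (\<lambda>p. cnj (al p)) p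
    = cnj (al p) * (x - x' - x' * cnj (pd 1 r p) - \<rho> * cnj (pd 1 q p))"
proof -
  assume p: "p \<in> C"
  have mix: "pd 3 r p = r p * pd 1 q p - q p * pd 1 r p" using Z_mixed[OF p] by simp
  have n: "r p \<noteq> 0" "cnj (r p) \<noteq> 0" using r_neq[OF p] by auto
  have d: "pd i al p = - (pd i e p * r p + e p * pd i r p) / (e p * r p)\<^sup>2" for i
    unfolding al_def[abs_def] using p r_neq by (simp add: C.pd_simps sm_C)
  have d1: "pd 1 al p = - al p * (1 + pd 1 r p) / r p"
    using n by (simp add: d pd_e[OF p] al_def field_simps power2_eq_square)
  have d2: "pd 2 al p = al p / cnj (r p)"
    using n by (simp add: d pd_e[OF p] pd_r[OF p] al_def field_simps power2_eq_square)
  have d3: "pd 3 al p = - al p * (cnj (q p) / cnj (r p) - q p / r p + pd 1 q p - q p * pd 1 r p / r p)"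
    using n by (simp add: d pd_e[OF p] mix al_def field_simps power2_eq_square)
  show "along x x' \<rho> al p = al p * (x' - x - x * pd 1 r p - \<rho> * pd 1 q p)"
    using n unfolding along_def d1 d2 d3 by (simp add: field_simps)
  show "along x x' \<rho> (\<lambda>p. cnj (al p)) p
    = cnj (al p) * (x - x' - x' * cnj (pd 1 r p) - \<rho> * cnj (pd 1 q p))"
    using n unfolding along_def C.pd_cnj[OF smooth_al p] d1 d2 d3 by (simp add: field_simps)
qed

text \<open>By L_au = L_ua the derivative of L_a equals x L_aa + \<rho> L_ua, the a-derivative of
  the expression for V L with coefficients held fixed. The factor \<open>r\<close> turns
  \<partial>_\<zeta> into \<partial>_a.\<close>

lemma along_r1: "p \<in> C \<Longrightarrow> along x x' \<rho> (pd 1 r) p = r p * (x * pd 1 (pd 1 r) p + \<rho> * pd 1 (pd 1 q) p)"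
  using Z_mixed_deriv[of p] by (simp add: along_def pd2_pd1 algebra_simps)

text \<open>The quotient is \<mu>. Its factor L_u contributes the u-derivative of V L at fixed a,
  which is \<open>pd 3\<close> plus \<open>q\<close> times \<open>pd 1\<close>, again with
  coefficients held fixed; the weight exp (- a - cnj a) contributes the term with
  \<open>x + x'\<close>.\<close>

lemma along_q1:
  assumes p: "p \<in> C"
  shows "along x x' \<rho> (\<lambda>p. pd 1 q p / h p) p
    = (x * pd 3 (pd 1 r) p + \<rho> * pd 3 (pd 1 q) p
       + q p * (x * pd 1 (pd 1 r) p + \<rho> * pd 1 (pd 1 q) p) - (x + x') * pd 1 q p) / h p"
proof -
  have mix: "pd 3 (pd 1 r) p = r p * pd 1 (pd 1 q) p - q p * pd 1 (pd 1 r) p"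
    using Z_mixed_deriv[OF p] by simp
  have n: "r p \<noteq> 0" "cnj (r p) \<noteq> 0" using r_neq[OF p] by auto
  have d: "pd i (\<lambda>p. pd 1 q p / h p) p = (pd i (pd 1 q) p * h p - pd 1 q p * pd i h p) / (h p)\<^sup>2" for i
    using p by (simp add: C.pd_simps sm_C)
  show ?thesis
    using n unfolding along_def d pd_h[OF p] pd2_pd1(2)[OF p] mix
    by (simp add: field_simps power2_eq_square)
qed

text \<open>The defining equation differentiated in \<zeta> and in u. In the second case Y
  contributes its slope - 2 Re x, and the resulting term is exactly the one that the weight of \<mu>
  cancels in \<open>along_q1\<close>.\<close>

lemma symmetry_deriv:
  assumes "symmetry x \<rho>" and p: "p \<in> U"
  defines "Y \<equiv> of_real (\<rho> - 2 * Re x * fst (snd p))"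
  shows "x * pd 1 (pd 1 r) p + Y * pd 1 (pd 1 q) p = 0"
    "x * pd 3 (pd 1 r) p + Y * pd 3 (pd 1 q) p = (x + cnj x) * pd 1 q p"
proof -
  let ?G = "\<lambda>p. x * pd 1 r p + (of_real \<rho> - 2 * of_real (Re x) * uc p) * pd 1 q p"
  have G: "pd i ?G p = 0" for i
  proof -
    have "pd i ?G p = pd i (\<lambda>p. cnj x - x) p"
      by (rule U.pd_eq[OF p]) (use assms in \<open>simp add: symmetry_def symmetry_at_def uc_def\<close>)
    then show ?thesis by simp
  qed
  have pU: "pd i ?G p = x * pd i (pd 1 r) p - 2 * of_real (Re x) * pd i uc p * pd 1 q p
     + (of_real \<rho> - 2 * of_real (Re x) * uc p) * pd i (pd 1 q) p" for i
    using p smooth_uc[OF open_U] by (simp add: U.pd_simps sm_U)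
  show "x * pd 1 (pd 1 r) p + Y * pd 1 (pd 1 q) p = 0"
    using G[of 1] unfolding pU by (simp add: pd_uc Y_def uc_def)
  show "x * pd 3 (pd 1 r) p + Y * pd 3 (pd 1 q) p = (x + cnj x) * pd 1 q p"
    using G[of 3] unfolding pU by (simp add: pd_uc Y_def uc_def complex_add_cnj algebra_simps)
qed

lemma symmetry_along:
  assumes "symmetry x \<rho>" and p: "p \<in> U"
  defines "Y \<equiv> of_real (\<rho> - 2 * Re x * fst (snd p))"
  shows "along x (cnj x) Y al p = 0" "along x (cnj x) Y (\<lambda>p. cnj (al p)) p = 0"
    "along x (cnj x) Y (pd 1 r) p = 0" "along x (cnj x) Y (\<lambda>p. pd 1 q p / h p) p = 0"
proof -
  have s: "x * pd 1 r p + Y * pd 1 q p = cnj x - x"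
    using assms(1) p by (simp add: symmetry_def symmetry_at_def Y_def)
  have "cnj (x * pd 1 r p + Y * pd 1 q p) = cnj (cnj x - x)" using s by simp
  then have s': "cnj x * cnj (pd 1 r p) + Y * cnj (pd 1 q p) = x - cnj x" by (simp add: Y_def)
  show "along x (cnj x) Y al p = 0"
    using s by (simp add: along_al[OF inC[OF p]] algebra_simps)
  show "along x (cnj x) Y (\<lambda>p. cnj (al p)) p = 0"
    using s' by (simp add: along_cnj_al[OF inC[OF p]] algebra_simps)
  show "along x (cnj x) Y (pd 1 r) p = 0" "along x (cnj x) Y (\<lambda>p. pd 1 q p / h p) p = 0"
    using symmetry_deriv[OF assms(1) p] by (simp_all add: along_r1 along_q1 inC[OF p] Y_def)
qed

text \<open>
  The cross product of the components of \<open>d log \<alpha>\<^sup>*\<close> and \<open>d log \<alpha>\<close> with respect to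
  \<open>da, da\<^sup>*, du\<close>; it spans their common kernel.
\<close>

definition "kx p = - cnj (pd 1 q p) - pd 1 q p * (1 + cnj (pd 1 r p))"
definition "k\<rho> p = (1 + pd 1 r p) * (1 + cnj (pd 1 r p)) - 1"

lemma cnj_k: "cnj (kx p) = - pd 1 q p - (1 + pd 1 r p) * cnj (pd 1 q p)" "cnj (k\<rho> p) = k\<rho> p"
  by (simp_all add: kx_def k\<rho>_def algebra_simps)

lemma along_k: 
  assumes "p \<in> C"
  shows "along (kx p) (cnj (kx p)) (k\<rho> p) al p = 0"
    "along (kx p) (cnj (kx p)) (k\<rho> p) (\<lambda>p. cnj (al p)) p = 0"
  using assms unfolding along_al[OF assms] along_cnj_al[OF assms] cnj_k
  by (auto simp: kx_def k\<rho>_def algebra_simps)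

lemma smooth_k: "smooth_on C kx" "smooth_on C k\<rho>"
  unfolding kx_def[abs_def] k\<rho>_def[abs_def] by (simp_all add: sm_C)

text \<open>The scale of the cross product has no meaning and may vary over \<open>U\<close>; the
  constants of the symmetry are obtained by freezing \<open>kx\<close> and \<open>T\<close> at one
  point.\<close>

lemma symmetry_from_kernel:
  assumes nz: "\<And>p. p \<in> U \<Longrightarrow> kx p \<noteq> 0 \<or> k\<rho> p \<noteq> 0"
    and kr: "\<And>p. p \<in> U \<Longrightarrow> along (kx p) (cnj (kx p)) (k\<rho> p) (pd 1 r) p = 0"
    and kq: "\<And>p. p \<in> U \<Longrightarrow> along (kx p) (cnj (kx p)) (k\<rho> p) (\<lambda>p. pd 1 q p / h p) p = 0"
  shows "\<exists>x \<rho>. symmetry x \<rho>"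
proof -
  define ky where "ky = (\<lambda>p. cnj (kx p))"
  have s: "smooth_on U kx" "smooth_on U k\<rho>" "smooth_on U ky"
    using smooth_k by (simp_all add: smooth_U ky_def sm_U)
  have id: "ky p = kx p * (1 + pd 1 r p) + k\<rho> p * pd 1 q p" for p
    unfolding ky_def cnj_k unfolding kx_def k\<rho>_def by (simp add: algebra_simps)
  \<comment> \<open>These are the terms that arise when the coefficients of \<open>id\<close> are
    differentiated: in \<zeta> they cancel, in u they leave \<open>kx + ky\<close> times
    \<open>pd 1 q\<close>.\<close>
  have k1: "kx p * pd 1 (pd 1 r) p + k\<rho> p * pd 1 (pd 1 q) p = 0"
    and k3: "kx p * pd 3 (pd 1 r) p + k\<rho> p * pd 3 (pd 1 q) p = (kx p + ky p) * pd 1 q p" if p: "p \<in> U" for p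
    using kr[OF p] kq[OF p] r_neq[OF inC[OF p]]
    by (simp_all add: along_r1 along_q1 inC[OF p] ky_def)
  have dk: "pd i ky p = pd i kx p * (1 + pd 1 r p) + kx p * pd i (pd 1 r) p
      + pd i k\<rho> p * pd 1 q p + k\<rho> p * pd i (pd 1 q) p" if p: "p \<in> U" for i p
  proof -
    have "pd i ky p = pd i (\<lambda>p. kx p * (1 + pd 1 r p) + k\<rho> p * pd 1 q p) p"
      by (rule U.pd_eq[OF p id])
    then show ?thesis using p s by (simp add: U.pd_simps sm_U)
  qed
  have cj: "pd 1 ky p = cnj (pd 2 kx p)" "pd 2 ky p = cnj (pd 1 kx p)" "pd 3 ky p = cnj (pd 3 kx p)"
    "pd 1 k\<rho> p = cnj (pd 2 k\<rho> p)" "pd 2 k\<rho> p = cnj (pd 1 k\<rho> p)" "pd 3 k\<rho> p = cnj (pd 3 k\<rho> p)"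
    if p: "p \<in> U" for p
  proof -
    show "pd 1 ky p = cnj (pd 2 kx p)" "pd 2 ky p = cnj (pd 1 kx p)" "pd 3 ky p = cnj (pd 3 kx p)"
      using U.pd_cnj[OF s(1) p] by (simp_all add: ky_def)
    have "k\<rho> = (\<lambda>p. cnj (k\<rho> p))" by (simp add: cnj_k)
    then show "pd 1 k\<rho> p = cnj (pd 2 k\<rho> p)" "pd 2 k\<rho> p = cnj (pd 1 k\<rho> p)" "pd 3 k\<rho> p = cnj (pd 3 k\<rho> p)"
      using U.pd_cnj[OF s(2) p] by metis+
  qed
  have par: "\<exists>s. y1 = s * kx p \<and> y2 = s * ky p \<and> y3 = s * k\<rho> p"
    if p: "p \<in> U" and y: "y2 = y1 * (1 + pd 1 r p) + y3 * pd 1 q p"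
      "y1 = y2 * (1 + cnj (pd 1 r p)) + y3 * cnj (pd 1 q p)" for p y1 y2 y3
    using kernel_parallel[OF y] nz[OF p] unfolding ky_def cnj_k unfolding kx_def k\<rho>_def by auto
  \<comment> \<open>The analogue of \<rho> = Y + 2 Re x u. The added term contributes
    \<open>kx + ky\<close> to the u-derivative, which is just the correction that makes the
    u-derivatives solve the kernel equations.\<close>
  define T where "T = (\<lambda>p. k\<rho> p + (kx p + ky p) * uc p)"
  have sT: "smooth_on U T" unfolding T_def using s smooth_uc[OF open_U] by (simp add: sm_U)
  have \<sigma>: "\<exists>\<sigma>. pd i kx p = \<sigma> * kx p \<and> pd i ky p = \<sigma> * ky p \<and> pd i T p = \<sigma> * T p" if p: "p \<in> U" for i p
  proof -
    have dT: "pd i T p = pd i k\<rho> p + (pd i kx p + pd i ky p) * uc p + (kx p + ky p) * pd i uc p" for i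
      unfolding T_def using p s smooth_uc[OF open_U] by (simp add: U.pd_simps sm_U)
    have e1: "pd 1 ky p = pd 1 kx p * (1 + pd 1 r p) + pd 1 k\<rho> p * pd 1 q p"
      using dk[OF p, of 1] k1[OF p] by algebra
    have e2: "pd 2 ky p = pd 2 kx p * (1 + pd 1 r p) + pd 2 k\<rho> p * pd 1 q p"
      using dk[OF p, of 2] by (simp add: pd2_pd1 inC[OF p])
    have e3: "pd 3 ky p = pd 3 kx p * (1 + pd 1 r p) + (pd 3 k\<rho> p + (kx p + ky p)) * pd 1 q p"
      using dk[OF p, of 3] k3[OF p] by algebra
    have kr': "cnj (kx p + ky p) = kx p + ky p" by (simp add: ky_def)
    \<comment> \<open>Conjugation exchanges \<open>pd 1\<close> and \<open>pd 2\<close>, so the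
      second kernel equation for index 1 is the conjugate of the first one for index 2.\<close>
    have c1: "pd 1 kx p = pd 1 ky p * (1 + cnj (pd 1 r p)) + pd 1 k\<rho> p * cnj (pd 1 q p)"
      using arg_cong[OF e2, of cnj] by (simp add: cj(1,2,5)[OF p])
    have c2: "pd 2 kx p = pd 2 ky p * (1 + cnj (pd 1 r p)) + pd 2 k\<rho> p * cnj (pd 1 q p)"
      using arg_cong[OF e1, of cnj] by (simp add: cj(1,2,4)[OF p])
    have c3: "pd 3 kx p = pd 3 ky p * (1 + cnj (pd 1 r p)) + (pd 3 k\<rho> p + (kx p + ky p)) * cnj (pd 1 q p)"
      using arg_cong[OF e3, of cnj] kr' by (simp add: cj(3)[OF p] cj(6)[OF p, symmetric])
    show ?thesis
    proof (cases i rule: index4_cases)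
      case 1
      show ?thesis using par[OF p e1 c1] dT[of 1] pd_uc(1)
        by (auto simp: 1 T_def algebra_simps)
    next
      case 2
      show ?thesis using par[OF p e2 c2] dT[of 2] pd_uc(2)
        by (auto simp: 2 T_def algebra_simps)
    next
      case 3
      obtain t where t: "pd 3 kx p = t * kx p" "pd 3 ky p = t * ky p" "pd 3 k\<rho> p + (kx p + ky p) = t * k\<rho> p"
        using par[OF p e3 c3] by blast
      have "pd 3 T p = t * T p"
        using dT[of 3] t pd_uc(3)[of p] unfolding T_def by algebra
      then show ?thesis using t by (auto simp: 3)
    next
      case 4
      have "pd 4 kx p = 0" "pd 4 k\<rho> p = 0" 
        unfolding kx_def[abs_def] k\<rho>_def[abs_def] using p
        by (simp_all add: U.pd_simps sm_U pd2_pd1 inC[OF p])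
      moreover from this have "pd 4 ky p = 0" using U.pd_cnj[OF s(1) p] by (simp add: ky_def)
      ultimately show ?thesis using dT[of 4] pd_uc(4) by (auto simp: 4 intro!: exI[of _ 0])
    qed
  qed
  \<comment> \<open>Equal to 2 |kx|^2 + T^2, hence positive even where one component vanishes.
    Differentiation multiplies \<open>N\<close> and every product of two components by 2 \<sigma>,
    so their quotients are constant and \<sigma> need not be integrated.\<close>
  define N where "N = (\<lambda>p. 2 * (kx p * ky p) + T p ^ 2)"
  have sN: "smooth_on U N" unfolding N_def using s sT by (simp add: sm_U)
  have Tr: "cnj (T p) = T p" for p by (simp add: T_def ky_def cnj_k(2) uc_def add.commute)
  have N: "N p \<noteq> 0" if p: "p \<in> U" for p
  proof
    assume "N p = 0"
    have T: "T p = of_real (Re (T p))" using Tr[of p] by (simp add: complex_eq_iff)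
    have K: "kx p * ky p = of_real ((cmod (kx p))\<^sup>2)" by (simp only: ky_def complex_norm_square)
    have "of_real (2 * (cmod (kx p))\<^sup>2 + (Re (T p))\<^sup>2) = N p"
      unfolding N_def K by (subst (2) T) simp
    then have "2 * (cmod (kx p))\<^sup>2 + (Re (T p))\<^sup>2 = 0"
      using \<open>N p = 0\<close> by (simp only: of_real_eq_0_iff)
    then have "kx p = 0" "Re (T p) = 0"
      by (auto simp: add_nonneg_eq_0_iff)
    then have "kx p = 0" "T p = 0" using T by simp_all
    then show False using nz[OF p] by (simp add: T_def ky_def)
  qed
  obtain p0 where p0: "p0 \<in> U" using U_nonempty by blast
  have const: "P p * Q p / N p = P p0 * Q p0 / N p0"
    if P: "smooth_on U P" and Q: "smooth_on U Q" and p: "p \<in> U"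
      and \<sigma>': "\<And>i p. p \<in> U \<Longrightarrow> \<exists>\<sigma>. pd i kx p = \<sigma> * kx p \<and> pd i ky p = \<sigma> * ky p \<and> pd i T p = \<sigma> * T p
         \<and> pd i P p = \<sigma> * P p \<and> pd i Q p = \<sigma> * Q p" for P Q p
  proof (rule constant_on_connected[OF open_U connected_U _ _ p p0])
    show "smooth_on U (\<lambda>p. P p * Q p / N p)" using P Q sN N by (simp add: sm_U)
    fix i p assume p: "p \<in> U"
    obtain t where t: "pd i kx p = t * kx p" "pd i ky p = t * ky p" "pd i T p = t * T p"
        "pd i P p = t * P p" "pd i Q p = t * Q p" using \<sigma>'[OF p] by blast
    have "pd i N p = 2 * t * N p"
      unfolding N_def using p s sT by (simp add: U.pd_simps sm_U t algebra_simps power2_eq_square)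
    then show "pd i (\<lambda>p. P p * Q p / N p) p = 0"
      using p P Q sN N by (simp add: U.pd_simps sm_U t)
  qed
  have c: "kx p * kx p / N p = kx p0 * kx p0 / N p0" "kx p * ky p / N p = kx p0 * ky p0 / N p0"
    "ky p * ky p / N p = ky p0 * ky p0 / N p0" "kx p * T p / N p = kx p0 * T p0 / N p0"
    "ky p * T p / N p = ky p0 * T p0 / N p0" "T p * T p / N p = T p0 * T p0 / N p0" if p: "p \<in> U" for p
    by (rule const[OF s(1) s(1) p] const[OF s(1) s(3) p] const[OF s(3) s(3) p] const[OF s(1) sT p]
        const[OF s(3) sT p] const[OF sT sT p]; use \<sigma> in blast)+
  define \<rho> where "\<rho> = Re (T p0)"
  have \<rho>: "of_real \<rho> = T p0" using Tr[of p0] by (simp add: \<rho>_def complex_eq_iff)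
  have "symmetry_at (kx p0) \<rho> p" if p: "p \<in> U" for p
  proof -
    \<comment> \<open>The constant quotients are the entries of the orthogonal projection onto the
      line of (kx, ky, T). It fixes the vector at \<open>p0\<close>, and applied to that vector it
      gives \<open>b\<close> times the vector at \<open>p\<close>, with \<open>b\<close> their
      Hermitian product over \<open>N\<close>.\<close>
    define b where "b = (kx p * ky p0 + ky p * kx p0 + T p * T p0) / N p"
    have N0: "N p0 = kx p0 * ky p0 + ky p0 * kx p0 + T p0 * T p0"
      by (simp add: N_def power2_eq_square)
    have bx: "kx p * b = kx p0"
    proof -
      have "kx p * b = (kx p * kx p / N p) * ky p0 + (kx p * ky p / N p) * kx p0 + (kx p * T p / N p) * T p0"
        by (simp add: b_def add_divide_distrib algebra_simps)
      also have "\<dots> = kx p0 * (N p0 / N p0)"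
        unfolding c[OF p] by (subst (4) N0) (simp add: add_divide_distrib algebra_simps)
      finally show ?thesis using N[OF p0] by simp
    qed
    have by': "ky p * b = ky p0"
    proof -
      have "ky p * b = (kx p * ky p / N p) * ky p0 + (ky p * ky p / N p) * kx p0 + (ky p * T p / N p) * T p0"
        by (simp add: b_def add_divide_distrib algebra_simps)
      also have "\<dots> = ky p0 * (N p0 / N p0)"
        unfolding c[OF p] by (subst (4) N0) (simp add: add_divide_distrib algebra_simps)
      finally show ?thesis using N[OF p0] by simp
    qed
    have bT: "T p * b = T p0"
    proof -
      have "T p * b = (kx p * T p / N p) * ky p0 + (ky p * T p / N p) * kx p0 + (T p * T p / N p) * T p0"
        by (simp add: b_def add_divide_distrib algebra_simps)
      also have "\<dots> = T p0 * (N p0 / N p0)"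
        unfolding c[OF p] by (subst (4) N0) (simp add: add_divide_distrib algebra_simps)
      finally show ?thesis using N[OF p0] by simp
    qed
    have "ky p = kx p * (1 + pd 1 r p) + (T p - (kx p + ky p) * uc p) * pd 1 q p"
      using id[of p] by (simp add: T_def)
    then have "ky p0 = kx p0 * (1 + pd 1 r p) + (T p0 - (kx p0 + ky p0) * uc p) * pd 1 q p"
      using bx by' bT by algebra
    moreover have "kx p0 + ky p0 = 2 * of_real (Re (kx p0))" by (simp add: ky_def complex_add_cnj)
    ultimately have "ky p0 = kx p0 * (1 + pd 1 r p) + (of_real \<rho> - 2 * of_real (Re (kx p0)) * uc p) * pd 1 q p"
      unfolding \<rho> by simp
    then show ?thesis
      unfolding symmetry_at_def by (simp add: ky_def uc_def algebra_simps)
  qed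
  moreover have "kx p0 \<noteq> 0 \<or> \<rho> \<noteq> 0"
  proof (rule ccontr)
    assume "\<not> ?thesis"
    then have "kx p0 = 0" "T p0 = 0" using \<rho> by auto
    then show False using nz[OF p0] by (simp add: T_def ky_def)
  qed
  ultimately show ?thesis unfolding symmetry_def by blast
qed

end

subsection \<open>Curvature and its covariant derivatives\<close>

text \<open>\<open>plane 1\<close> and \<open>plane 2\<close> are the parallel 2-forms \<open>d\<zeta> \<and> du\<close> and \<open>d\<zeta>\<^sup>* \<and> du\<close>.\<close>

definition plane :: "4 \<Rightarrow> 4 \<Rightarrow> 4 \<Rightarrow> complex" where
  "plane s i j = (if i = s \<and> j = 3 then 1 else if i = 3 \<and> j = s then - 1 else 0)"

lemma sum_lists_Suc:
  fixes G :: "'a::finite list \<Rightarrow> 'b::comm_monoid_add"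
  shows "(\<Sum>is | length is = Suc n. G is) = (\<Sum>i\<in>UNIV. \<Sum>is | length is = n. G (i # is))"
proof -
  have "{is :: 'a list. length is = Suc n} = (\<lambda>(i, is). i # is) ` (UNIV \<times> {is. length is = n})"
    by (auto simp: length_Suc_conv image_iff)
  then have "(\<Sum>is | length is = Suc n. G is) = (\<Sum>(i, is)\<in>UNIV \<times> {is. length is = n}. G (i # is))"
    by (simp add: sum.reindex inj_on_def case_prod_unfold)
  then show ?thesis by (simp add: sum.cartesian_product)
qed

text \<open>Contracting a sum of two squares of 2-forms separates into contractions of the single
  forms. The scalar \<open>c\<close> is reserved for the frame components of derivative
  indices.\<close>

lemma sum_product_pairs:
  fixes P Q :: "'a::finite \<Rightarrow> 'a \<Rightarrow> complex"
  shows "(\<Sum>i\<in>UNIV. \<Sum>j\<in>UNIV. \<Sum>k\<in>UNIV. \<Sum>l\<in>UNIV. (\<alpha> * P i j * P k l + \<beta> * Q i j * Q k l) * (c * w i * x j * y k * z l))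
    = \<alpha> * c * (\<Sum>i\<in>UNIV. \<Sum>j\<in>UNIV. P i j * w i * x j) * (\<Sum>k\<in>UNIV. \<Sum>l\<in>UNIV. P k l * y k * z l)
      + \<beta> * c * (\<Sum>i\<in>UNIV. \<Sum>j\<in>UNIV. Q i j * w i * x j) * (\<Sum>k\<in>UNIV. \<Sum>l\<in>UNIV. Q k l * y k * z l)"
proof -
  have fac: "(\<Sum>i\<in>UNIV. \<Sum>j\<in>UNIV. f i j) * (\<Sum>k\<in>UNIV. \<Sum>l\<in>UNIV. g k l)
      = (\<Sum>i\<in>UNIV. \<Sum>j\<in>UNIV. \<Sum>k\<in>UNIV. \<Sum>l\<in>UNIV. f i j * g k l)" for f g :: "'a \<Rightarrow> 'a \<Rightarrow> complex"
    by (simp only: sum_distrib_right) (simp only: sum_distrib_left)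
  have one: "\<alpha> * c * (\<Sum>i\<in>UNIV. \<Sum>j\<in>UNIV. P i j * w i * x j) * (\<Sum>k\<in>UNIV. \<Sum>l\<in>UNIV. P k l * y k * z l)
    = (\<Sum>i\<in>UNIV. \<Sum>j\<in>UNIV. \<Sum>k\<in>UNIV. \<Sum>l\<in>UNIV. (\<alpha> * P i j * P k l) * (c * w i * x j * y k * z l))"
    for \<alpha> and P :: "'a \<Rightarrow> 'a \<Rightarrow> complex"
    unfolding mult.assoc[of "\<alpha> * c"] fac unfolding sum_distrib_left by (simp only: mult_ac)
  show ?thesis unfolding one by (simp only: distrib_right sum.distrib)
qed

context pp_wave
begin

abbreviation "g \<equiv> pp_metric f"
definition "Hf = pd 1 (pd 1 F)"

lemma metric_eq:
  "g p = vector [vector [0, 1, 0, 0], vector [1, 0, 0, 0],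
     vector [0, 0, - 2 * (F p + cnj (F p)), - 1], vector [0, 0, - 1, 0]]"
  by (cases p) (simp add: pp_metric_def F_def)

lemma metric_comp:
  "g p $ 1 $ 1 = 0" "g p $ 1 $ 2 = 1" "g p $ 1 $ 3 = 0" "g p $ 1 $ 4 = 0"
  "g p $ 2 $ 1 = 1" "g p $ 2 $ 2 = 0" "g p $ 2 $ 3 = 0" "g p $ 2 $ 4 = 0"
  "g p $ 3 $ 1 = 0" "g p $ 3 $ 2 = 0" "g p $ 3 $ 3 = - 2 * (F p + cnj (F p))" "g p $ 3 $ 4 = - 1"
  "g p $ 4 $ 1 = 0" "g p $ 4 $ 2 = 0" "g p $ 4 $ 3 = - 1" "g p $ 4 $ 4 = 0"
  unfolding metric_eq by (simp_all add: vector_4)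

lemma metric_inv:
  "matrix_inv (g p) = vector [vector [0, 1, 0, 0], vector [1, 0, 0, 0],
     vector [0, 0, 0, - 1], vector [0, 0, - 1, 2 * (F p + cnj (F p))]]"
  unfolding metric_eq
  by (rule matrix_inv_eqI)
    (simp_all add: vec_eq_iff forall_4 matrix_matrix_mult_def sum_4 vector_4 mat_def)

definition chr :: "4 \<Rightarrow> 4 \<Rightarrow> 4 \<Rightarrow> pt \<Rightarrow> complex" where
  "chr m i j =
    (if m = 1 \<and> i = 3 \<and> j = 3 then (\<lambda>p. cnj (pd 1 F p))
     else if m = 2 \<and> i = 3 \<and> j = 3 then (\<lambda>p. pd 1 F p)
     else if m = 4 \<and> i = 3 \<and> j = 3 then (\<lambda>p. pd 3 F p + cnj (pd 3 F p))
     else if m = 4 \<and> (i = 1 \<and> j = 3 \<or> i = 3 \<and> j = 1) then (\<lambda>p. pd 1 F p)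
     else if m = 4 \<and> (i = 2 \<and> j = 3 \<or> i = 3 \<and> j = 2) then (\<lambda>p. cnj (pd 1 F p))
     else (\<lambda>p. 0))"

lemma christoffel_eq:
  assumes "p \<in> C"
  shows "christoffel g m i j p = chr m i j p"
proof -
  have d: "pd i (\<lambda>q. - 2 * (F q + cnj (F q))) p = - 2 * (pd i F p + pd i (\<lambda>q. cnj (F q)) p)" for i
    using assms by (simp add: C.pd_simps sm)
  note simps = christoffel_def sum_4 metric_inv vector_4 metric_comp d[simplified] C.pd_cnj[OF smooth_F assms]
    pd2_F[OF assms] pd4_F[OF assms] chr_def
  show ?thesis
    by (cases m rule: index4_cases; cases i rule: index4_cases; cases j rule: index4_cases)
      (simp_all add: simps)
qed

lemma pd_F2: "p \<in> C \<Longrightarrow> pd 2 (pd i F) p = 0" "p \<in> C \<Longrightarrow> pd 4 (pd i F) p = 0"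
  "p \<in> C \<Longrightarrow> pd 3 (pd 1 F) p = pd 1 (pd 3 F) p"
  using pd_zero_pd[OF smooth_F pd2_F] pd_zero_pd[OF smooth_F pd4_F] C.pd_commute[OF smooth_F] by auto

text \<open>Only derivatives of Christoffel symbols survive: a product of two symbols is nonzero
  only when \<open>k\<close>, \<open>l\<close> and \<open>j\<close> are all 3, and then the two
  products cancel.\<close>

lemma riemann_eq:
  assumes "p \<in> C"
  shows "riemann g [i, j, k, l] p = Hf p * plane 1 i j * plane 1 k l + cnj (Hf p) * plane 2 i j * plane 2 k l"
proof -
  have pdc: "pd n (christoffel g m i j) p = pd n (chr m i j) p" for n m i j
    by (rule C.pd_eq[OF assms christoffel_eq])
  have up: "riemann_up g m j k l p = pd k (chr m l j) p - pd l (chr m k j) p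
     + (\<Sum>n\<in>UNIV. chr m k n p * chr n l j p - chr m l n p * chr n k j p)" for m j k l
    by (simp add: riemann_up_def pdc christoffel_eq[OF assms])
  have sF: "smooth_on C (pd n F)" for n using smooth_F by (rule C.smooth_pd)
  have d1: "pd 1 (\<lambda>p. cnj (pd n F p)) p = 0" "pd 2 (\<lambda>p. cnj (pd n F p)) p = cnj (pd 1 (pd n F) p)"
    "pd 3 (\<lambda>p. cnj (pd n F p)) p = cnj (pd 3 (pd n F) p)" "pd 4 (\<lambda>p. cnj (pd n F p)) p = 0" for n
    using C.pd_cnj[OF sF assms] pd_F2[OF assms] by simp_all
  have d2: "pd k (\<lambda>p. pd 3 F p + cnj (pd 3 F p)) p = pd k (pd 3 F) p + pd k (\<lambda>p. cnj (pd 3 F p)) p" for k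
    using assms by (simp add: C.pd_simps sm)
  have d3: "pd k (\<lambda>p. pd 1 F p) p = pd k (pd 1 F) p" for k by simp
  have up': "riemann_up g m j k l p =
     (if m = 1 then cnj (Hf p) * plane 2 2 j * plane 2 k l
      else if m = 2 then Hf p * plane 1 1 j * plane 1 k l
      else if m = 3 then 0
      else - (if j = 1 then Hf p * plane 1 3 1 * plane 1 k l 
              else if j = 2 then cnj (Hf p) * plane 2 3 2 * plane 2 k l else 0))" for m j k l
    unfolding up
    by (cases m rule: index4_cases; cases j rule: index4_cases; cases k rule: index4_cases; cases l rule: index4_cases)
      (simp_all add: sum_4 chr_def plane_def d1 d2 pd_F2[OF assms] Hf_def)
  show ?thesis
    by (cases i rule: index4_cases; cases j rule: index4_cases)
      (simp_all add: sum_4 metric_comp up' plane_def)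
qed

lemma plane_parallel:
  assumes "s = 1 \<or> s = 2"
  shows "(\<Sum>m\<in>UNIV. chr m n i p * plane s m j + chr m n j p * plane s i m) = 0"
  using assms
  by (elim disjE; cases n rule: index4_cases; cases i rule: index4_cases; cases j rule: index4_cases)
    (simp_all add: sum_4 chr_def plane_def)

text \<open>The Christoffel corrections in the four form slots cancel because both 2-forms are
  parallel. With free coefficients \<open>b\<close> and \<open>c\<close> this serves both
  derivatives: the first then has no correction at all, the second only that in its inner derivative
  index.\<close>

lemma plane_slots:
  "(\<Sum>m\<in>UNIV. chr m n i p * (b * plane 1 m j * plane 1 k l + c * plane 2 m j * plane 2 k l))
   + (\<Sum>m\<in>UNIV. chr m n j p * (b * plane 1 i m * plane 1 k l + c * plane 2 i m * plane 2 k l))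
   + (\<Sum>m\<in>UNIV. chr m n k p * (b * plane 1 i j * plane 1 m l + c * plane 2 i j * plane 2 m l))
   + (\<Sum>m\<in>UNIV. chr m n l p * (b * plane 1 i j * plane 1 k m + c * plane 2 i j * plane 2 k m)) = 0"
proof -
  let ?P = "\<lambda>s i j. \<Sum>m\<in>UNIV. chr m n i p * plane s m j + chr m n j p * plane s i m"
  have "?thesis \<longleftrightarrow> b * (?P 1 i j * plane 1 k l + plane 1 i j * ?P 1 k l)
     + c * (?P 2 i j * plane 2 k l + plane 2 i j * ?P 2 k l) = 0"
    by (simp only: sum_distrib_left sum_distrib_right sum.distrib[symmetric] distrib_left distrib_right mult_ac add_ac)
  then show ?thesis by (simp only: plane_parallel simp_thms) simp
qed

lemma smooth_Hf: "smooth_on C Hf"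
  unfolding Hf_def by (simp add: sm)

lemma nabla_1:
  assumes "p \<in> C"
  shows "nabla_riemann g 1 [n, i, j, k, l] p
    = pd n Hf p * plane 1 i j * plane 1 k l + pd n (\<lambda>p. cnj (Hf p)) p * plane 2 i j * plane 2 k l"
proof -
  have "pd n (riemann g [i, j, k, l]) p
    = pd n (\<lambda>p. Hf p * plane 1 i j * plane 1 k l + cnj (Hf p) * plane 2 i j * plane 2 k l) p"
    by (rule C.pd_eq[OF assms riemann_eq])
  also have "\<dots> = pd n Hf p * plane 1 i j * plane 1 k l + pd n (\<lambda>p. cnj (Hf p)) p * plane 2 i j * plane 2 k l"
    using assms smooth_Hf by (simp add: C.pd_add C.pd_mult C.pd_const sm)
  finally show ?thesis
    using plane_slots[of n i p "Hf p" j k l "cnj (Hf p)"] assms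
    by (simp add: nabla_riemann_def numeral_eq_Suc christoffel_eq riemann_eq add.assoc del: riemann.simps)
qed

definition hess :: "(pt \<Rightarrow> complex) \<Rightarrow> 4 \<Rightarrow> 4 \<Rightarrow> pt \<Rightarrow> complex" where
  "hess G n m p = pd n (pd m G) p - (\<Sum>s\<in>UNIV. chr s n m p * pd s G p)"

lemma nabla_2:
  assumes "p \<in> C"
  shows "nabla_riemann g 2 [n, m, i, j, k, l] p
    = hess Hf n m p * plane 1 i j * plane 1 k l
      + hess (\<lambda>p. cnj (Hf p)) n m p * plane 2 i j * plane 2 k l"
proof -
  have nab: "nabla_riemann g 2 = cov_deriv g (nabla_riemann g 1)"
    by (simp add: nabla_riemann_def numeral_eq_Suc)
  have "pd n (nabla_riemann g 1 [m, i, j, k, l]) p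
    = pd n (\<lambda>p. pd m Hf p * plane 1 i j * plane 1 k l + pd m (\<lambda>p. cnj (Hf p)) p * plane 2 i j * plane 2 k l) p"
    by (rule C.pd_eq[OF assms nabla_1])
  also have "\<dots> = pd n (pd m Hf) p * plane 1 i j * plane 1 k l
      + pd n (pd m (\<lambda>p. cnj (Hf p))) p * plane 2 i j * plane 2 k l"
    using assms smooth_Hf by (simp add: C.pd_add C.pd_mult C.pd_const sm)
  finally have d: "pd n (nabla_riemann g 1 [m, i, j, k, l]) p = pd n (pd m Hf) p * plane 1 i j * plane 1 k l
      + pd n (pd m (\<lambda>p. cnj (Hf p))) p * plane 2 i j * plane 2 k l" .
  have s0: "(\<Sum>s\<in>UNIV. chr s n m p * (pd s Hf p * plane 1 i j * plane 1 k l
        + pd s (\<lambda>p. cnj (Hf p)) p * plane 2 i j * plane 2 k l))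
    = (\<Sum>s\<in>UNIV. chr s n m p * pd s Hf p) * plane 1 i j * plane 1 k l
      + (\<Sum>s\<in>UNIV. chr s n m p * pd s (\<lambda>p. cnj (Hf p)) p) * plane 2 i j * plane 2 k l"
    by (simp add: sum_4 algebra_simps)
  have "nabla_riemann g 2 [n, m, i, j, k, l] p = pd n (nabla_riemann g 1 [m, i, j, k, l]) p
    - (\<Sum>s\<in>UNIV. chr s n m p * (pd s Hf p * plane 1 i j * plane 1 k l
        + pd s (\<lambda>p. cnj (Hf p)) p * plane 2 i j * plane 2 k l))"
    using plane_slots[of n i p "pd m Hf p" j k l "pd m (\<lambda>p. cnj (Hf p)) p"] assms
    unfolding nab by (simp add: numeral_eq_Suc christoffel_eq nabla_1[simplified] add.assoc)
  then show ?thesis unfolding d s0 hess_def by (simp add: algebra_simps)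
qed


section \<open>Tetrad components of the curvature and of its first two covariant derivatives\<close>

lemma frame_plane:
  assumes "p \<in> C"
  shows "(\<Sum>i\<in>UNIV. \<Sum>j\<in>UNIV. plane 1 i j * fr c i p * fr d j p) = plane 1 c d / (e p * h p)"
    "(\<Sum>i\<in>UNIV. \<Sum>j\<in>UNIV. plane 2 i j * fr c i p * fr d j p) = plane 2 c d * e p / h p"
  by (cases c rule: index4_cases; cases d rule: index4_cases;
      simp add: sum_4 plane_def frame_eq[OF assms])+

lemma Hf_eq:
  assumes "p \<in> C"
  shows "Hf p = (e p * h p)\<^sup>2" "cnj (Hf p) = (h p / e p)\<^sup>2"
proof -
  have "Hf p = exp (4 * A p)" using exp_A[OF assms] by (simp add: Hf_def)
  also have "\<dots> = (e p * h p)\<^sup>2"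
    by (simp add: e_def h_def exp_add[symmetric] exp_of_nat_mult[symmetric] power2_eq_square)
  finally show "Hf p = (e p * h p)\<^sup>2" .
  then show "cnj (Hf p) = (h p / e p)\<^sup>2" by (simp add: cnj_e cnj_h)
qed

text \<open>The factor 1 stands where orders one and two carry the frame components of derivative
  indices, so that \<open>sum_product_pairs\<close> matches all three orders.\<close>

lemma tetrad_comp_4:
  "tetrad_comp f a Z T [b, c, d, k] p = (\<Sum>i\<in>UNIV. \<Sum>j\<in>UNIV. \<Sum>m\<in>UNIV. \<Sum>l\<in>UNIV. T [i, j, m, l] p *
     (1 * fr b i p * fr c j p * fr d m p * fr k l p))"
  by (simp add: tetrad_comp_def sum_lists_Suc prod.lessThan_Suc)

lemma tetrad_comp_5:
  "tetrad_comp f a Z T [n, b, c, d, k] p = (\<Sum>n'\<in>UNIV. \<Sum>i\<in>UNIV. \<Sum>j\<in>UNIV. \<Sum>m\<in>UNIV. \<Sum>l\<in>UNIV. T [n', i, j, m, l] p *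
     (fr n n' p * fr b i p * fr c j p * fr d m p * fr k l p))"
  by (simp add: tetrad_comp_def sum_lists_Suc prod.lessThan_Suc)

lemma tetrad_comp_6:
  "tetrad_comp f a Z T [n, s, b, c, d, k] p = (\<Sum>n'\<in>UNIV. \<Sum>s'\<in>UNIV. \<Sum>i\<in>UNIV. \<Sum>j\<in>UNIV. \<Sum>m\<in>UNIV. \<Sum>l\<in>UNIV. T [n', s', i, j, m, l] p *
     ((fr n n' p * fr s s' p) * fr b i p * fr c j p * fr d m p * fr k l p))"
  by (simp add: tetrad_comp_def sum_lists_Suc prod.lessThan_Suc)

abbreviation "icomp s \<equiv> tetrad_comp f a Z (nabla_riemann g s)"

text \<open>This is the normalisation \<Psi>_4 = 1: in the tetrad the 2-forms acquire the factors 1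
  / (e h) and e / h, whose squares cancel f_\<zeta>\<zeta> = (e h)^2 and its conjugate. All
  components are constant, in accordance with t_0 = 0.\<close>

lemma tetrad_0:
  assumes "p \<in> C"
  shows "icomp 0 [b, c, d, k] p
    = plane 1 b c * plane 1 d k + plane 2 b c * plane 2 d k"
proof -
  have "nabla_riemann g 0 = riemann g" by (simp add: nabla_riemann_def)
  then show ?thesis
    unfolding tetrad_comp_4
    by (simp only: riemann_eq[OF assms] sum_product_pairs frame_plane[OF assms] Hf_eq[OF assms])
      (simp add: cnj_e cnj_h power2_eq_square field_simps)
qed

text \<open>Tetrad components of da, which is cnj \<alpha> times \<omega>^1; \<open>\<eta>\<close>
  does the same for the conjugate of a.\<close>

definition "\<xi> n p = (if n = (1::4) then al p else 0)"
definition "\<eta> n p = (if n = (2::4) then cnj (al p) else 0)"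

lemma pd_cnj_A:
  assumes "p \<in> C"
  shows "pd 1 (\<lambda>p. cnj (A p)) p = 0" "pd 2 (\<lambda>p. cnj (A p)) p = 1 / cnj (r p)"
    "pd 3 (\<lambda>p. cnj (A p)) p = - (cnj (q p) / cnj (r p))" "pd 4 (\<lambda>p. cnj (A p)) p = 0"
  using assms by (simp_all add: C.pd_cnj sm pd_A)

lemma Hf_exp:
  "p \<in> C \<Longrightarrow> Hf p = exp (4 * A p)" "p \<in> C \<Longrightarrow> cnj (Hf p) = exp (4 * cnj (A p))"
proof -
  show *: "p \<in> C \<Longrightarrow> Hf p = exp (4 * A p)" using exp_A by (simp add: Hf_def)
  show "p \<in> C \<Longrightarrow> cnj (Hf p) = exp (4 * cnj (A p))" unfolding * by (simp add: exp_cnj)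
qed

text \<open>Passing to the logarithm of f_\<zeta>\<zeta>: the factor \<open>H\<close> later cancels
  against the normalised tetrad and only derivatives of a, or of its conjugate, remain.\<close>

lemma pd_exp4:
  assumes G: "smooth_on C G" and H: "\<And>p. p \<in> C \<Longrightarrow> H p = exp (4 * G p)" and p: "p \<in> C"
  shows "pd n H p = H p * (4 * pd n G p)"
    "hess H n m p = H p * (16 * pd n G p * pd m G p + 4 * hess G n m p)"
proof -
  have 1: "pd n H p = H p * (4 * pd n G p)" if p: "p \<in> C" for n p
  proof -
    have "pd n H p = pd n (\<lambda>p. exp (4 * G p)) p" by (rule C.pd_eq[OF p H])
    then show ?thesis using p G by (simp add: C.pd_simps sm H)
  qed
  show "pd n H p = H p * (4 * pd n G p)" by (rule 1[OF p])
  have sH: "smooth_on C H"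
    using smooth_on_cong[OF C.open_S H] G by (simp add: sm)
  have "pd n (pd m H) p = pd n (\<lambda>p. H p * (4 * pd m G p)) p" by (rule C.pd_eq[OF p 1])
  also have "\<dots> = H p * (16 * pd n G p * pd m G p + 4 * pd n (pd m G) p)"
    using p G sH by (simp add: C.pd_simps sm 1 algebra_simps)
  finally show "hess H n m p = H p * (16 * pd n G p * pd m G p + 4 * hess G n m p)"
    unfolding hess_def by (simp add: 1[OF p] sum_4 algebra_simps)
qed

lemma frame_pd_A:
  assumes "p \<in> C"
  shows "(\<Sum>i\<in>UNIV. fr n i p * pd i A p) = \<xi> n p"
    "(\<Sum>i\<in>UNIV. fr n i p * pd i (\<lambda>p. cnj (A p)) p) = \<eta> n p"
  by (cases n rule: index4_cases;
      simp add: sum_4 frame_eq[OF assms] pd_A[OF assms] pd_cnj_A[OF assms] \<xi>_def \<eta>_def al_def cnj_e divide_simps)+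

lemma tetrad_1:
  assumes "p \<in> C"
  shows "icomp 1 [n, b, c, d, k] p
    = 4 * \<xi> n p * (plane 1 b c * plane 1 d k) + 4 * \<eta> n p * (plane 2 b c * plane 2 d k)"
proof -
  have "icomp 1 [n, b, c, d, k] p
    = (\<Sum>n'\<in>UNIV. Hf p * (4 * pd n' A p) * fr n n' p * (plane 1 b c / (e p * h p)) * (plane 1 d k / (e p * h p))
      + cnj (Hf p) * (4 * pd n' (\<lambda>p. cnj (A p)) p) * fr n n' p * (plane 2 b c * e p / h p) * (plane 2 d k * e p / h p))"
    unfolding tetrad_comp_5
    by (simp only: nabla_1[OF assms] sum_product_pairs frame_plane[OF assms]
        pd_exp4(1)[OF smooth_A Hf_exp(1) assms] pd_exp4(1)[OF smooth_on_cnj[OF C.open_S smooth_A] Hf_exp(2) assms])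
  also have "\<dots> = (\<Sum>n'\<in>UNIV. 4 * (fr n n' p * pd n' A p) * (plane 1 b c * plane 1 d k)
      + 4 * (fr n n' p * pd n' (\<lambda>p. cnj (A p)) p) * (plane 2 b c * plane 2 d k))"
    by (intro sum.cong refl) (simp add: Hf_eq[OF assms] cnj_e cnj_h power2_eq_square field_simps)
  also have "\<dots> = 4 * (\<Sum>n'\<in>UNIV. fr n n' p * pd n' A p) * (plane 1 b c * plane 1 d k)
      + 4 * (\<Sum>n'\<in>UNIV. fr n n' p * pd n' (\<lambda>p. cnj (A p)) p) * (plane 2 b c * plane 2 d k)"
    by (simp only: sum.distrib sum_distrib_left sum_distrib_right)
  finally show ?thesis unfolding frame_pd_A[OF assms] .
qed

text \<open>Tetrad components of the covariant Hessian of a, with \<open>hB\<close> for the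
  conjugate of a. The entries are L_a, \<mu> and \<nu> up to sign and powers of cnj \<alpha>; this
  is where the second-order invariants enter.\<close>

definition "hA n m =
  (if n = (1::4) \<and> m = (1::4) then (\<lambda>p. - (pd 1 r p * (al p)\<^sup>2))
   else if n = 1 \<and> m = 3 \<or> n = 3 \<and> m = 1 then (\<lambda>p. - (al p * (pd 1 q p / h p)))
   else if n = 3 \<and> m = 3 then (\<lambda>p. - (nu f a Z p * al p)) else (\<lambda>p. 0))"
definition "hB n m =
  (if n = (2::4) \<and> m = (2::4) then (\<lambda>p. - (cnj (pd 1 r p) * (cnj (al p))\<^sup>2))
   else if n = 2 \<and> m = 3 \<or> n = 3 \<and> m = 2 then (\<lambda>p. - (cnj (al p) * cnj (pd 1 q p / h p)))
   else if n = 3 \<and> m = 3 then (\<lambda>p. - (cnj (nu f a Z p) * cnj (al p))) else (\<lambda>p. 0))"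

lemma nu_h: "p \<in> C \<Longrightarrow> nu f a Z p = (pd 3 q p + q p * pd 1 q p + cnj (pd 1 F p)) * e p / (h p)\<^sup>2"
proof -
  assume p: "p \<in> C"
  have "exp (- A p - 3 * cnj (A p)) * (h p)\<^sup>2 = e p"
    by (simp add: e_def h_def exp_add[symmetric] power2_eq_square)
  then have "exp (- A p - 3 * cnj (A p)) = e p / (h p)\<^sup>2" by (simp add: field_simps)
  then show ?thesis by (simp add: nu_eq[OF p])
qed

lemma hess_A_table:
  assumes p: "p \<in> C"
  shows "pd 1 (pd 1 A) p = - pd 1 r p / (r p)\<^sup>2" 
    "pd 1 (pd 3 A) p = - pd 1 q p / r p + q p * pd 1 r p / (r p)\<^sup>2"
    "pd 3 (pd 1 A) p = - pd 1 q p / r p + q p * pd 1 r p / (r p)\<^sup>2"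
    "pd 3 (pd 3 A) p = - pd 3 q p / r p + q p * pd 1 q p / r p - (q p)\<^sup>2 * pd 1 r p / (r p)\<^sup>2"
    "pd 2 (pd i A) p = 0" "pd 4 (pd i A) p = 0" "pd i (pd 2 A) p = 0" "pd i (pd 4 A) p = 0"
proof -
  have n: "r p \<noteq> 0" using r_neq[OF p] .
  have mix: "pd 3 r p = r p * pd 1 q p - q p * pd 1 r p" using Z_mixed[OF p] by simp
  have 1: "pd i (pd 1 A) p = pd i (\<lambda>p. 1 / r p) p" for i by (rule C.pd_eq[OF p pd1_A])
  have 3: "pd i (pd 3 A) p = pd i (\<lambda>p. - (q p / r p)) p" for i by (rule C.pd_eq[OF p pd3_A])
  show "pd 1 (pd 1 A) p = - pd 1 r p / (r p)\<^sup>2" 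
    using p r_neq by (simp add: 1 C.pd_simps sm)
  show "pd 1 (pd 3 A) p = - pd 1 q p / r p + q p * pd 1 r p / (r p)\<^sup>2"
    using p r_neq by (simp add: 3 C.pd_simps sm) (simp add: field_simps power2_eq_square)
  then show "pd 3 (pd 1 A) p = - pd 1 q p / r p + q p * pd 1 r p / (r p)\<^sup>2"
    using C.pd_commute[OF smooth_A p, of 3 1] by simp
  show "pd 3 (pd 3 A) p = - pd 3 q p / r p + q p * pd 1 q p / r p - (q p)\<^sup>2 * pd 1 r p / (r p)\<^sup>2"
    using p r_neq by (simp add: 3 C.pd_simps sm mix) (simp add: field_simps power2_eq_square)
  show "pd 2 (pd i A) p = 0" "pd 4 (pd i A) p = 0"
    using pd_zero_pd[OF smooth_A pd2_A p] pd_zero_pd[OF smooth_A pd4_A p] by simp_all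
  then show "pd i (pd 2 A) p = 0" "pd i (pd 4 A) p = 0"
    using C.pd_commute[OF smooth_A p] by metis+
qed

lemma hess_cnj_A_table:
  assumes p: "p \<in> C"
  shows "pd 2 (pd 2 (\<lambda>p. cnj (A p))) p = cnj (pd 1 (pd 1 A) p)" 
    "pd 2 (pd 3 (\<lambda>p. cnj (A p))) p = cnj (pd 1 (pd 3 A) p)"
    "pd 3 (pd 2 (\<lambda>p. cnj (A p))) p = cnj (pd 1 (pd 3 A) p)"
    "pd 3 (pd 3 (\<lambda>p. cnj (A p))) p = cnj (pd 3 (pd 3 A) p)"
    "pd 1 (pd i (\<lambda>p. cnj (A p))) p = 0" "pd 4 (pd i (\<lambda>p. cnj (A p))) p = 0"
    "pd i (pd 1 (\<lambda>p. cnj (A p))) p = 0" "pd i (pd 4 (\<lambda>p. cnj (A p))) p = 0"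
proof -
  have s: "smooth_on C (pd i A)" for i using smooth_A by (rule C.smooth_pd)
  have sc: "smooth_on C (\<lambda>p. cnj (A p))" by (simp add: sm)
  have 2: "pd i (pd 2 (\<lambda>p. cnj (A p))) p = pd i (\<lambda>p. cnj (pd 1 A p)) p" for i
    by (rule C.pd_eq[OF p C.pd_cnj(2)[OF smooth_A]])
  have 3: "pd i (pd 3 (\<lambda>p. cnj (A p))) p = pd i (\<lambda>p. cnj (pd 3 A p)) p" for i
    by (rule C.pd_eq[OF p C.pd_cnj(3)[OF smooth_A]])
  show "pd 2 (pd 2 (\<lambda>p. cnj (A p))) p = cnj (pd 1 (pd 1 A) p)" 
    "pd 2 (pd 3 (\<lambda>p. cnj (A p))) p = cnj (pd 1 (pd 3 A) p)"
    "pd 3 (pd 3 (\<lambda>p. cnj (A p))) p = cnj (pd 3 (pd 3 A) p)"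
    by (simp_all add: 2 3 C.pd_cnj[OF s p])
  then show "pd 3 (pd 2 (\<lambda>p. cnj (A p))) p = cnj (pd 1 (pd 3 A) p)"
    using C.pd_commute[OF sc p, of 3 2] by simp
  show "pd 1 (pd i (\<lambda>p. cnj (A p))) p = 0" "pd 4 (pd i (\<lambda>p. cnj (A p))) p = 0"
    using pd_zero_pd[OF sc pd_cnj_A(1) p] pd_zero_pd[OF sc pd_cnj_A(4) p] by simp_all
  then show "pd i (pd 1 (\<lambda>p. cnj (A p))) p = 0" "pd i (pd 4 (\<lambda>p. cnj (A p))) p = 0"
    using C.pd_commute[OF sc p] by metis+
qed

lemma frame_hess_A:
  assumes "p \<in> C"
  shows "(\<Sum>i\<in>UNIV. \<Sum>j\<in>UNIV. fr n i p * fr m j p * hess A i j p) = hA n m p"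
proof -
  have n: "r p \<noteq> 0" using r_neq[OF assms] .
  note t = sum_4 frame_eq[OF assms] hess_def chr_def pd_A[OF assms] hess_A_table[OF assms] hA_def al_def nu_h[OF assms]
  show ?thesis
    by (cases n rule: index4_cases; cases m rule: index4_cases)
      (use n in \<open>simp_all add: t\<close>, use n in \<open>simp_all add: field_simps power2_eq_square\<close>)
qed

lemma frame_hess_cnj_A:
  assumes "p \<in> C"
  shows "(\<Sum>i\<in>UNIV. \<Sum>j\<in>UNIV. fr n i p * fr m j p * hess (\<lambda>p. cnj (A p)) i j p) = hB n m p"
proof -
  have n: "r p \<noteq> 0" "cnj (r p) \<noteq> 0" using r_neq[OF assms] by auto
  note t = sum_4 frame_eq[OF assms] hess_def chr_def pd_cnj_A[OF assms] hess_cnj_A_table[OF assms]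
    hess_A_table(1-4)[OF assms] hB_def al_def nu_h[OF assms] cnj_e cnj_h
  show ?thesis
    by (cases n rule: index4_cases; cases m rule: index4_cases)
      (use n in \<open>simp_all add: t\<close>, use n in \<open>simp_all add: field_simps power2_eq_square\<close>)
qed

lemma tetrad_2:
  assumes "p \<in> C"
  shows "icomp 2 [n, m, b, c, d, k] p
    = (16 * \<xi> n p * \<xi> m p + 4 * hA n m p) * (plane 1 b c * plane 1 d k)
      + (16 * \<eta> n p * \<eta> m p + 4 * hB n m p) * (plane 2 b c * plane 2 d k)"
proof -
  let ?B = "\<lambda>p. cnj (A p)"
  have "icomp 2 [n, m, b, c, d, k] p
    = (\<Sum>i\<in>UNIV. \<Sum>j\<in>UNIV. Hf p * (16 * pd i A p * pd j A p + 4 * hess A i j p) * (fr n i p * fr m j p)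
         * (plane 1 b c / (e p * h p)) * (plane 1 d k / (e p * h p))
      + cnj (Hf p) * (16 * pd i ?B p * pd j ?B p + 4 * hess ?B i j p) * (fr n i p * fr m j p)
         * (plane 2 b c * e p / h p) * (plane 2 d k * e p / h p))"
    unfolding tetrad_comp_6
    by (simp only: nabla_2[OF assms] sum_product_pairs frame_plane[OF assms]
        pd_exp4(2)[OF smooth_A Hf_exp(1) assms] pd_exp4(2)[OF smooth_on_cnj[OF C.open_S smooth_A] Hf_exp(2) assms])
  also have "\<dots> = (\<Sum>i\<in>UNIV. \<Sum>j\<in>UNIV.
      16 * ((fr n i p * pd i A p) * (fr m j p * pd j A p)) * (plane 1 b c * plane 1 d k)
      + 4 * (fr n i p * fr m j p * hess A i j p) * (plane 1 b c * plane 1 d k)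
      + 16 * ((fr n i p * pd i ?B p) * (fr m j p * pd j ?B p)) * (plane 2 b c * plane 2 d k)
      + 4 * (fr n i p * fr m j p * hess ?B i j p) * (plane 2 b c * plane 2 d k))"
    by (intro sum.cong refl) (simp add: Hf_eq[OF assms] cnj_e cnj_h power2_eq_square field_simps)
  also have "\<dots> = 16 * ((\<Sum>i\<in>UNIV. fr n i p * pd i A p) * (\<Sum>j\<in>UNIV. fr m j p * pd j A p)) * (plane 1 b c * plane 1 d k)
      + 4 * (\<Sum>i\<in>UNIV. \<Sum>j\<in>UNIV. fr n i p * fr m j p * hess A i j p) * (plane 1 b c * plane 1 d k)
      + 16 * ((\<Sum>i\<in>UNIV. fr n i p * pd i ?B p) * (\<Sum>j\<in>UNIV. fr m j p * pd j ?B p)) * (plane 2 b c * plane 2 d k)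
      + 4 * (\<Sum>i\<in>UNIV. \<Sum>j\<in>UNIV. fr n i p * fr m j p * hess ?B i j p) * (plane 2 b c * plane 2 d k)"
    unfolding sum_product by (simp only: sum.distrib sum_distrib_left sum_distrib_right)
  finally show ?thesis
    unfolding frame_pd_A[OF assms] frame_hess_A[OF assms] frame_hess_cnj_A[OF assms]
    by (simp add: algebra_simps)
qed

end

declare One_nat_def [simp del]

subsection \<open>Ranks of differentials\<close>

lemma dim_pair_iff:
  fixes v w :: "'a::field^'n"
  shows "vec.dim {v, w} = 2 \<longleftrightarrow> (\<exists>i j. v $ i * w $ j - v $ j * w $ i \<noteq> 0)"
proof -
  have "vec.dim {v, w} = 2 \<longleftrightarrow> w \<noteq> 0 \<and> (\<nexists>c. v = c *s w)"
    by (auto simp: vec.dim_insert vec.span_singleton)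
  also have "\<dots> \<longleftrightarrow> (\<exists>i j. v $ i * w $ j - v $ j * w $ i \<noteq> 0)"
  proof
    assume R: "w \<noteq> 0 \<and> (\<nexists>c. v = c *s w)"
    then obtain i where i: "w $ i \<noteq> 0" by (auto simp: vec_eq_iff)
    have "v \<noteq> (v $ i / w $ i) *s w" using R by blast
    then obtain j where "v $ j \<noteq> v $ i / w $ i * w $ j" by (auto simp: vec_eq_iff)
    then show "\<exists>i j. v $ i * w $ j - v $ j * w $ i \<noteq> 0"
      using i by (intro exI[of _ i] exI[of _ j]) (simp add: field_simps)
  next
    assume "\<exists>i j. v $ i * w $ j - v $ j * w $ i \<noteq> 0"
    then show "w \<noteq> 0 \<and> (\<nexists>c. v = c *s w)" by (auto simp: mult_ac)
  qed
  finally show ?thesis .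
qed

lemma span_pair: "w \<in> vec.span {u, v} \<longleftrightarrow> (\<exists>s t. w = s *s u + t *s v)"
  for u v w :: "'a::field^'n"
proof
  assume "w \<in> vec.span {u, v}"
  then show "\<exists>s t. w = s *s u + t *s v"
    unfolding vec.span_insert vec.span_singleton by auto (metis add.commute diff_add_cancel)
next
  assume "\<exists>s t. w = s *s u + t *s v"
  then show "w \<in> vec.span {u, v}"
    by (elim exE) (simp add: vec.span_add vec.span_scale vec.span_base)
qed

definition wedge3 :: "complex^4 \<Rightarrow> complex^4 \<Rightarrow> complex^4 \<Rightarrow> 4 \<Rightarrow> 4 \<Rightarrow> 4 \<Rightarrow> complex" where
  "wedge3 u v w i j k = u $ i * (v $ j * w $ k - v $ k * w $ j)
     - u $ j * (v $ i * w $ k - v $ k * w $ i) + u $ k * (v $ i * w $ j - v $ j * w $ i)"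

text \<open>Cramer's rule: the nonzero minor in rows \<open>i\<close> and \<open>j\<close> allows
  the vanishing 3 by 3 minors on rows \<open>i\<close>, \<open>j\<close>, \<open>k\<close> to be
  solved for \<open>w $ k\<close>.\<close>

lemma span_pair_iff_wedge3:
  assumes "u $ i * v $ j - u $ j * v $ i \<noteq> 0"
  shows "w \<in> vec.span {u, v} \<longleftrightarrow> (\<forall>i j k. wedge3 u v w i j k = 0)"
proof
  assume "w \<in> vec.span {u, v}"
  then obtain s t where "w = s *s u + t *s v" unfolding span_pair by blast
  then show "\<forall>i j k. wedge3 u v w i j k = 0"
    by (auto simp: wedge3_def algebra_simps)
next
  assume R: "\<forall>i j k. wedge3 u v w i j k = 0"
  let ?D = "u $ i * v $ j - u $ j * v $ i"
  define D N1 N2 where "D = ?D" and "N1 = w $ i * v $ j - w $ j * v $ i" and "N2 = u $ i * w $ j - u $ j * w $ i"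
  have D: "D \<noteq> 0" using assms by (simp add: D_def)
  have "w $ k * D = N1 * u $ k + N2 * v $ k" for k
    using R[rule_format, of i j k] unfolding wedge3_def D_def N1_def N2_def by algebra
  then have "w $ k = (N1 * u $ k + N2 * v $ k) / D" for k
    using D by (simp add: nonzero_eq_divide_eq)
  then have "w = (N1 / D) *s u + (N2 / D) *s v"
    by (simp add: vec_eq_iff add_divide_distrib)
  then show "w \<in> vec.span {u, v}" unfolding span_pair by blast
qed

text \<open>Three covectors on a three-dimensional space that annihilate a common nonzero vector are
  dependent: each of \<open>c1\<close>, \<open>c2\<close>, \<open>c3\<close> times their determinant
  is 0. All other minors agree with this one up to sign, repeat an index, or contain the index
  4.\<close>

lemma wedge3_zero:
  assumes c: "c1 \<noteq> 0 \<or> c2 \<noteq> 0 \<or> c3 \<noteq> 0"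
    and k: "\<And>y. y \<in> {u, v, w} \<Longrightarrow> c1 * y $ 1 + c2 * y $ 2 + c3 * y $ 3 = 0 \<and> y $ 4 = 0"
  shows "wedge3 u v w i j k = 0"
proof -
  note ku = k[of u, simplified] and kv = k[of v, simplified] and kw = k[of w, simplified]
  have "c1 * wedge3 u v w 1 2 3 = 0" "c2 * wedge3 u v w 1 2 3 = 0" "c3 * wedge3 u v w 1 2 3 = 0"
    unfolding wedge3_def using ku kv kw by algebra+
  then have D: "wedge3 u v w 1 2 3 = 0" using c by auto
  show ?thesis
    by (cases i rule: index4_cases; cases j rule: index4_cases; cases k rule: index4_cases)
      (use D ku kv kw in \<open>auto simp: wedge3_def algebra_simps\<close>)
qed

definition grad :: "(pt \<Rightarrow> complex) \<Rightarrow> pt \<Rightarrow> complex^4" where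
  "grad G p = (\<chi> i. pd i G p)"

lemma grad_nth [simp]: "grad G p $ i = pd i G p"
  by (simp add: grad_def)

lemma differential_rank_grad: "differential_rank \<F> p = vec.dim ((\<lambda>G. grad G p) ` \<F>)"
  by (simp add: differential_rank_def grad_def)

context smooth_domain
begin

lemma grad_cong:
  assumes "p \<in> S" "\<And>q. q \<in> S \<Longrightarrow> F q = G q"
  shows "grad F p = grad G p"
  unfolding vec_eq_iff grad_nth by (intro allI pd_eq[OF assms])

lemma grad_const [simp]: "grad (\<lambda>_. c) p = 0"
  by (simp add: vec_eq_iff)

lemma grad_mult: "smooth_on S F \<Longrightarrow> smooth_on S G \<Longrightarrow> p \<in> S \<Longrightarrow>
    grad (\<lambda>p. F p * G p) p = G p *s grad F p + F p *s grad G p"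
  by (simp add: vec_eq_iff pd_mult)

lemma grad_combine:
  assumes "smooth_on S F" "smooth_on S G" "p \<in> S"
  shows "grad (\<lambda>p. F p * c + G p * d) p = c *s grad F p + d *s grad G p"
  using assms by (simp add: vec_eq_iff pd_add pd_mult smooth)

lemma grad_mult_mem:
  assumes "vec.subspace W" "smooth_on S F" "smooth_on S G" "p \<in> S" "grad F p \<in> W" "grad G p \<in> W"
  shows "grad (\<lambda>p. F p * G p) p \<in> W"
  using assms by (simp add: grad_mult vec.subspace_add vec.subspace_scale)

text \<open>Second-order tetrad components carry powers of cnj \<alpha>; the product rule allows
  such a nonvanishing factor to be stripped off without leaving the subspace.\<close>

lemma grad_mult_cancel:
  assumes "vec.subspace W" "smooth_on S F" "smooth_on S G" "p \<in> S" "G p \<noteq> 0"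
    "grad G p \<in> W" "grad (\<lambda>p. F p * G p) p \<in> W"
  shows "grad F p \<in> W"
proof -
  have "(1 / G p) *s (grad (\<lambda>p. F p * G p) p - F p *s grad G p) \<in> W"
    using assms by (intro vec.subspace_scale vec.subspace_diff) auto
  moreover have "(1 / G p) *s (grad (\<lambda>p. F p * G p) p - F p *s grad G p) = grad F p"
    using assms by (simp add: grad_mult)
  ultimately show ?thesis by simp
qed

end

context pp_wave
begin

section \<open>Spans of the gradients of the invariants of order one and two\<close>

abbreviation "cal \<equiv> (\<lambda>p. cnj (al p))"
abbreviation "r1 \<equiv> pd 1 r"
abbreviation "qh \<equiv> (\<lambda>p. pd 1 q p / h p)"
abbreviation "nuf \<equiv> nu f a Z"

lemma smooth_nu: "smooth_on C nuf"
proof -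
  have "smooth_on C (\<lambda>p. (pd 3 q p + q p * pd 1 q p + cnj (pd 1 F p)) * e p / (h p)\<^sup>2)"
    by (simp add: sm_C)
  then show ?thesis by (subst smooth_on_cong[OF C.open_S nu_h]) auto
qed

lemmas sm_inv = sm_C smooth_al smooth_nu

definition "W p = vec.span {grad al p, grad cal p}"

lemma W_subspace: "vec.subspace (W p)" and al_W: "grad al p \<in> W p" and cal_W: "grad cal p \<in> W p"
  by (auto simp: W_def vec.subspace_span vec.span_base)

text \<open>The two spanning gradients are conjugates of each other, so \<open>W\<close> contains
  with the differential of a function also that of its conjugate. Membership then has to be tested
  for L_a, \<mu> and \<nu> alone.\<close>

lemma grad_cnj_W:
  assumes p: "p \<in> C" and G: "smooth_on C G" and "grad G p \<in> W p"
  shows "grad (\<lambda>p. cnj (G p)) p \<in> W p"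
proof -
  obtain s t where st: "grad G p = s *s grad al p + t *s grad cal p"
    using assms(3) unfolding W_def span_pair by blast
  have e: "pd i G p = s * pd i al p + t * pd i cal p" for i
    using arg_cong[OF st, of "\<lambda>v. v $ i"] by simp
  have "grad (\<lambda>p. cnj (G p)) p = cnj t *s grad al p + cnj s *s grad cal p"
    unfolding vec_eq_iff forall_4
    using C.pd_cnj[OF smooth_al p] by (simp add: C.pd_cnj[OF G p] e add.commute)
  then show ?thesis unfolding W_def span_pair by blast
qed

lemma nabla_comp_cases:
  assumes "G \<in> curvature_invariants f a Z 2"
  obtains b c d k where "G = icomp 0 [b, c, d, k]"
  | n b c d k where "G = icomp 1 [n, b, c, d, k]"
  | n m b c d k where "G = icomp 2 [n, m, b, c, d, k]"
proof -
  obtain s cs where G: "G = icomp s cs" "s \<le> 2" "length cs = 4 + s"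
    using assms by (auto simp: curvature_invariants_def)
  then have "s = 0 \<or> s = 1 \<or> s = 2" by auto
  then show ?thesis
    using G that by (auto simp: length_Suc_conv numeral_eq_Suc One_nat_def)
qed

lemma grad_0:
  assumes "p \<in> C"
  shows "grad (icomp 0 [b, c, d, k]) p = 0"
  by (subst C.grad_cong[OF assms tetrad_0]) auto

lemma \<xi>\<eta>:
  "smooth_on C (\<xi> n)" "smooth_on C (\<eta> n)" "grad (\<xi> n) p \<in> W p" "grad (\<eta> n) p \<in> W p"
proof -
  have "\<xi> n = (if n = 1 then al else (\<lambda>_. 0))" "\<eta> n = (if n = 2 then cal else (\<lambda>_. 0))"
    by (auto simp: \<xi>_def \<eta>_def)
  then show "smooth_on C (\<xi> n)" "smooth_on C (\<eta> n)" "grad (\<xi> n) p \<in> W p" "grad (\<eta> n) p \<in> W p"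
    by (auto simp: sm_inv al_W cal_W vec.subspace_0[OF W_subspace])
qed

lemma grad_1:
  assumes "p \<in> C"
  shows "grad (icomp 1 [n, b, c, d, k]) p
    = (4 * (plane 1 b c * plane 1 d k)) *s grad (\<xi> n) p + (4 * (plane 2 b c * plane 2 d k)) *s grad (\<eta> n) p"
proof -
  have "grad (icomp 1 [n, b, c, d, k]) p
     = grad (\<lambda>p. \<xi> n p * (4 * (plane 1 b c * plane 1 d k)) + \<eta> n p * (4 * (plane 2 b c * plane 2 d k))) p"
    by (rule C.grad_cong[OF assms]) (simp add: tetrad_1)
  then show ?thesis using C.grad_combine[OF \<xi>\<eta>(1,2) assms] by simp
qed

lemma smooth_hess: "smooth_on C (hA n m)" "smooth_on C (hB n m)"
  by (auto simp: hA_def hB_def sm_inv simp del: complex_cnj_divide)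

lemma grad_2:
  assumes "p \<in> C"
  shows "grad (icomp 2 [n, m, b, c, d, k]) p
    = (plane 1 b c * plane 1 d k) *s grad (\<lambda>p. 16 * \<xi> n p * \<xi> m p + 4 * hA n m p) p
      + (plane 2 b c * plane 2 d k) *s grad (\<lambda>p. 16 * \<eta> n p * \<eta> m p + 4 * hB n m p) p"
proof -
  have "grad (icomp 2 [n, m, b, c, d, k]) p
     = grad (\<lambda>p. (16 * \<xi> n p * \<xi> m p + 4 * hA n m p) * (plane 1 b c * plane 1 d k)
       + (16 * \<eta> n p * \<eta> m p + 4 * hB n m p) * (plane 2 b c * plane 2 d k)) p"
    by (rule C.grad_cong[OF assms]) (simp add: tetrad_2)
  then show ?thesis using C.grad_combine[OF _ _ assms] by (simp add: sm_inv \<xi>\<eta> smooth_hess)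
qed

lemma grad_linear:
  assumes "p \<in> C" "smooth_on C G"
  shows "grad (\<lambda>p. c * G p) p = c *s grad G p" "grad (\<lambda>p. - G p) p = - grad G p"
  using assms by (simp_all add: vec_eq_iff C.pd_simps sm)

lemma hess_W:
  assumes p: "p \<in> C" and "grad r1 p \<in> W p" "grad qh p \<in> W p" "grad nuf p \<in> W p"
  shows "grad (hA n m) p \<in> W p" "grad (hB n m) p \<in> W p"
proof -
  have s: "smooth_on C r1" "smooth_on C qh" by (simp_all add: sm_inv)
  note cj = grad_cnj_W[OF p s(1) assms(2)] grad_cnj_W[OF p s(2) assms(3)] grad_cnj_W[OF p smooth_nu assms(4)]
  note mm = C.grad_mult_mem[OF W_subspace _ _ p]
  have "grad (\<lambda>p. al p * al p) p \<in> W p" "grad (\<lambda>p. cal p * cal p) p \<in> W p"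
    by (intro mm al_W cal_W; simp add: sm_inv)+
  then have sq: "grad (\<lambda>p. (al p)\<^sup>2) p \<in> W p" "grad (\<lambda>p. (cal p)\<^sup>2) p \<in> W p"
    by (simp_all add: power2_eq_square)
  have t: "grad (\<lambda>p. - (pd 1 r p * (al p)\<^sup>2)) p \<in> W p" "grad (\<lambda>p. - (al p * (pd 1 q p / h p))) p \<in> W p"
    "grad (\<lambda>p. - (nuf p * al p)) p \<in> W p"
    "grad (\<lambda>p. - (cnj (pd 1 r p) * (cnj (al p))\<^sup>2)) p \<in> W p"
    "grad (\<lambda>p. - (cnj (al p) * cnj (pd 1 q p / h p))) p \<in> W p"
    "grad (\<lambda>p. - (cnj (nuf p) * cnj (al p))) p \<in> W p"
    by (subst grad_linear(2)[OF p]; (intro vec.subspace_neg[OF W_subspace] mm al_W cal_W sq cj assms)?;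
        simp add: sm_inv del: complex_cnj_divide)+
  then show "grad (hA n m) p \<in> W p" "grad (hB n m) p \<in> W p"
    by (auto simp: hA_def hB_def vec.subspace_0[OF W_subspace] simp del: complex_cnj_divide)
qed

lemma span_order_1:
  assumes p: "p \<in> C"
  shows "vec.span ((\<lambda>G. grad G p) ` curvature_invariants f a Z 1) = W p"
proof (rule vec.span_unique)
  show "(\<lambda>G. grad G p) ` curvature_invariants f a Z 1 \<subseteq> W p"
  proof (rule image_subsetI)
    fix G assume G: "G \<in> curvature_invariants f a Z 1"
    obtain s cs where Gs: "G = icomp s cs" "s \<le> 1" "length cs = 4 + s"
      using G by (auto simp: curvature_invariants_def)
    show "grad G p \<in> W p"
    proof (cases "s = 0")
      case True
      then obtain b c d k where "G = icomp 0 [b, c, d, k]"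
        using Gs by (auto simp: length_Suc_conv numeral_eq_Suc)
      then show ?thesis using p W_subspace by (simp add: grad_0 vec.subspace_0)
    next
      case False
      then have "s = 1" using Gs by simp
      then obtain n b c d k where "G = icomp 1 [n, b, c, d, k]"
        using Gs by (auto simp: length_Suc_conv numeral_eq_Suc One_nat_def)
      then show ?thesis
        using p W_subspace \<xi>\<eta> by (simp add: grad_1 vec.subspace_add vec.subspace_scale)
    qed
  qed
  show "vec.subspace (W p)" by (rule W_subspace)
  fix T assume T: "(\<lambda>G. grad G p) ` curvature_invariants f a Z 1 \<subseteq> T" "vec.subspace T"
  have "icomp 1 cs \<in> curvature_invariants f a Z 1" if "length cs = 5" for cs
    using that by (force simp: curvature_invariants_def)
  then have m: "grad (icomp 1 cs) p \<in> T" if "length cs = 5" for cs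
    using T(1) that by blast
  have "\<xi> 1 = al" "\<xi> 2 = (\<lambda>_. 0)" "\<eta> 2 = cal" "\<eta> 1 = (\<lambda>_. 0)" by (auto simp: \<xi>_def \<eta>_def)
  \<comment> \<open>The last four indices 1, 3, 1, 3 select the first 2-form with coefficient 1 and
    annihilate the second; 2, 3, 2, 3 do the opposite.\<close>
  then have "4 *s grad al p \<in> T" "4 *s grad cal p \<in> T"
    using m[of "[1, 1, 3, 1, 3]"] m[of "[2, 2, 3, 2, 3]"] by (simp_all add: grad_1[OF p] plane_def)
  from this[THEN vec.subspace_scale[OF T(2), of _ "1/4"]]
  have "grad al p \<in> T" "grad cal p \<in> T" by simp_all
  then show "W p \<subseteq> T" unfolding W_def by (intro vec.span_minimal T(2)) simp
qed

lemma order_2_mem: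
  assumes p: "p \<in> C" and T: "vec.subspace T" "(\<lambda>G. grad G p) ` curvature_invariants f a Z 2 \<subseteq> T"
  shows "grad al p \<in> T" "grad cal p \<in> T" "grad r1 p \<in> T" "grad qh p \<in> T" "grad nuf p \<in> T"
proof -
  have "curvature_invariants f a Z 1 \<subseteq> curvature_invariants f a Z 2"
    by (force simp: curvature_invariants_def)
  then have WT: "W p \<subseteq> T"
    unfolding span_order_1[OF p, symmetric] using T by (intro vec.span_minimal) auto
  then show al: "grad al p \<in> T" and "grad cal p \<in> T" using al_W[of p] cal_W[of p] by blast+
  have "icomp 2 cs \<in> curvature_invariants f a Z 2" if "length cs = 6" for cs
    using that by (force simp: curvature_invariants_def)
  then have m: "grad (icomp 2 cs) p \<in> T" if "length cs = 6" for cs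
    using T(2) that by blast
  have H: "grad (hA n k) p \<in> T" for n k
  proof -
    let ?Q = "grad (\<lambda>p. 16 * \<xi> n p * \<xi> k p + 4 * hA n k p) p"
    have Q: "?Q \<in> T"
      using m[of "[n, k, 1, 3, 1, 3]"] by (simp add: grad_2[OF p] plane_def)
    have "?Q = (16 * \<xi> k p) *s grad (\<xi> n) p + (16 * \<xi> n p) *s grad (\<xi> k) p + 4 *s grad (hA n k) p"
      using p by (simp add: vec_eq_iff C.pd_simps sm \<xi>\<eta> smooth_hess)
    then have e: "4 *s grad (hA n k) p = ?Q - ((16 * \<xi> k p) *s grad (\<xi> n) p + (16 * \<xi> n p) *s grad (\<xi> k) p)"
      by simp
    have "grad (\<xi> n) p \<in> T" "grad (\<xi> k) p \<in> T" using \<xi>\<eta>(3) WT by blast+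
    then have "4 *s grad (hA n k) p \<in> T"
      unfolding e by (intro vec.subspace_diff vec.subspace_add vec.subspace_scale T(1) Q)
    from vec.subspace_scale[OF T(1) this, of "1/4"] show ?thesis by simp
  qed
  note cancel = C.grad_mult_cancel[OF T(1) _ _ p]
  have "hA 1 1 = (\<lambda>p. - (r1 p * (al p * al p)))" "hA 1 3 = (\<lambda>p. - (qh p * al p))"
    "hA 3 3 = (\<lambda>p. - (nuf p * al p))" by (auto simp: hA_def power2_eq_square)
  then have "- grad (\<lambda>p. r1 p * (al p * al p)) p \<in> T" "- grad (\<lambda>p. qh p * al p) p \<in> T"
    "- grad (\<lambda>p. nuf p * al p) p \<in> T"
    using H[of 1 1] H[of 1 3] H[of 3 3]
    by (simp_all add: grad_linear(2)[OF p] sm_inv)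
  from this[THEN vec.subspace_neg[OF T(1)]]
  have "grad (\<lambda>p. r1 p * (al p * al p)) p \<in> T" "grad (\<lambda>p. qh p * al p) p \<in> T"
    "grad (\<lambda>p. nuf p * al p) p \<in> T" by simp_all
  then show "grad r1 p \<in> T" "grad qh p \<in> T" "grad nuf p \<in> T"
    using cancel[of r1 "\<lambda>p. al p * al p"] cancel[of qh al] cancel[of nuf al] al al_neq[OF p]
      C.grad_mult_mem[OF T(1) smooth_al smooth_al p al al]
    by (simp_all add: sm_inv)
qed

lemma order_2_subset:
  assumes p: "p \<in> C" and "grad r1 p \<in> W p" "grad qh p \<in> W p" "grad nuf p \<in> W p"
  shows "(\<lambda>G. grad G p) ` curvature_invariants f a Z 2 \<subseteq> W p"
proof (rule image_subsetI)
  fix G assume "G \<in> curvature_invariants f a Z 2"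
  note W = W_subspace[of p]
  have mem: "grad (\<lambda>p. 16 * X p * Y p + 4 * Q p) p \<in> W p"
    if "smooth_on C X" "smooth_on C Y" "smooth_on C Q" "grad X p \<in> W p" "grad Y p \<in> W p" "grad Q p \<in> W p"
    for X Y Q
  proof -
    have "grad (\<lambda>p. 16 * X p * Y p + 4 * Q p) p
      = (16 * Y p) *s grad X p + (16 * X p) *s grad Y p + 4 *s grad Q p"
      using p that by (simp add: vec_eq_iff C.pd_simps sm)
    then show ?thesis using that W by (simp add: vec.subspace_add vec.subspace_scale)
  qed
  show "grad G p \<in> W p"
    using \<open>G \<in> _\<close>
  proof (cases rule: nabla_comp_cases)
    case (1 b c d k)
    then show ?thesis using p W by (simp add: grad_0 vec.subspace_0)
  next
    case (2 n b c d k)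
    then show ?thesis using p W \<xi>\<eta> by (simp add: grad_1 vec.subspace_add vec.subspace_scale)
  next
    case (3 n m b c d k)
    then show ?thesis
      using p W \<xi>\<eta> hess_W[OF assms] smooth_hess mem
      by (simp add: grad_2 vec.subspace_add vec.subspace_scale)
  qed
qed

text \<open>The order-one gradients span \<open>W\<close>, and order two adds those of L_a, \<mu>,
  \<nu> and their conjugates. Since the span at order two contains \<open>W\<close>, equal rank 2 at
  both orders means that nothing new was added.\<close>

lemma invariant_count_iff:
  "invariant_count U f a Z [0, 2, 2] \<longleftrightarrow>
    (\<forall>p\<in>U. vec.dim {grad al p, grad cal p} = 2 \<and> grad r1 p \<in> W p \<and> grad qh p \<in> W p \<and> grad nuf p \<in> W p)"
proof -
  have rank1: "differential_rank (curvature_invariants f a Z 1) p = vec.dim {grad al p, grad cal p}"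
    if "p \<in> U" for p
    unfolding differential_rank_grad
    using span_order_1[OF inC[OF that]] vec.span_eq_dim by (auto simp: W_def)
  have "{1..2::nat} = {1, 2}" by auto
  then have "invariant_count U f a Z [0, 2, 2] \<longleftrightarrow>
    (\<forall>p\<in>U. vec.dim {grad al p, grad cal p} = 2 \<and> differential_rank (curvature_invariants f a Z 2) p = 2)"
    using rank1 by (auto simp: invariant_count_def)
  also have "\<dots> \<longleftrightarrow> (\<forall>p\<in>U. vec.dim {grad al p, grad cal p} = 2 \<and> grad r1 p \<in> W p \<and> grad qh p \<in> W p \<and> grad nuf p \<in> W p)"
  proof (intro ball_cong refl conj_cong)
    fix p assume pU: "p \<in> U" and d: "vec.dim {grad al p, grad cal p} = 2"
    note p = inC[OF pU]
    let ?I = "(\<lambda>G. grad G p) ` curvature_invariants f a Z 2"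
    have dW: "vec.dim (W p) = 2" using d by (simp add: W_def)
    have WI: "W p \<subseteq> vec.span ?I"
      unfolding W_def using order_2_mem(1,2)[OF p vec.subspace_span vec.span_superset]
      by (intro vec.span_minimal vec.subspace_span) auto
    show "differential_rank (curvature_invariants f a Z 2) p = 2
      \<longleftrightarrow> grad r1 p \<in> W p \<and> grad qh p \<in> W p \<and> grad nuf p \<in> W p"
    proof
      assume "differential_rank (curvature_invariants f a Z 2) p = 2"
      then have "vec.dim (vec.span ?I) = 2" by (simp add: differential_rank_grad)
      then have "W p = vec.span ?I"
        using vec.subspace_dim_equal[OF W_subspace vec.subspace_span WI] dW by simp
      then show "grad r1 p \<in> W p \<and> grad qh p \<in> W p \<and> grad nuf p \<in> W p"
        using order_2_mem(3-5)[OF p vec.subspace_span vec.span_superset] by simp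
    next
      assume "grad r1 p \<in> W p \<and> grad qh p \<in> W p \<and> grad nuf p \<in> W p"
      then have "?I \<subseteq> W p" using order_2_subset[OF p] by blast
      then have "vec.span ?I = W p" using WI vec.span_minimal[OF _ W_subspace] by blast
      then show "differential_rank (curvature_invariants f a Z 2) p = 2"
        using dW unfolding differential_rank_grad by (metis vec.dim_span)
    qed
  qed
  finally show ?thesis .
qed

section \<open>Kernel directions, symmetries and wedge conditions in terms of gradients\<close>

lemma pd4_inv:
  assumes "p \<in> C"
  shows "pd 4 al p = 0" "pd 4 cal p = 0" "pd 4 r1 p = 0" "pd 4 qh p = 0"
proof -
  show 1: "pd 4 al p = 0"
    unfolding al_def[abs_def] using assms r_neq by (simp add: C.pd_simps sm_C pd_e pd_r)
  show "pd 4 cal p = 0" using C.pd_cnj[OF smooth_al assms] 1 by simp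
  show "pd 4 r1 p = 0" using pd2_pd1(3) assms by simp
  show "pd 4 qh p = 0" using assms by (simp add: C.pd_simps sm_C pd_h pd2_pd1)
qed

lemma along_grad_span:
  assumes "grad G p \<in> W p" "along x x' \<rho> al p = 0" "along x x' \<rho> cal p = 0"
  shows "along x x' \<rho> G p = 0"
proof -
  obtain s t where st: "grad G p = s *s grad al p + t *s grad cal p"
    using assms(1) unfolding W_def span_pair by blast
  have e: "pd i G p = s * pd i al p + t * pd i cal p" for i
    using arg_cong[OF st, of "\<lambda>v. v $ i"] by simp
  have "along x x' \<rho> G p = s * along x x' \<rho> al p + t * along x x' \<rho> cal p"
    unfolding along_def e by (simp add: algebra_simps)
  then show ?thesis using assms by simp
qed

text \<open>If the cross product vanished, the differentials of log cnj \<alpha> and log \<alpha>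
  would be proportional, with factor - (1 + L_a), and all 2 by 2 minors would be zero.\<close>

lemma dim_imp_k_neq:
  assumes p: "p \<in> C" and "vec.dim {grad al p, grad cal p} = 2"
  shows "kx p \<noteq> 0 \<or> k\<rho> p \<noteq> 0"
proof (rule ccontr)
  assume "\<not> ?thesis"
  then have k: "kx p = 0" "k\<rho> p = 0" by auto
  define m where "m = 1 + pd 1 r p"
  have mm: "m * cnj m = 1" and l: "cnj (pd 1 q p) = - pd 1 q p * cnj m"
    using k unfolding kx_def k\<rho>_def m_def complex_cnj_add complex_cnj_one by algebra+
  have along: "along x x' \<rho> al p * cnj (al p) = - m * al p * along x x' \<rho> cal p" for x x' \<rho>
  proof -
    have 1: "along x x' \<rho> al p = al p * (x' - x * m - \<rho> * pd 1 q p)"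
      by (simp add: along_al[OF p] m_def algebra_simps)
    have 2: "along x x' \<rho> cal p = cnj (al p) * (x - x' * cnj m - \<rho> * cnj (pd 1 q p))"
      by (simp add: along_cnj_al[OF p] m_def algebra_simps)
    show ?thesis unfolding 1 2 l using mm by algebra
  qed
  have n: "r p \<noteq> 0" "cnj (r p) \<noteq> 0" "cnj (al p) \<noteq> 0" using r_neq[OF p] al_neq[OF p] by auto
  \<comment> \<open>The coordinate derivations at fixed v, rewritten for the coordinates (a, cnj a,
    u); the u-derivative at fixed \<zeta> moves a at the rate - q / r.\<close>
  have rec: "pd 1 G p = along (1 / r p) 0 0 G p" "pd 2 G p = along 0 (1 / cnj (r p)) 0 G p"
    "pd 3 G p = along (- q p / r p) (- cnj (q p) / cnj (r p)) 1 G p" for G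
    using n by (simp_all add: along_def)
  have "pd i al p * cnj (al p) = - m * al p * pd i cal p" for i
    using along pd4_inv[OF p] by (cases i rule: index4_cases) (simp_all add: rec)
  then have "pd i al p = (- m * al p / cnj (al p)) * pd i cal p" for i
    using n by (simp add: field_simps)
  then have "grad al p $ i * grad cal p $ j - grad al p $ j * grad cal p $ i = 0" for i j
    by (simp add: mult_ac)
  then show False using assms(2) unfolding dim_pair_iff by blast
qed

text \<open>The functions involved are independent of v and are annihilated by the symmetry, which
  is nonzero on the space of (\<zeta>, u). Their differentials thus lie in a two-dimensional space,
  and \<open>W\<close> exhausts it.\<close>

lemma symmetry_grad_W:
  assumes "symmetry x \<rho>" and p: "p \<in> U" and d: "vec.dim {grad al p, grad cal p} = 2"
  shows "grad r1 p \<in> W p" "grad qh p \<in> W p"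
proof -
  define Y where "Y = complex_of_real (\<rho> - 2 * Re x * fst (snd p))"
  note pC = inC[OF p]
  define c1 c2 where "c1 = x * r p + Y * q p" and "c2 = cnj x * cnj (r p) + Y * cnj (q p)"
  have c: "c1 \<noteq> 0 \<or> c2 \<noteq> 0 \<or> Y \<noteq> 0"
    using assms(1) r_neq[OF pC] by (auto simp: c1_def Y_def symmetry_def)
  have al: "along x (cnj x) Y G p = c1 * pd 1 G p + c2 * pd 2 G p + Y * pd 3 G p" for G
    by (simp add: along_def c1_def c2_def)
  have z: "c1 * pd 1 G p + c2 * pd 2 G p + Y * pd 3 G p = 0 \<and> pd 4 G p = 0"
    if "G = al \<or> G = cal \<or> G = r1 \<or> G = qh" for G
    using symmetry_along[OF assms(1) p, folded Y_def] pd4_inv[OF pC] that unfolding al[symmetric] by auto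
  obtain i j where ij: "grad al p $ i * grad cal p $ j - grad al p $ j * grad cal p $ i \<noteq> 0"
    using d unfolding dim_pair_iff by blast
  have "wedge3 (grad al p) (grad cal p) (grad G p) i j k = 0" if G: "G = r1 \<or> G = qh" for G i j k
  proof (rule wedge3_zero[OF c])
    fix y assume "y \<in> {grad al p, grad cal p, grad G p}"
    then obtain G' where "y = grad G' p" "G' = al \<or> G' = cal \<or> G' = r1 \<or> G' = qh"
      using G by blast
    then show "c1 * y $ 1 + c2 * y $ 2 + Y * y $ 3 = 0 \<and> y $ 4 = 0" using z[of G'] by simp
  qed
  then show "grad r1 p \<in> W p" "grad qh p \<in> W p"
    unfolding W_def span_pair_iff_wedge3[OF ij] by simp_all
qed

lemma wedges:
  assumes p: "p \<in> U"
  shows "(\<exists>i j. wedge11 (d_fun (alpha a)) (d_fun (\<lambda>q. cnj (alpha a q))) i j p \<noteq> 0)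
      \<longleftrightarrow> vec.dim {grad al p, grad cal p} = 2"
    and "vec.dim {grad al p, grad cal p} = 2 \<Longrightarrow>
      (\<forall>i j k. wedge12 (d_fun (alpha a)) (wedge11 (d_fun (\<lambda>q. cnj (alpha a q))) (d_fun (nu f a Z))) i j k p = 0)
      \<longleftrightarrow> grad nuf p \<in> W p"
proof -
  note pC = inC[OF p]
  have g: "d_fun (alpha a) i p = pd i cal p" "d_fun (\<lambda>q. cnj (alpha a q)) i p = pd i al p" for i
    using C.pd_eq[OF pC, of "alpha a" cal] C.pd_eq[OF pC, of "\<lambda>q. cnj (alpha a q)" al]
    by (simp_all add: d_fun_def alpha_al)
  have sw: "{grad al p, grad cal p} = {grad cal p, grad al p}" by auto
  show "(\<exists>i j. wedge11 (d_fun (alpha a)) (d_fun (\<lambda>q. cnj (alpha a q))) i j p \<noteq> 0)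
      \<longleftrightarrow> vec.dim {grad al p, grad cal p} = 2"
    unfolding sw dim_pair_iff by (simp add: wedge11_def g)
  assume "vec.dim {grad al p, grad cal p} = 2"
  then obtain i j where ij: "grad cal p $ i * grad al p $ j - grad cal p $ j * grad al p $ i \<noteq> 0"
    unfolding sw dim_pair_iff by blast
  show "(\<forall>i j k. wedge12 (d_fun (alpha a)) (wedge11 (d_fun (\<lambda>q. cnj (alpha a q))) (d_fun (nu f a Z))) i j k p = 0)
      \<longleftrightarrow> grad nuf p \<in> W p"
    unfolding W_def sw span_pair_iff_wedge3[OF ij] wedge3_def wedge12_def wedge11_def
    by (simp add: g) (simp add: d_fun_def)
qed

lemma invariant_count_characterization:
  "invariant_count U f a Z [0, 2, 2] \<longleftrightarrow>
      (\<exists>V. tetrad_symmetry V) \<and>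
      (\<forall>p\<in>U. \<exists>i j. wedge11 (d_fun (alpha a)) (d_fun (\<lambda>q. cnj (alpha a q))) i j p \<noteq> 0) \<and>
      (\<forall>p\<in>U. \<forall>i j k. wedge12 (d_fun (alpha a))
           (wedge11 (d_fun (\<lambda>q. cnj (alpha a q))) (d_fun (nu f a Z))) i j k p = 0)"
  (is "?L \<longleftrightarrow> ?V \<and> ?A \<and> ?B")
proof
  assume ?L
  then have L: "vec.dim {grad al p, grad cal p} = 2" "grad r1 p \<in> W p" "grad qh p \<in> W p" "grad nuf p \<in> W p"
    if "p \<in> U" for p using that by (auto simp: invariant_count_iff)
  have "\<exists>x \<rho>. symmetry x \<rho>"
  proof (rule symmetry_from_kernel)
    fix p assume p: "p \<in> U"
    show "kx p \<noteq> 0 \<or> k\<rho> p \<noteq> 0" using dim_imp_k_neq[OF inC[OF p] L(1)[OF p]] .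
    show "along (kx p) (cnj (kx p)) (k\<rho> p) (pd 1 r) p = 0"
      "along (kx p) (cnj (kx p)) (k\<rho> p) (\<lambda>p. pd 1 q p / h p) p = 0"
      using along_grad_span[OF _ along_k[OF inC[OF p]]] L(2,3)[OF p] by blast+
  qed
  then show "?V \<and> ?A \<and> ?B" using symmetry_imp_tetrad_symmetry wedges L by blast
next
  assume R: "?V \<and> ?A \<and> ?B"
  then obtain x \<rho> where s: "symmetry x \<rho>" using tetrad_symmetry_imp_symmetry by blast
  show ?L unfolding invariant_count_iff
  proof
    fix p assume p: "p \<in> U"
    have d: "vec.dim {grad al p, grad cal p} = 2" using wedges(1)[OF p] R p by blast
    moreover have "grad nuf p \<in> W p" using wedges(2)[OF p d] R p by blast
    ultimately show "vec.dim {grad al p, grad cal p} = 2 \<and> grad r1 p \<in> W p \<and> grad qh p \<in> W p \<and> grad nuf p \<in> W p"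
      using symmetry_grad_W[OF s p d] by blast
  qed
qed

end

subsection \<open>Killing fields\<close>

context smooth_domain
begin

lemma slice_constant:
  assumes G: "smooth_on S G" and S: "S = P \<times> I \<times> J" "convex P" "convex J"
    and pd0: "\<And>p. p \<in> S \<Longrightarrow> pd 1 G p = 0 \<and> pd 2 G p = 0 \<and> pd 4 G p = 0"
    and p: "(z, u, v) \<in> S" "(z', u, v') \<in> S"
  shows "G (z, u, v) = G (z', u, v')"
proof -
  let ?G = "\<lambda>x. G (fst x, u, snd x)"
  have "?G (z, v) = ?G (z', v')"
  proof (rule has_derivative_zero_unique[of "P \<times> J"])
    show "convex (P \<times> J)" using S by (simp add: convex_Times)
    show "(z, v) \<in> P \<times> J" "(z', v') \<in> P \<times> J" using p S by auto
    fix x assume x: "x \<in> P \<times> J"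
    have xS: "(fst x, u, snd x) \<in> S" using x p S by auto
    have "((\<lambda>x. (fst x, u, snd x)) has_derivative (\<lambda>h. (fst h, 0, snd h))) (at x)"
      by (auto intro!: derivative_eq_intros)
    from has_derivative_compose[OF this has_derivative_pd[OF differentiable[OF G xS]]]
    have "(?G has_derivative (\<lambda>h. 0)) (at x)" using pd0[OF xS] by simp
    then show "(?G has_derivative (\<lambda>h. 0)) (at x within P \<times> J)" by (rule has_derivative_at_withinI)
  qed
  then show ?thesis by simp
qed

end

text \<open>On a box with convex slices \<open>R\<close> is a function of u alone, so it can be
  integrated along the segment through \<open>z0\<close> and \<open>v0\<close>.\<close>

lemma antiderivative_u:
  fixes R :: "pt \<Rightarrow> complex"
  assumes S: "S = P \<times> {c<..<d} \<times> J" "open P" "open J" "convex P" "convex J"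
    and R: "smooth_on S R" and pd0: "\<And>p. p \<in> S \<Longrightarrow> pd 1 R p = 0 \<and> pd 2 R p = 0 \<and> pd 4 R p = 0"
    and real: "\<And>p. p \<in> S \<Longrightarrow> cnj (R p) = R p" and p0: "(z0, u0, v0) \<in> S"
  shows "\<exists>T G. open T \<and> (z0, u0, v0) \<in> T \<and> T \<subseteq> S \<and> smooth_on T G \<and>
    (\<forall>p\<in>T. cnj (G p) = G p \<and> pd 1 G p = 0 \<and> pd 2 G p = 0 \<and> pd 3 G p = R p \<and> pd 4 G p = 0)"
proof -
  have oS: "open S" using S by (simp add: open_Times)
  interpret smooth_domain S by unfold_locales (rule oS)
  \<comment> \<open>The integral is taken over a compact interval inside the box; the midpoints
    between \<open>u0\<close> and the ends keep \<open>u0\<close> in its interior.\<close>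
  define c' d' where "c' = (c + u0) / 2" and "d' = (u0 + d) / 2"
  have cd: "c < c'" "c' < u0" "u0 < d'" "d' < d" using p0 S by (auto simp: c'_def d'_def)
  have "continuous_on {c'..d'} (\<lambda>t. Re (R (z0, t, v0)))"
  proof (rule continuous_on_Re, rule continuous_on_compose2[OF smooth_on_imp_continuous_on[OF R]])
    show "continuous_on {c'..d'} (\<lambda>t. (z0, t, v0))" by (intro continuous_intros)
    show "(\<lambda>t. (z0, t, v0)) ` {c'..d'} \<subseteq> S" using cd p0 S by auto
  qed
  from antiderivative_continuous[OF this] obtain G
    where G: "\<And>t. t \<in> {c'..d'} \<Longrightarrow> (G has_vector_derivative Re (R (z0, t, v0))) (at t within {c'..d'})"
    by blast
  define T where "T = P \<times> {c'<..<d'} \<times> J"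
  have T: "open T" "(z0, u0, v0) \<in> T" "T \<subseteq> S"
    using S p0 cd by (auto simp: T_def open_Times)
  have D: "((\<lambda>p. of_real (G (fst (snd p)))) has_derivative (\<lambda>h. of_real (fst (snd h)) * R p)) (at p)"
    if p: "p \<in> T" for p
  proof -
    obtain z u v where zuv: "p = (z, u, v)" by (cases p) auto
    then have u: "u \<in> {c'<..<d'}" using p by (auto simp: T_def)
    have Ru: "R (z0, u, v0) = R p"
      unfolding zuv by (rule slice_constant[OF R S(1,4,5) pd0]) (use p u cd p0 T S zuv in \<open>auto simp: T_def\<close>)
    have Rr: "complex_of_real (Re (R p)) = R p"
      using real[of p] p T by (auto simp: complex_eq_iff)
    have "(G has_vector_derivative Re (R p)) (at u)"
      using G[of u] u at_within_Icc_at[of c' u d'] by (auto simp: Ru)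
    then have "((\<lambda>t. complex_of_real (G t)) has_derivative (\<lambda>h. complex_of_real (h *\<^sub>R Re (R p)))) (at u)"
      unfolding has_vector_derivative_def by (rule bounded_linear.has_derivative[OF bounded_linear_of_real])
    then have "((\<lambda>t. complex_of_real (G t)) has_derivative (\<lambda>h. of_real h * R p)) (at u)"
      by (simp add: Rr)
    then have G': "((\<lambda>t. complex_of_real (G t)) has_derivative (\<lambda>h. of_real h * R p)) (at (fst (snd p)))"
      by (simp add: zuv)
    have "((\<lambda>p :: pt. fst (snd p)) has_derivative (\<lambda>h. fst (snd h))) (at p)"
      by (auto intro!: derivative_eq_intros)
    from has_derivative_compose[OF this G'] show ?thesis .
  qed
  have "smooth_on T (\<lambda>p. complex_of_real (G (fst (snd p))))"
    by (rule smooth_onI[OF T(1) D]) (use T R smooth_on_subset in \<open>auto intro!: smooth_on_mult smooth_on_const\<close>)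
  moreover have "pd 1 (\<lambda>p. complex_of_real (G (fst (snd p)))) p = 0 \<and> pd 2 (\<lambda>p. complex_of_real (G (fst (snd p)))) p = 0
      \<and> pd 3 (\<lambda>p. complex_of_real (G (fst (snd p)))) p = R p \<and> pd 4 (\<lambda>p. complex_of_real (G (fst (snd p)))) p = 0"
    if "p \<in> T" for p
    unfolding pd_def Let_def frechet_derivative_eqI[OF D[OF that]] by simp
  ultimately show ?thesis
    using T by (intro exI[of _ T] exI[of _ "\<lambda>p. complex_of_real (G (fst (snd p)))"]) auto
qed

definition zc :: "pt \<Rightarrow> complex" where "zc p = fst p"
definition vc :: "pt \<Rightarrow> complex" where "vc p = of_real (snd (snd p))"

lemma has_derivative_zc: "(zc has_derivative (\<lambda>h. fst h)) (at p)"
  and has_derivative_vc: "(vc has_derivative (\<lambda>h. of_real (snd (snd h)))) (at p)"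
  unfolding zc_def[abs_def] vc_def[abs_def] by (auto intro!: derivative_eq_intros)

lemma pd_zc: "pd 1 zc p = 1" "pd 2 zc p = 0" "pd 3 zc p = 0" "pd 4 zc p = 0"
  and pd_vc: "pd 1 vc p = 0" "pd 2 vc p = 0" "pd 3 vc p = 0" "pd 4 vc p = 1"
  unfolding pd_def Let_def frechet_derivative_eqI[OF has_derivative_zc]
    frechet_derivative_eqI[OF has_derivative_vc] by simp_all

lemma smooth_zc: "open S \<Longrightarrow> smooth_on S zc" and smooth_vc: "open S \<Longrightarrow> smooth_on S vc"
  by (rule smooth_onI[OF _ has_derivative_zc] smooth_onI[OF _ has_derivative_vc]; auto)+

context pp_wave
begin

abbreviation lie_g :: "field4 \<Rightarrow> 4 \<Rightarrow> 4 \<Rightarrow> pt \<Rightarrow> complex" where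
  "lie_g X i j p \<equiv> (\<Sum>l\<in>UNIV. X l p * pd l (\<lambda>q. g q $ i $ j) p
     + g p $ l $ j * pd i (X l) p + g p $ i $ l * pd j (X l) p)"

definition "H p = F p + cnj (F p)"
text \<open>The derivative of \<open>H\<close> along X, with the holomorphy of f in \<zeta> and its
  independence of v already inserted.\<close>

definition "dH X p = X 1 p * pd 1 F p + X (2::4) p * cnj (pd 1 F p) + X 3 p * (pd 3 F p + cnj (pd 3 F p))"

lemma killing_eqs:
  assumes p: "p \<in> C"
  shows "(\<forall>i j. lie_g X i j p = 0) \<longleftrightarrow>
    pd 1 (X 2) p = 0 \<and> pd 2 (X 1) p = 0 \<and> pd 1 (X 1) p + pd 2 (X 2) p = 0 \<and>
    pd 1 (X 4) p = pd 3 (X 2) p - 2 * H p * pd 1 (X 3) p \<and>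
    pd 2 (X 4) p = pd 3 (X 1) p - 2 * H p * pd 2 (X 3) p \<and>
    pd 4 (X 2) p = pd 1 (X 3) p \<and> pd 4 (X 1) p = pd 2 (X 3) p \<and> pd 4 (X 3) p = 0 \<and>
    pd 4 (X 4) p = - pd 3 (X 3) p \<and> pd 3 (X 4) p = - dH X p - 2 * H p * pd 3 (X 3) p"
proof -
  have d: "pd i (\<lambda>q. - (2 * F q) - 2 * cnj (F q)) p = - (2 * pd i F p) - 2 * pd i (\<lambda>q. cnj (F q)) p" for i
    using p by (simp add: C.pd_diff C.pd_minus C.pd_mult C.pd_const sm)
  note simps = sum_4 metric_comp d C.pd_cnj[OF smooth_F p] pd2_F[OF p] pd4_F[OF p]
  have E: "lie_g X 1 1 p = 2 * pd 1 (X 2) p" "lie_g X 2 2 p = 2 * pd 2 (X 1) p"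
    "lie_g X 1 2 p = pd 1 (X 1) p + pd 2 (X 2) p" "lie_g X 2 1 p = pd 1 (X 1) p + pd 2 (X 2) p"
    "lie_g X 1 3 p = - 2 * H p * pd 1 (X 3) p - pd 1 (X 4) p + pd 3 (X 2) p"
    "lie_g X 3 1 p = - 2 * H p * pd 1 (X 3) p - pd 1 (X 4) p + pd 3 (X 2) p"
    "lie_g X 2 3 p = - 2 * H p * pd 2 (X 3) p - pd 2 (X 4) p + pd 3 (X 1) p"
    "lie_g X 3 2 p = - 2 * H p * pd 2 (X 3) p - pd 2 (X 4) p + pd 3 (X 1) p"
    "lie_g X 1 4 p = pd 4 (X 2) p - pd 1 (X 3) p" "lie_g X 4 1 p = pd 4 (X 2) p - pd 1 (X 3) p"
    "lie_g X 2 4 p = pd 4 (X 1) p - pd 2 (X 3) p" "lie_g X 4 2 p = pd 4 (X 1) p - pd 2 (X 3) p"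
    "lie_g X 3 3 p = - 2 * dH X p - 4 * H p * pd 3 (X 3) p - 2 * pd 3 (X 4) p"
    "lie_g X 3 4 p = - pd 3 (X 3) p - pd 4 (X 4) p - 2 * H p * pd 4 (X 3) p"
    "lie_g X 4 3 p = - pd 3 (X 3) p - pd 4 (X 4) p - 2 * H p * pd 4 (X 3) p"
    "lie_g X 4 4 p = - 2 * pd 4 (X 3) p"
    by (simp_all add: simps H_def dH_def) (simp_all add: algebra_simps)
  have e0: "2 * pd 1 (X 2) p = 0 \<longleftrightarrow> pd 1 (X 2) p = 0" "2 * pd 2 (X 1) p = 0 \<longleftrightarrow> pd 2 (X 1) p = 0"
    "- 2 * pd 4 (X 3) p = 0 \<longleftrightarrow> pd 4 (X 3) p = 0"
    "pd 4 (X 2) p - pd 1 (X 3) p = 0 \<longleftrightarrow> pd 4 (X 2) p = pd 1 (X 3) p"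
    "pd 4 (X 1) p - pd 2 (X 3) p = 0 \<longleftrightarrow> pd 4 (X 1) p = pd 2 (X 3) p"
    by simp_all
  have e33: "- 2 * dH X p - 4 * H p * pd 3 (X 3) p - 2 * pd 3 (X 4) p = 0
    \<longleftrightarrow> pd 3 (X 4) p = - dH X p - 2 * H p * pd 3 (X 3) p" by algebra
  have e13: "- 2 * H p * pd 1 (X 3) p - pd 1 (X 4) p + pd 3 (X 2) p = 0
    \<longleftrightarrow> pd 1 (X 4) p = pd 3 (X 2) p - 2 * H p * pd 1 (X 3) p" by algebra
  have e23: "- 2 * H p * pd 2 (X 3) p - pd 2 (X 4) p + pd 3 (X 1) p = 0
    \<longleftrightarrow> pd 2 (X 4) p = pd 3 (X 1) p - 2 * H p * pd 2 (X 3) p" by algebra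
  have e34: "- pd 3 (X 3) p - pd 4 (X 4) p - 2 * H p * pd 4 (X 3) p = 0
    \<longleftrightarrow> pd 4 (X 4) p = - pd 3 (X 3) p" if "pd 4 (X 3) p = 0" using that by algebra
  show ?thesis
    unfolding forall_4 E e33 e13 e23 e0 using e34 by blast
qed

text \<open>The Killing equations prescribe all first derivatives of \<open>X 4\<close>, so each
  pair of mixed derivatives gives a condition on the other components. Two of these conditions,
  differentiated once more in \<zeta>, acquire the factor f_\<zeta>\<zeta>; cancelling it forces
  \<open>X 3\<close> to depend on u only and x = X a to be constant.\<close>

lemma killing_structure:
  assumes NU: "open N" "N \<subseteq> U" and K: "killing_on g N X" and p: "p \<in> N"
  defines "x \<equiv> \<lambda>p. (X 1 p - X 3 p * q p) / r p"
  shows "smooth_on N x" "pd i x p = 0"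
    "pd 1 (X 3) p = 0" "pd 2 (X 3) p = 0" "pd 4 (X 3) p = 0" "pd 3 (X 3) p = - (x p + cnj (x p))"
    "x p * pd 1 r p + X 3 p * pd 1 q p = cnj (x p) - x p"
    "pd 1 (X 4) p = pd 3 (X 2) p" "pd 2 (X 4) p = pd 3 (X 1) p" "pd 4 (X 4) p = x p + cnj (x p)"
    "pd 3 (X 4) p = - dH X p + 2 * H p * (x p + cnj (x p))"
proof -
  interpret N: smooth_domain N by unfold_locales (rule NU(1))
  have NC: "p \<in> N \<Longrightarrow> p \<in> C" for p using NU inC by blast
  have smN: "smooth_on C G \<Longrightarrow> smooth_on N G" for G
    using smooth_on_subset[OF NU(1)] NC by (metis subsetI)
  have sX: "smooth_on N (X i)" for i using K by (simp add: killing_on_def)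
  note s = sX N.smooth sm_C[THEN smN]
  have re: "X 2 p = cnj (X 1 p)" "cnj (X 3 p) = X 3 p" if "p \<in> N" for p
    using K that by (auto simp: killing_on_def real_field_on_def Reals_cnj_iff)
  have eqs: "pd 1 (X 2) p = 0" "pd 2 (X 1) p = 0" "pd 1 (X 1) p = - pd 2 (X 2) p"
    "pd 1 (X 4) p = pd 3 (X 2) p - 2 * H p * pd 1 (X 3) p"
    "pd 2 (X 4) p = pd 3 (X 1) p - 2 * H p * pd 2 (X 3) p"
    "pd 4 (X 2) p = pd 1 (X 3) p" "pd 4 (X 1) p = pd 2 (X 3) p" "pd 4 (X 3) p = 0"
    "pd 4 (X 4) p = - pd 3 (X 3) p" "pd 3 (X 4) p = - dH X p - 2 * H p * pd 3 (X 3) p" if "p \<in> N" for p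
    using K that killing_eqs[OF NC[OF that], of X] by (auto simp: killing_on_def eq_neg_iff_add_eq_0)
  have com: "pd i (pd j (X k)) p = pd j (pd i (X k)) p" if "p \<in> N" for i j k p
    using N.pd_commute[OF sX that] .
  have zero: "pd j (pd i (X k)) p = 0" if "\<And>p. p \<in> N \<Longrightarrow> pd j (X k) p = 0" "p \<in> N" for i j k p
  proof -
    have "pd i (pd j (X k)) p = pd i (\<lambda>_. 0) p" by (rule N.pd_eq[OF that(2,1)])
    then show ?thesis using com[OF that(2), of i j k] by simp
  qed
  have H_pd: "pd 4 H p = 0" "pd 1 H p = pd 1 F p" if "p \<in> C" for p
    unfolding H_def[abs_def] using that
    by (simp_all add: C.pd_simps sm pd4_F pd2_F)
  have sH: "smooth_on N H" unfolding H_def[abs_def] by (simp add: s)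
  have cF: "pd 1 (\<lambda>p. cnj (pd k F p)) p = 0" "pd 4 (\<lambda>p. cnj (pd k F p)) p = 0" if "p \<in> C" for p k
    using that C.pd_cnj[OF C.smooth_pd[OF smooth_F, of k] that] pd_F2[OF that] by simp_all
  have sdH: "smooth_on N (dH X)" unfolding dH_def[abs_def] by (simp add: s)
  have Y11: "pd 1 (pd 1 (X 3)) p = 0" if p: "p \<in> N" for p
  proof -
    have "pd 1 (pd 1 (X 3)) p = pd 1 (pd 4 (X 2)) p" by (rule N.pd_eq[OF p]) (simp add: eqs)
    then show ?thesis using zero[OF eqs(1) p] com[OF p] by simp
  qed
  \<comment> \<open>The chain of mixed derivatives returns this quantity with the opposite
    sign.\<close>
  have Y12: "pd 1 (pd 2 (X 3)) p = 0" if p: "p \<in> N" for p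
  proof -
    have "pd 1 (pd 2 (X 3)) p = pd 1 (pd 4 (X 1)) p" by (rule N.pd_eq[OF p]) (simp add: eqs)
    also have "\<dots> = pd 4 (pd 1 (X 1)) p" by (rule com[OF p])
    also have "\<dots> = pd 4 (\<lambda>p. - pd 2 (X 2) p) p" by (rule N.pd_eq[OF p eqs(3)])
    also have "\<dots> = - pd 2 (pd 4 (X 2)) p" using p com[OF p, of 4 2 2] by (simp add: N.pd_simps s)
    also have "pd 2 (pd 4 (X 2)) p = pd 2 (pd 1 (X 3)) p" by (rule N.pd_eq[OF p eqs(6)])
    also have "\<dots> = pd 1 (pd 2 (X 3)) p" by (rule com[OF p])
    finally show ?thesis by simp
  qed
  \<comment> \<open>The two orders of differentiating \<open>X 4\<close> in \<zeta> and v give this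
    quantity with opposite signs.\<close>
  have Y31: "pd 3 (pd 1 (X 3)) p = 0" if p: "p \<in> N" for p
  proof -
    have "pd 4 (pd 1 (X 4)) p = pd 4 (\<lambda>p. pd 3 (X 2) p - 2 * H p * pd 1 (X 3) p) p"
      by (rule N.pd_eq[OF p eqs(4)])
    also have "\<dots> = pd 4 (pd 3 (X 2)) p"
      using p zero[OF eqs(8) p, of 1] H_pd[OF NC[OF p]] by (simp add: N.pd_simps s sH)
    also have "\<dots> = pd 3 (pd 4 (X 2)) p" by (rule com[OF p])
    also have "\<dots> = pd 3 (pd 1 (X 3)) p" by (rule N.pd_eq[OF p eqs(6)])
    finally have 1: "pd 4 (pd 1 (X 4)) p = pd 3 (pd 1 (X 3)) p" .
    have "pd 1 (pd 4 (X 4)) p = pd 1 (\<lambda>p. - pd 3 (X 3) p) p" by (rule N.pd_eq[OF p eqs(9)])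
    also have "\<dots> = - pd 3 (pd 1 (X 3)) p" using p com[OF p, of 1 3 3] by (simp add: N.pd_simps s)
    finally show ?thesis using 1 com[OF p, of 1 4 4] by simp
  qed
  have Y33: "pd 3 (pd 3 (X 3)) p = pd 2 (X 3) p * pd 1 F p + pd 1 (X 3) p * cnj (pd 1 F p)" if p: "p \<in> N" for p
  proof -
    have d4: "pd 4 (dH X) p = pd 4 (X 1) p * pd 1 F p + pd 4 (X 2) p * cnj (pd 1 F p)"
      unfolding dH_def[abs_def] using p NC[OF p]
      by (simp add: N.pd_add N.pd_mult s eqs cF pd_F2)
    have "pd 4 (pd 3 (X 4)) p = pd 4 (\<lambda>p. - dH X p - 2 * H p * pd 3 (X 3) p) p"
      by (rule N.pd_eq[OF p eqs(10)])
    moreover have "\<dots> = - pd 4 (dH X) p"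
      using p zero[OF eqs(8) p, of 3] H_pd[OF NC[OF p]] by (simp add: N.pd_simps s sH sdH)
    moreover have "pd 3 (pd 4 (X 4)) p = pd 3 (\<lambda>p. - pd 3 (X 3) p) p" by (rule N.pd_eq[OF p eqs(9)])
    moreover have "\<dots> = - pd 3 (pd 3 (X 3)) p" using p by (simp add: N.pd_simps s)
    ultimately have "pd 3 (pd 3 (X 3)) p = pd 4 (dH X) p" using com[OF p, of 3 4 4] by simp
    then show ?thesis using d4 eqs(6,7)[OF p] by simp
  qed
  \<comment> \<open>In the \<zeta>-derivative of \<open>Y33\<close> every term vanishes except the
    one in which f_\<zeta> is differentiated, and f_\<zeta>\<zeta> has no zero.\<close>
  have Y2: "pd 2 (X 3) p = 0" if p: "p \<in> N" for p
  proof -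
    have "pd 1 (pd 3 (pd 3 (X 3))) p = pd 3 (pd 1 (pd 3 (X 3))) p"
      by (rule N.pd_commute[OF _ p]) (simp add: s)
    also have "\<dots> = pd 3 (\<lambda>_. 0) p"
      by (rule N.pd_eq[OF p]) (use Y31 com in simp)
    finally have "pd 1 (pd 3 (pd 3 (X 3))) p = 0" by simp
    moreover have "pd 1 (pd 3 (pd 3 (X 3))) p = pd 1 (\<lambda>p. pd 2 (X 3) p * pd 1 F p + pd 1 (X 3) p * cnj (pd 1 F p)) p"
      by (rule N.pd_eq[OF p Y33])
    moreover have "\<dots> = pd 2 (X 3) p * Hf p"
      using p NC[OF p] by (simp add: N.pd_add N.pd_mult s cF Y11 Y12 Hf_def)
    ultimately show ?thesis using Hf_eq(1)[OF NC[OF p]] by auto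
  qed
  have Y1: "pd 1 (X 3) p = 0" if p: "p \<in> N" for p
  proof -
    have "pd 1 (X 3) p = pd 1 (\<lambda>p. cnj (X 3 p)) p" by (rule N.pd_eq[OF p]) (simp add: re)
    also have "\<dots> = cnj (pd 2 (X 3) p)" using N.pd_cnj[OF sX p] by simp
    finally show ?thesis using Y2[OF p] by simp
  qed
  have X4: "pd 1 (X 4) p = pd 3 (X 2) p" "pd 2 (X 4) p = pd 3 (X 1) p" if p: "p \<in> N" for p
    using eqs[OF p] Y1[OF p] Y2[OF p] by simp_all
  have W11: "pd 1 (pd 1 (X 1)) p = 0" if p: "p \<in> N" for p
  proof -
    have "pd 1 (pd 1 (X 1)) p = pd 1 (\<lambda>p. - pd 2 (X 2) p) p" by (rule N.pd_eq[OF p eqs(3)])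
    then show ?thesis using p zero[OF eqs(1) p, of 2] by (simp add: N.pd_simps s)
  qed
  have W31: "pd 3 (pd 1 (X 1)) p = 0" if p: "p \<in> N" for p
  proof -
    have "pd 2 (pd 1 (X 4)) p = pd 2 (pd 3 (X 2)) p" by (rule N.pd_eq[OF p X4(1)])
    moreover have "pd 1 (pd 2 (X 4)) p = pd 1 (pd 3 (X 1)) p" by (rule N.pd_eq[OF p X4(2)])
    ultimately have 1: "pd 3 (pd 2 (X 2)) p = pd 3 (pd 1 (X 1)) p"
      using com[OF p, of 2 1 4] com[OF p, of 2 3 2] com[OF p, of 1 3 1] by simp
    have "pd 3 (pd 1 (X 1)) p = pd 3 (\<lambda>p. - pd 2 (X 2) p) p" by (rule N.pd_eq[OF p eqs(3)])
    also have "\<dots> = - pd 3 (pd 2 (X 2)) p" using p by (simp add: N.pd_simps s)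
    finally show ?thesis using 1 by simp
  qed
  have W4: "pd 4 (X 1) p = 0" if p: "p \<in> N" for p using eqs(7)[OF p] Y2[OF p] by simp
  have W1i: "pd i (pd 1 (X 1)) p = 0" if p: "p \<in> N" for i p
    using W11[OF p] W31[OF p] zero[OF eqs(2) p, of 1] zero[OF W4 p, of 1]
    by (cases i rule: index4_cases) simp_all
  have Y3i: "pd i (pd 3 (X 3)) p = 0" if p: "p \<in> N" for i p
    using zero[OF Y1 p, of 3] zero[OF Y2 p, of 3] Y33[OF p] Y1[OF p] Y2[OF p] zero[OF eqs(8) p, of 3]
    by (cases i rule: index4_cases) simp_all
  have W33: "pd 3 (pd 3 (X 2)) p = - (pd 1 (X 1) p * pd 1 F p + X 1 p * Hf p + X 3 p * pd 3 (pd 1 F) p)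
      - 2 * pd 1 F p * pd 3 (X 3) p" if p: "p \<in> N" for p
  proof -
    have "pd 1 (dH X) p = pd 1 (X 1) p * pd 1 F p + X 1 p * Hf p + X 3 p * pd 3 (pd 1 F) p"
      unfolding dH_def[abs_def] using p NC[OF p]
      by (simp add: N.pd_add N.pd_mult s eqs cF pd_F2 Y1 Hf_def)
    moreover have "pd 1 (pd 3 (X 4)) p = pd 1 (\<lambda>p. - dH X p - 2 * H p * pd 3 (X 3) p) p"
      by (rule N.pd_eq[OF p eqs(10)])
    moreover have "\<dots> = - pd 1 (dH X) p - 2 * pd 1 F p * pd 3 (X 3) p"
      using p H_pd[OF NC[OF p]] Y3i[OF p] by (simp add: N.pd_simps s sH sdH)
    moreover have "pd 3 (pd 1 (X 4)) p = pd 3 (pd 3 (X 2)) p" by (rule N.pd_eq[OF p X4(1)])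
    ultimately show ?thesis using com[OF p, of 1 3 4] by simp
  qed
  \<comment> \<open>The \<zeta>-derivative of \<open>W33\<close>. As f_\<zeta>\<zeta> = exp (4 a),
    its derivative along X is 4 f_\<zeta>\<zeta> x; cancelling f_\<zeta>\<zeta> expresses x by two
    quantities with zero derivative (\<open>W1i\<close>, \<open>Y3i\<close>).\<close>
  have x: "x p = - (pd 1 (X 1) p + pd 3 (X 3) p) / 2" if p: "p \<in> N" for p
  proof -
    have "pd 1 (pd 3 (pd 3 (X 2))) p = pd 3 (pd 1 (pd 3 (X 2))) p"
      by (rule N.pd_commute[OF _ p]) (simp add: s)
    also have "\<dots> = pd 3 (\<lambda>_. 0) p" by (rule N.pd_eq[OF p]) (use zero[OF eqs(1)] in simp)
    finally have 1: "pd 1 (pd 3 (pd 3 (X 2))) p = 0" by simp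
    have c: "pd 1 (pd 3 (pd 1 F)) p = pd 3 Hf p"
      using C.pd_commute[OF C.smooth_pd[OF smooth_F, of 1] NC[OF p], of 1 3] by (simp add: Hf_def)
    have sHf: "smooth_on N Hf" using smN[OF smooth_Hf] .
    have c1: "pd 1 (pd 1 F) p = Hf p" by (simp add: Hf_def)
    have Hf1: "pd 1 Hf p = 4 * Hf p / r p" and Hf3: "pd 3 Hf p = - (4 * Hf p * q p / r p)"
      using pd_exp4(1)[OF smooth_A Hf_exp(1) NC[OF p]] pd_A[OF NC[OF p]] by simp_all
    have "pd 1 (pd 3 (pd 3 (X 2))) p = pd 1 (\<lambda>p. - (pd 1 (X 1) p * pd 1 F p + X 1 p * Hf p + X 3 p * pd 3 (pd 1 F) p)
      - 2 * pd 1 F p * pd 3 (X 3) p) p" by (rule N.pd_eq[OF p W33])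
    also have "\<dots> = - (2 * pd 1 (X 1) p * Hf p + X 1 p * pd 1 Hf p + X 3 p * pd 3 Hf p) - 2 * Hf p * pd 3 (X 3) p"
      using p by (simp add: N.pd_simps s sHf W1i Y3i Y1 c c1 algebra_simps)
    also have "\<dots> = - 2 * Hf p * (pd 1 (X 1) p + pd 3 (X 3) p + 2 * x p)"
      unfolding Hf1 Hf3 using r_neq[OF NC[OF p]] by (simp add: x_def field_simps)
    finally have "pd 1 (X 1) p + pd 3 (X 3) p + 2 * x p = 0"
      using 1 Hf_eq(1)[OF NC[OF p]] by simp
    then have 2: "2 * x p = - (pd 1 (X 1) p + pd 3 (X 3) p)" by algebra
    have "x p = 2 * x p / 2" by simp
    then show ?thesis unfolding 2 .
  qed
  show sx: "smooth_on N x" unfolding x_def by (simp add: s r_neq NC)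
  have xi: "pd i x p = 0" for i
  proof -
    have "pd i x p = pd i (\<lambda>p. (- 1 / 2) * (pd 1 (X 1) p + pd 3 (X 3) p)) p"
      by (rule N.pd_eq[OF p]) (subst x; simp add: add_divide_distrib)
    then show ?thesis using p by (simp add: N.pd_simps s W1i Y3i)
  qed
  show "pd i x p = 0" by (rule xi)
  have W1c: "cnj (pd 1 (X 1) p) = - pd 1 (X 1) p"
  proof -
    have "pd 2 (X 2) p = pd 2 (\<lambda>p. cnj (X 1 p)) p" by (rule N.pd_eq[OF p]) (simp add: re)
    then show ?thesis using N.pd_cnj[OF sX p, of 1] eqs(3)[OF p] by simp
  qed
  have Y3c: "cnj (pd 3 (X 3) p) = pd 3 (X 3) p"
  proof -
    have "pd 3 (X 3) p = pd 3 (\<lambda>p. cnj (X 3 p)) p" by (rule N.pd_eq[OF p]) (simp add: re)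
    then show ?thesis using N.pd_cnj[OF sX p, of 3] by simp
  qed
  \<comment> \<open>Here \<open>pd 1 (X 1)\<close> is imaginary and \<open>pd 3 (X 3)\<close> is
    real, so this equation and its conjugate separate Im x from Re x.\<close>
  have x2: "2 * x p = - (pd 1 (X 1) p + pd 3 (X 3) p)" by (simp add: x[OF p])
  have x2c: "2 * cnj (x p) = pd 1 (X 1) p - pd 3 (X 3) p"
    using arg_cong[OF x2, of cnj] W1c Y3c by simp
  show Y3: "pd 3 (X 3) p = - (x p + cnj (x p))"
    using x2 x2c by algebra
  have "pd 1 (X 1) p = pd 1 (\<lambda>p. x p * r p + X 3 p * q p) p"
    by (rule N.pd_eq[OF p]) (simp add: x_def r_neq NC)
  also have "\<dots> = x p * pd 1 r p + X 3 p * pd 1 q p"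
    using p sx xi[of 1] Y1 by (simp add: N.pd_simps s)
  finally show "x p * pd 1 r p + X 3 p * pd 1 q p = cnj (x p) - x p"
    using x2 x2c by algebra
  show "pd 1 (X 3) p = 0" "pd 2 (X 3) p = 0" "pd 4 (X 3) p = 0"
    "pd 1 (X 4) p = pd 3 (X 2) p" "pd 2 (X 4) p = pd 3 (X 1) p"
    using Y1 Y2 eqs(8) X4 p by auto
  show "pd 4 (X 4) p = x p + cnj (x p)" "pd 3 (X 4) p = - dH X p + 2 * H p * (x p + cnj (x p))"
    using eqs(9,10)[OF p] Y3 by (simp_all add: algebra_simps)
qed


lemma along_mult:
  "p \<in> C \<Longrightarrow> smooth_on C G \<Longrightarrow> smooth_on C K \<Longrightarrow>
    along x x' \<rho> (\<lambda>p. G p * K p) p = along x x' \<rho> G p * K p + G p * along x x' \<rho> K p"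
  unfolding along_def by (simp add: C.pd_mult algebra_simps)

lemma along_exp:
  assumes p: "p \<in> C"
  shows "along x x' \<rho> h p = (x + x') * h p" "along x x' \<rho> (\<lambda>p. cnj (e p)) p = (x' - x) * cnj (e p)"
proof -
  have n: "r p \<noteq> 0" "cnj (r p) \<noteq> 0" using r_neq[OF p] by auto
  show "along x x' \<rho> h p = (x + x') * h p"
    using n by (simp add: along_def pd_h[OF p] field_simps)
  show "along x x' \<rho> (\<lambda>p. cnj (e p)) p = (x' - x) * cnj (e p)"
    unfolding along_def C.pd_cnj[OF smooth_e p] pd_e[OF p] using n by (simp add: field_simps)
qed

text \<open>
  The invariance of \<open>\<nu>\<close> is the integrability condition for the \<open>\<partial>\<^sub>v\<close> component of a Killing field.
\<close>

lemma along_nu_numerator: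
  assumes p: "p \<in> C" and nu: "along x x' \<rho> nuf p = 0"
  defines "N \<equiv> \<lambda>p. pd 3 q p + q p * pd 1 q p + cnj (pd 1 F p)"
  shows "along x x' \<rho> N p = (x + 3 * x') * N p"
proof -
  have N: "N p = nuf p * (h p * (h p * cnj (e p)))" if "p \<in> C" for p
    using that by (simp add: N_def nu_h cnj_e power2_eq_square)
  have "along x x' \<rho> N p = along x x' \<rho> (\<lambda>p. nuf p * (h p * (h p * cnj (e p)))) p"
    unfolding along_def using C.pd_eq[OF p N] by simp
  \<comment> \<open>The weights add up: twice \<open>x + x'\<close> from the square of
    \<open>h\<close>, and \<open>x' - x\<close> from the conjugate of \<open>e\<close>.\<close>
  also have "\<dots> = (x + 3 * x') * N p"
    using p nu by (simp add: along_mult along_exp sm_inv N) (simp add: algebra_simps)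
  finally show ?thesis .
qed

text \<open>The first three components are read off from \<open>x\<close> and \<open>\<rho>\<close>.
  For \<open>X 4\<close> a function with prescribed first derivatives has to be found; it is an
  explicit potential plus an integral in u, which is formed on a box around the point.\<close>

lemma killing_exists:
  assumes sy: "symmetry x \<rho>" and nu: "\<And>p. p \<in> U \<Longrightarrow> grad nuf p \<in> W p" and p0: "p0 \<in> U"
  shows "\<exists>N X. open N \<and> p0 \<in> N \<and> N \<subseteq> U \<and> killing_on g N X \<and>
    (\<forall>p\<in>N. X 3 p = of_real (\<rho> - 2 * Re x * fst (snd p)) \<and> X 1 p = x * r p + X 3 p * q p)"
proof -
  define Y where "Y = (\<lambda>p. of_real \<rho> - 2 * of_real (Re x) * uc p)"
  define w where "w = (\<lambda>p. x * r p + Y p * q p)"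
  have xx: "2 * complex_of_real (Re x) = x + cnj x" by (simp add: complex_add_cnj)
  have Yu: "Y p = of_real (\<rho> - 2 * Re x * fst (snd p))" for p by (simp add: Y_def uc_def)
  have Yr: "cnj (Y p) = Y p" for p by (simp add: Yu)
  have sY: "smooth_on U Y" unfolding Y_def using smooth_uc[OF open_U] by (simp add: sm_U)
  have Y0: "pd 1 Y p = 0" "pd 2 Y p = 0" "pd 4 Y p = 0" "pd 3 Y p = - (x + cnj x)" if "p \<in> U" for p
    unfolding Y_def using that smooth_uc[OF open_U]
    by (simp_all add: U.pd_simps sm_U pd_uc complex_add_cnj)
  have sw: "smooth_on U w" unfolding w_def using sY by (simp add: sm_U)
  have eqn: "x * pd 1 r p + Y p * pd 1 q p = cnj x - x" if "p \<in> U" for p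
    using sy that by (auto simp: symmetry_def symmetry_at_def Yu)
  have dw: "pd i w p = x * pd i r p + pd i Y p * q p + Y p * pd i q p" if "p \<in> U" for i p
    unfolding w_def using that sY by (simp add: U.pd_simps sm_U)
  have w1: "pd 1 w p = cnj x - x" and w2: "pd 2 w p = 0" and w4: "pd 4 w p = 0" if p: "p \<in> U" for p
    using dw[OF p] eqn[OF p] Y0[OF p] pd_r[OF inC[OF p]] pd_q[OF inC[OF p]] by simp_all
  have w3: "pd 3 w p = w p * pd 1 q p + Y p * pd 3 q p - 2 * cnj x * q p" if p: "p \<in> U" for p
  proof -
    have mix: "pd 3 r p = r p * pd 1 q p - q p * pd 1 r p" using Z_mixed[OF inC[OF p]] by simp
    have "w p = x * r p + Y p * q p" by (simp add: w_def)
    then show ?thesis using dw[OF p, of 3] mix Y0(4)[OF p] eqn[OF p] by algebra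
  qed
  have wc: "pd i (pd j w) p = pd j (pd i w) p" if "p \<in> U" for i j p using U.pd_commute[OF sw that] .
  \<comment> \<open>The compatibility of the derivatives prescribed for \<open>X 4\<close> in cnj
    \<zeta> and in u. The vanishing derivative of \<nu> along V supplies the second u-derivative of
    \<open>q\<close>.\<close>
  have w33: "pd 3 (pd 3 w) p = (x + 3 * cnj x) * cnj (pd 1 F p)
      - (cnj (w p) * cnj (pd 1 (pd 1 F) p) + Y p * cnj (pd 3 (pd 1 F) p))" if p: "p \<in> U" for p
  proof -
    note pC = inC[OF p]
    have z: "along x (cnj x) (Y p) al p = 0" "along x (cnj x) (Y p) cal p = 0"
      using symmetry_along(1,2)[OF sy p] by (simp_all add: Yu)
    have nu0: "along x (cnj x) (Y p) nuf p = 0" by (rule along_grad_span[OF nu[OF p] z])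
    have "pd 3 (pd 3 w) p = pd 3 (\<lambda>p. w p * pd 1 q p + Y p * pd 3 q p - 2 * cnj x * q p) p"
      by (rule U.pd_eq[OF p w3])
    also have "\<dots> = pd 3 w p * pd 1 q p + w p * pd 3 (pd 1 q) p + pd 3 Y p * pd 3 q p + Y p * pd 3 (pd 3 q) p
        - 2 * cnj x * pd 3 q p"
      using p sw sY by (simp add: U.pd_simps sm_U)
    finally have 1: "pd 3 (pd 3 w) p = (w p * pd 1 q p + Y p * pd 3 q p - 2 * cnj x * q p) * pd 1 q p
        + w p * pd 3 (pd 1 q) p - (x + cnj x) * pd 3 q p + Y p * pd 3 (pd 3 q) p - 2 * cnj x * pd 3 q p"
      unfolding w3[OF p] Y0(4)[OF p] by algebra
    have mix: "r p * pd 1 (pd 1 q) p = pd 3 (pd 1 r) p + q p * pd 1 (pd 1 r) p" by (rule Z_mixed_deriv[OF pC])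
    have sd: "x * pd 1 (pd 1 r) p + Y p * pd 1 (pd 1 q) p = 0"
      "x * pd 3 (pd 1 r) p + Y p * pd 3 (pd 1 q) p = (x + cnj x) * pd 1 q p"
      using symmetry_deriv[OF sy p] by (simp_all add: Yu)
    have "w p = x * r p + Y p * q p" by (simp add: w_def)
    then have 2: "w p * pd 1 (pd 1 q) p + Y p * pd 3 (pd 1 q) p = (x + cnj x) * pd 1 q p"
      using mix sd by algebra
    define N where "N = (\<lambda>p. pd 3 q p + q p * pd 1 q p + cnj (pd 1 F p))"
    have N: "along x (cnj x) (Y p) N p = (x + 3 * cnj x) * N p"
      unfolding N_def by (rule along_nu_numerator[OF pC nu0])
    have com: "pd 1 (pd 3 q) p = pd 3 (pd 1 q) p" by (rule C.pd_commute[OF smooth_q pC])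
    have d: "pd i N p = pd i (pd 3 q) p + pd i q p * pd 1 q p + q p * pd i (pd 1 q) p + pd i (\<lambda>p. cnj (pd 1 F p)) p" for i
      unfolding N_def using pC by (simp add: C.pd_add C.pd_mult sm)
    have cF: "pd 1 (\<lambda>p. cnj (pd 1 F p)) p = 0" "pd 2 (\<lambda>p. cnj (pd 1 F p)) p = cnj (pd 1 (pd 1 F) p)"
      "pd 3 (\<lambda>p. cnj (pd 1 F p)) p = cnj (pd 3 (pd 1 F) p)"
      using C.pd_cnj[OF C.smooth_pd[OF smooth_F, of 1] pC] pd_F2[OF pC] by simp_all
    have "along x (cnj x) (Y p) N p = w p * (pd 3 (pd 1 q) p + pd 1 q p * pd 1 q p + q p * pd 1 (pd 1 q) p)
        + Y p * (pd 3 (pd 3 q) p + pd 3 q p * pd 1 q p + q p * pd 3 (pd 1 q) p)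
        + (cnj (w p) * cnj (pd 1 (pd 1 F) p) + Y p * cnj (pd 3 (pd 1 F) p))"
      unfolding along_def d cF com pd_q[OF pC] pd2_pd1(2)[OF pC] using Yr
      by (simp add: w_def algebra_simps)
    then show ?thesis using 1 2 N unfolding N_def by algebra
  qed
  define w3 where "w3 = pd 3 w"
  \<comment> \<open>Since \<open>w\<close> is affine in \<zeta> and \<open>w3\<close> depends on u
    only, this potential has the derivatives prescribed in \<zeta>, cnj \<zeta> and v.\<close>
  define T0 where "T0 = (\<lambda>p. (x + cnj x) * vc p + cnj (w3 p) * zc p + w3 p * cnj (zc p))"
  define \<tau> where "\<tau> = (\<lambda>p. - (w p * pd 1 F p + cnj (w p) * cnj (pd 1 F p) + Y p * (pd 3 F p + cnj (pd 3 F p)))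
      + 2 * (F p + cnj (F p)) * (x + cnj x))"
  \<comment> \<open>What the u-derivative of \<open>T0\<close> lacks of the prescribed value
    \<open>\<tau>\<close>; by \<open>w33\<close> it depends on u alone.\<close>
  define R where "R = (\<lambda>p. \<tau> p - (cnj (pd 3 w3 p) * zc p + pd 3 w3 p * cnj (zc p)))"
  have sw3: "smooth_on U w3" "smooth_on U (pd 3 w3)" unfolding w3_def using sw by (simp_all add: U.smooth_pd)
  have s: "smooth_on U zc" "smooth_on U vc" using smooth_zc smooth_vc open_U by auto
  have w3i: "pd 1 w3 p = 0" "pd 2 w3 p = 0" "pd 4 w3 p = 0" if p: "p \<in> U" for p
    unfolding w3_def
    using U.pd_eq[OF p w1, where i = 3] U.pd_eq[OF p w2, where i = 3] U.pd_eq[OF p w4, where i = 3]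
    by (simp_all add: wc[OF p, of _ 3])
  have w33i: "pd 1 (pd 3 w3) p = 0" "pd 2 (pd 3 w3) p = 0" "pd 4 (pd 3 w3) p = 0" if p: "p \<in> U" for p
    using U.pd_eq[OF p w3i(1), where i = 3] U.pd_eq[OF p w3i(2), where i = 3] U.pd_eq[OF p w3i(3), where i = 3]
    by (simp_all add: U.pd_commute[OF sw3(1) p, of _ 3])
  have s\<tau>: "smooth_on U \<tau>" unfolding \<tau>_def using sw sY by (simp add: sm_U)
  have sR: "smooth_on U R" unfolding R_def using s\<tau> sw3 s by (simp add: sm_U)
  have Rr: "cnj (R p) = R p" for p
    by (simp add: R_def \<tau>_def Yr algebra_simps)
  have pdcF: "pd 1 (\<lambda>p. cnj (pd k F p)) p = 0" "pd 4 (\<lambda>p. cnj (pd k F p)) p = 0" "pd 1 (\<lambda>p. cnj (F p)) p = 0"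
    "pd 4 (\<lambda>p. cnj (F p)) p = 0" if "p \<in> U" for k p
    using C.pd_cnj[OF C.smooth_pd[OF smooth_F, of k] inC[OF that]] pd_F2[OF inC[OF that]]
      C.pd_cnj[OF smooth_F inC[OF that]] pd2_F[OF inC[OF that]] pd4_F[OF inC[OF that]] by simp_all
  have \<tau>1: "pd 1 \<tau> p = cnj (pd 3 w3 p)" and \<tau>4: "pd 4 \<tau> p = 0" if p: "p \<in> U" for p
  proof -
    have cw: "pd 1 (\<lambda>p. cnj (w p)) p = 0" "pd 4 (\<lambda>p. cnj (w p)) p = 0"
      using U.pd_cnj[OF sw p] w2[OF p] w4[OF p] by simp_all
    have d: "pd i \<tau> p = - (pd i w p * pd 1 F p + w p * pd i (pd 1 F) p + (pd i (\<lambda>p. cnj (w p)) p * cnj (pd 1 F p)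
        + cnj (w p) * pd i (\<lambda>p. cnj (pd 1 F p)) p)
        + (pd i Y p * (pd 3 F p + cnj (pd 3 F p)) + Y p * (pd i (pd 3 F) p + pd i (\<lambda>p. cnj (pd 3 F p)) p)))
        + 2 * (pd i F p + pd i (\<lambda>p. cnj (F p)) p) * (x + cnj x)" for i
      unfolding \<tau>_def using p sw sY by (simp add: U.pd_add U.pd_diff U.pd_minus U.pd_mult U.pd_const sm_U algebra_simps)
    have c: "cnj (pd 3 w3 p) = cnj ((x + 3 * cnj x) * cnj (pd 1 F p)
      - (cnj (w p) * cnj (pd 1 (pd 1 F) p) + Y p * cnj (pd 3 (pd 1 F) p)))"
      unfolding w3_def by (subst w33[OF p]) simp
    show "pd 1 \<tau> p = cnj (pd 3 w3 p)"
      unfolding c d using p cw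
      by (simp add: w1 pdcF Y0 Yr pd_F2(3)[OF inC[OF p]] algebra_simps)
    show "pd 4 \<tau> p = 0"
      unfolding d using p cw inC[OF p] by (simp add: w4 pdcF Y0 pd_F2 pd4_F)
  qed
  have cz: "pd 1 (\<lambda>p. cnj (zc p)) p = 0" "pd 2 (\<lambda>p. cnj (zc p)) p = 1" "pd 3 (\<lambda>p. cnj (zc p)) p = 0"
    "pd 4 (\<lambda>p. cnj (zc p)) p = 0" if "p \<in> U" for p
    using U.pd_cnj[OF s(1) that] by (simp_all add: pd_zc)
  have R1: "pd 1 R p = 0" and R4: "pd 4 R p = 0" if p: "p \<in> U" for p
    unfolding R_def using p s\<tau> sw3 s U.pd_cnj[OF sw3(2) p]
    by (simp_all add: U.pd_diff U.pd_add U.pd_mult sm_U \<tau>1 \<tau>4 w33i pd_zc cz)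
  have R2: "pd 2 R p = 0" if p: "p \<in> U" for p
  proof -
    have "pd 2 R p = pd 2 (\<lambda>p. cnj (R p)) p" by (simp add: Rr)
    also have "\<dots> = cnj (pd 1 R p)" using U.pd_cnj[OF sR p] by simp
    finally show ?thesis by (simp add: R1 p)
  qed
  obtain z0 u0 v0 where p0e: "p0 = (z0, u0, v0)" by (cases p0) auto
  obtain e where e: "e > 0" "ball p0 e \<subseteq> U" using open_U p0 openE by blast
  \<comment> \<open>A product with convex slices, as \<open>antiderivative_u\<close> requires; the
    three radii \<open>e / 3\<close> add up to \<open>e\<close>, so the triangle inequality keeps it
    inside the ball.\<close>
  define S where "S = ball z0 (e / 3) \<times> {u0 - e / 3<..<u0 + e / 3} \<times> ball v0 (e / 3)"
  have SU: "S \<subseteq> U"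
  proof
    fix p assume "p \<in> S"
    then obtain z u v where p: "p = (z, u, v)" "dist z0 z < e / 3" "dist v0 v < e / 3"
      and u: "u0 - e / 3 < u" "u < u0 + e / 3"
      unfolding S_def by (cases p) simp
    have du: "dist u0 u < e / 3" unfolding dist_real_def using u by linarith
    have "dist p0 p \<le> dist z0 z + dist (u0, v0) (u, v)"
      unfolding p0e p(1) dist_Pair_Pair[of z0] using sqrt_sum_squares_le_sum[of "dist z0 z" "dist (u0, v0) (u, v)"] by simp
    also have "dist (u0, v0) (u, v) \<le> dist u0 u + dist v0 v"
      unfolding dist_Pair_Pair using sqrt_sum_squares_le_sum[of "dist u0 u" "dist v0 v"] by simp
    finally have "dist p0 p < e" using p(2,3) du by simp
    then show "p \<in> U" using e(2) by auto
  qed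
  have p0S: "(z0, u0, v0) \<in> S" using e(1) by (simp add: S_def)
  have oS: "open S" unfolding S_def by (intro open_Times) auto
  obtain T G where T: "open T" "(z0, u0, v0) \<in> T" "T \<subseteq> S" "smooth_on T G"
    and G: "\<And>p. p \<in> T \<Longrightarrow> cnj (G p) = G p \<and> pd 1 G p = 0 \<and> pd 2 G p = 0 \<and> pd 3 G p = R p \<and> pd 4 G p = 0"
    using antiderivative_u[OF S_def open_ball open_ball convex_ball convex_ball smooth_on_subset[OF oS SU sR] _ Rr p0S]
      R1 R2 R4 SU by blast
  interpret T: smooth_domain T by unfold_locales (rule T(1))
  have TU: "p \<in> T \<Longrightarrow> p \<in> U" for p using T(3) SU by blast
  have smT: "smooth_on U K \<Longrightarrow> smooth_on T K" for K
    by (rule smooth_on_subset[OF T(1) order_trans[OF T(3) SU]])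
  define X where "X = (\<lambda>i::4. if i = 1 then w else if i = 2 then (\<lambda>p. cnj (w p)) else if i = 3 then Y
      else (\<lambda>p. T0 p + G p))"
  have sT0: "smooth_on U T0" unfolding T0_def using sw3 s by (simp add: sm_U)
  have sX: "smooth_on T (X i)" for i
    using smT[OF sw] smT[OF sY] smT[OF sT0] T(4) by (auto simp: X_def T.smooth)
  have T0d: "pd 1 T0 p = cnj (w3 p)" "pd 2 T0 p = w3 p"
    "pd 3 T0 p = cnj (pd 3 w3 p) * zc p + pd 3 w3 p * cnj (zc p)" "pd 4 T0 p = x + cnj x" if p: "p \<in> U" for p
    unfolding T0_def using p sw3 s U.pd_cnj[OF sw3(1) p]
    by (simp_all add: U.pd_add U.pd_mult U.pd_const sm_U w3i pd_zc pd_vc cz)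
  have "killing_on g T X"
    unfolding killing_on_def
  proof (intro conjI ballI allI)
    show "smooth_on T (X i)" for i by (rule sX)
    have "cnj (T0 p) = T0 p" for p by (simp add: T0_def vc_def algebra_simps)
    then show "real_field_on T X"
      using G Yr by (auto simp: real_field_on_def X_def Reals_cnj_iff)
  next
    fix p i j assume p: "p \<in> T"
    note pU = TU[OF p]
    have X4: "pd i (\<lambda>p. T0 p + G p) p = pd i T0 p + pd i G p" for i
      using p smT[OF sT0] T(4) by (simp add: T.pd_add)
    have "dH X p = w p * pd 1 F p + cnj (w p) * cnj (pd 1 F p) + Y p * (pd 3 F p + cnj (pd 3 F p))"
      by (simp add: dH_def X_def)
    then have e3: "pd 3 T0 p + R p = - dH X p - 2 * H p * pd 3 Y p"
      by (simp add: T0d(3)[OF pU] R_def \<tau>_def Y0(4)[OF pU] H_def algebra_simps)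
    have "\<forall>i j. lie_g X i j p = 0"
      unfolding killing_eqs[OF inC[OF pU]]
      using e3 G[OF p] by (simp add: X_def X4 T0d[OF pU] U.pd_cnj[OF sw pU] w1[OF pU] w2[OF pU] w4[OF pU] Y0[OF pU] w3_def)
    then show "lie_g X i j p = 0" by blast
  qed
  moreover have "X 3 p = of_real (\<rho> - 2 * Re x * fst (snd p)) \<and> X 1 p = x * r p + X 3 p * q p" for p
    by (simp add: X_def Yu w_def)
  ultimately show ?thesis using T TU p0e by (intro exI[of _ T] exI[of _ X]) auto
qed

section \<open>The dimension of the algebra of germs of Killing fields\<close>

lemma killing_diff:
  assumes "open N" "killing_on g N X" "killing_on g N X'"
  shows "killing_on g N (\<lambda>i p. X i p - of_real c * X' i p)"
proof -
  interpret N: smooth_domain N by unfold_locales (rule assms(1))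
  have s: "smooth_on N (X i)" "smooth_on N (X' i)" for i using assms by (auto simp: killing_on_def)
  have d: "pd j (\<lambda>p. X i p - of_real c * X' i p) p = pd j (X i) p - of_real c * pd j (X' i) p"
    if "p \<in> N" for i j p using that s by (simp add: N.pd_simps N.smooth)
  have "lie_g (\<lambda>i p. X i p - of_real c * X' i p) i j p = lie_g X i j p - of_real c * lie_g X' i j p"
    if "p \<in> N" for i j p
    unfolding d[OF that] sum_distrib_left sum_subtractf[symmetric]
    by (intro sum.cong refl) (simp add: algebra_simps)
  then have "lie_g (\<lambda>i p. X i p - of_real c * X' i p) i j p = 0" if "p \<in> N" for i j p
    using assms(2,3) that by (simp add: killing_on_def)
  moreover have "real_field_on N (\<lambda>i p. X i p - of_real c * X' i p)"
    using assms(2,3) by (simp add: killing_on_def real_field_on_def)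
  ultimately show ?thesis using s by (simp add: killing_on_def N.smooth)
qed

lemma killing_on_subset: "open N' \<Longrightarrow> N' \<subseteq> N \<Longrightarrow> killing_on g N X \<Longrightarrow> killing_on g N' X"
  unfolding killing_on_def real_field_on_def by (auto intro: smooth_on_subset)

text \<open>X a is constant, hence 0; then \<open>X 3\<close> is constant, hence 0, and
  \<open>X 1\<close> vanishes; finally all derivatives of \<open>X 4\<close> are 0. A Killing field
  is thus determined by X a and X u at one point, up to a real multiple of \<partial>_v.\<close>

lemma killing_determined:
  assumes B: "open B" "connected B" "B \<subseteq> U" and K: "killing_on g B X" and p0: "p0 \<in> B"
    and z: "X 1 p0 = 0" "X 3 p0 = 0" and p: "p \<in> B"
  shows "X 1 p = 0" "X 2 p = 0" "X 3 p = 0" "X 4 p = of_real (Re (X 4 p0))"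
proof -
  interpret B: smooth_domain B by unfold_locales (rule B(1))
  define x where "x = (\<lambda>p. (X 1 p - X 3 p * q p) / r p)"
  have xp: "(X 1 p - X 3 p * q p) / r p = x p" for p by (simp add: x_def)
  note ks = killing_structure[OF B(1,3) K, unfolded xp]
  have sX: "smooth_on B (X i)" for i using K by (simp add: killing_on_def)
  have x0: "x p = 0" if "p \<in> B" for p
    using constant_on_connected[OF B(1,2) ks(1)[OF p0] ks(2) that p0] z by (simp add: x_def)
  have X3: "X 3 p = 0" if p: "p \<in> B" for p
  proof -
    have "pd i (X 3) p = 0" if "p \<in> B" for i p
      using ks(3-6)[OF that] x0[OF that] by (cases i rule: index4_cases) simp_all
    from constant_on_connected[OF B(1,2) sX this p p0] show ?thesis using z by simp
  qed
  have X1: "X 1 p = 0" if p: "p \<in> B" for p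
  proof -
    have "r p \<noteq> 0" using r_neq inC B(3) p by blast
    then show ?thesis using x0[OF p] X3[OF p] by (simp add: x_def)
  qed
  have X2: "X 2 p = 0" if p: "p \<in> B" for p
    using K X1[OF p] p by (simp add: killing_on_def real_field_on_def)
  have "pd i (X 4) p = 0" if p: "p \<in> B" for i p
  proof -
    have "pd 3 (X 2) p = 0" "pd 3 (X 1) p = 0"
      using B.pd_eq[OF p X2, where i = 3] B.pd_eq[OF p X1, where i = 3] by simp_all
    moreover have "dH X p = 0" using X1 X2 X3 p by (simp add: dH_def)
    ultimately show ?thesis
      using ks(8-11)[OF p] x0[OF p] by (cases i rule: index4_cases) simp_all
  qed
  from constant_on_connected[OF B(1,2) sX this p p0]
  have "X 4 p = X 4 p0" .
  moreover have "X 4 p0 \<in> \<real>" using K p0 by (simp add: killing_on_def real_field_on_def)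
  ultimately show "X 4 p = of_real (Re (X 4 p0))" by simp
  show "X 1 p = 0" "X 2 p = 0" "X 3 p = 0" using X1 X2 X3 p by auto
qed

text \<open>The equation and its conjugate place both pairs on the complex line of (kx, k\<rho>).
  Comparing the conjugate components as well shows that their ratio is real, so the possible values
  at a point fill one real dimension.\<close>

lemma real_proportional:
  assumes k: "kx p \<noteq> 0 \<or> k\<rho> p \<noteq> 0"
    and y: "y * pd 1 r p + Y * pd 1 q p = cnj y - y" "cnj Y = Y"
    and x: "x * pd 1 r p + X * pd 1 q p = cnj x - x" "cnj X = X" "x \<noteq> 0 \<or> X \<noteq> 0"
  shows "\<exists>c :: real. y = of_real c * x \<and> Y = of_real c * X"
proof -
  have par: "\<exists>s. y = s * kx p \<and> Y = s * k\<rho> p \<and> cnj y = s * cnj (kx p)"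
    if "y * pd 1 r p + Y * pd 1 q p = cnj y - y" "cnj Y = Y" for y Y
  proof -
    have 1: "cnj y = y * (1 + pd 1 r p) + Y * pd 1 q p" using that(1) by algebra
    have 2: "y = cnj y * (1 + cnj (pd 1 r p)) + Y * cnj (pd 1 q p)"
      using arg_cong[OF 1, of cnj] that(2) by simp
    show ?thesis
      using kernel_parallel[OF 1 2] k unfolding cnj_k unfolding kx_def k\<rho>_def by auto
  qed
  obtain s where s: "y = s * kx p" "Y = s * k\<rho> p" "cnj y = s * cnj (kx p)" using par[OF y] by blast
  obtain t where t: "x = t * kx p" "X = t * k\<rho> p" "cnj x = t * cnj (kx p)" using par[OF x(1,2)] by blast
  have t0: "t \<noteq> 0" using x(3) t by auto
  define c where "c = s / t"
  have cy: "y = c * x" unfolding s(1) t(1) c_def using t0 by simp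
  have cY: "Y = c * X" unfolding s(2) t(2) c_def using t0 by simp
  have cc: "cnj y = c * cnj x" unfolding s(3) t(3) c_def using t0 by simp
  have "cnj c * cnj x = c * cnj x" unfolding cc[symmetric] cy by simp
  moreover have "cnj c * X = c * X"
    using arg_cong[OF cY, of cnj] y(2) x(2) cY by simp
  ultimately have "cnj c = c" using x(3) by auto
  then have "c = of_real (Re c)" by (simp add: complex_eq_iff)
  then have "y = of_real (Re c) * x \<and> Y = of_real (Re c) * X" using cy cY by simp
  then show ?thesis by blast
qed

lemma local_isometry_dim_2:
  assumes count: "invariant_count U f a Z [0, 2, 2]" and p0: "p0 \<in> U"
  shows "local_isometry_dim g U p0 2"
proof -
  have L: "vec.dim {grad al p, grad cal p} = 2" "grad nuf p \<in> W p" if "p \<in> U" for p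
    using count that by (auto simp: invariant_count_iff)
  obtain x \<rho> where sy: "symmetry x \<rho>"
    using count invariant_count_characterization tetrad_symmetry_imp_symmetry by blast
  obtain N X where N: "open N" "p0 \<in> N" "N \<subseteq> U" and K: "killing_on g N X"
    and X: "\<And>p. p \<in> N \<Longrightarrow> X 3 p = of_real (\<rho> - 2 * Re x * fst (snd p))"
      "\<And>p. p \<in> N \<Longrightarrow> X 1 p = x * r p + X 3 p * q p"
    using killing_exists[OF sy L(2) p0] by blast
  note rn = r_neq[OF inC[OF p0]]
  have xX: "x \<noteq> 0 \<or> X 3 p0 \<noteq> 0" using sy X(1)[OF N(2)] by (auto simp: symmetry_def)
  define V :: field4 where "V = (\<lambda>i p. if i = 4 then 1 else 0)"
  have KV: "killing_on g M V" if "open M" "M \<subseteq> U" for M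
    unfolding killing_on_def
  proof (intro conjI ballI allI)
    show "smooth_on M (V i)" for i using that by (simp add: V_def)
    show "real_field_on M V" by (simp add: real_field_on_def V_def)
    have pdV: "pd j (V i) p = 0" for i j p by (simp add: V_def)
    fix p i j assume "p \<in> M"
    then have pC: "p \<in> C" using \<open>M \<subseteq> U\<close> inC by blast
    have dV: "dH V p = 0" by (simp add: dH_def V_def)
    have "\<forall>i j. lie_g V i j p = 0"
      unfolding killing_eqs[OF pC] by (simp add: pdV dV)
    then show "lie_g V i j p = 0" by blast
  qed
  \<comment> \<open>\<open>V\<close> is \<partial>_v; it spans the Killing fields invisible in the
    coordinates (\<zeta>, u) and supplies the second dimension.\<close>
  define B where "B = (\<lambda>j::nat. if j = 0 then V else X)"
  have sumB: "(\<Sum>j<2. complex_of_real (c j) * B j i p) = of_real (c 0) * V i p + of_real (c 1) * X i p" for c i p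
    by (simp add: B_def numeral_2_eq_2 One_nat_def)
  show ?thesis
    unfolding local_isometry_dim_def
  proof (intro exI[of _ N] exI[of _ B] conjI allI impI N)
    fix j :: nat assume "j < 2"
    then show "killing_on g N (B j)" using K KV[OF N(1,3)] by (simp add: B_def)
  next
    fix c :: "nat \<Rightarrow> real" and j :: nat
    assume ev: "\<forall>\<^sub>F x in nhds p0. \<forall>i. (\<Sum>j<2. complex_of_real (c j) * B j i x) = 0" and j: "j < 2"
    have z: "of_real (c 0) * V i p0 + of_real (c 1) * X i p0 = 0" for i
      using eventually_nhds_x_imp_x[OF ev] by (simp add: sumB)
    have "c 1 * 1 = 0"
    proof (rule ccontr)
      assume "c 1 * 1 \<noteq> 0"
      then have "X 1 p0 = 0" "X 3 p0 = 0" using z[of 1] z[of 3] by (simp_all add: V_def)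
      then show False using X(2)[OF N(2)] xX rn by auto
    qed
    moreover from this have "c 0 = 0" using z[of 4] by (simp add: V_def)
    ultimately show "c j = 0" using j less_2_cases[of j] by (auto simp: One_nat_def)
  next
    fix M X'
    assume "open M \<and> p0 \<in> M \<and> M \<subseteq> U \<and> killing_on g M X'"
    then have M: "open M" "p0 \<in> M" "M \<subseteq> U" and K': "killing_on g M X'" by auto
    \<comment> \<open>The derivative of a along \<open>X'\<close>, for which
      \<open>killing_structure\<close> gives the same linear equation as for
      \<open>x\<close>.\<close>
    define y where "y = (\<lambda>p. (X' 1 p - X' 3 p * q p) / r p)"
    have y: "y p0 * pd 1 r p0 + X' 3 p0 * pd 1 q p0 = cnj (y p0) - y p0"
      using killing_structure(7)[OF M(1,3) K' M(2)] by (simp add: y_def)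
    have re: "cnj (X' 3 p0) = X' 3 p0" "cnj (X 3 p0) = X 3 p0"
      using K' M(2) K N(2) by (auto simp: killing_on_def real_field_on_def Reals_cnj_iff)
    have xe: "x * pd 1 r p0 + X 3 p0 * pd 1 q p0 = cnj x - x"
      using sy p0 X(1)[OF N(2)] by (auto simp: symmetry_def symmetry_at_def)
    obtain c1 :: real where c1: "y p0 = of_real c1 * x" "X' 3 p0 = of_real c1 * X 3 p0"
      using real_proportional[OF dim_imp_k_neq[OF inC[OF p0] L(1)[OF p0]] y re(1) xe re(2) xX] by blast
    have "X' 1 p0 = y p0 * r p0 + X' 3 p0 * q p0" using rn by (simp add: y_def)
    then have X'1: "X' 1 p0 = of_real c1 * X 1 p0"
      using c1 X(2)[OF N(2)] by (simp add: algebra_simps)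
    have "open (M \<inter> N)" "p0 \<in> M \<inter> N" using M N by auto
    \<comment> \<open>The domains of the two fields may differ, and
      \<open>killing_determined\<close> needs a connected one; a ball in the intersection serves for
      both.\<close>
    then obtain \<epsilon> where \<epsilon>: "\<epsilon> > 0" "ball p0 \<epsilon> \<subseteq> M \<inter> N" using openE by blast
    define Xd where "Xd = (\<lambda>i p. X' i p - of_real c1 * X i p)"
    have Kd: "killing_on g (ball p0 \<epsilon>) Xd"
      unfolding Xd_def using \<epsilon> K K' by (intro killing_diff) (auto intro: killing_on_subset)
    define c0 where "c0 = Re (Xd 4 p0)"
    define c where "c = (\<lambda>j::nat. if j = 0 then c0 else c1)"
    have det: "X' i p = (\<Sum>j<2. complex_of_real (c j) * B j i p)" if p: "p \<in> ball p0 \<epsilon>" for i p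
    proof -
      have "ball p0 \<epsilon> \<subseteq> U" using \<epsilon> M by blast
      note d = killing_determined[OF open_ball connected_ball this Kd _ _ _ p, of p0]
      have "Xd 1 p = 0" "Xd 2 p = 0" "Xd 3 p = 0" "Xd 4 p = of_real c0"
        using d \<epsilon>(1) X'1 c1(2) by (simp_all add: Xd_def c0_def)
      then have "Xd i p = of_real c0 * V i p"
        by (cases i rule: index4_cases) (simp_all add: V_def)
      then have "X' i p = of_real c0 * V i p + of_real c1 * X i p"
        by (simp add: Xd_def algebra_simps)
      then show ?thesis unfolding sumB by (simp add: c_def)
    qed
    have "\<forall>\<^sub>F p in nhds p0. p \<in> ball p0 \<epsilon>" using \<epsilon>(1) by (intro eventually_nhds_in_open) auto
    then have "\<forall>\<^sub>F p in nhds p0. \<forall>i. X' i p = (\<Sum>j<2. complex_of_real (c j) * B j i p)"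
      by eventually_elim (simp add: det)
    then show "\<exists>c. \<forall>\<^sub>F p in nhds p0. \<forall>i. X' i p = (\<Sum>j<2. complex_of_real (c j) * B j i p)" by blast
  qed
qed

end

theorem proposition6p1:
  fixes U :: "(complex \<times> real \<times> real) set"
    and f a Z :: "complex \<Rightarrow> real \<Rightarrow> complex"
  assumes "vacuum_pp_wave U f"
    and "log_branch U f a"
    and "inverse_fun U a Z"
    and "\<forall>p\<in>U. alpha a p \<noteq> 0"
  shows "(invariant_count U f a Z [0, 2, 2] \<longleftrightarrow>
      (\<exists>V :: 4 \<Rightarrow> complex \<times> real \<times> real \<Rightarrow> complex.
         (\<forall>i. smooth_on U (V i)) \<and> real_field_on U V \<and>
         (\<forall>p\<in>U. \<forall>i. lie_form (of_frame f a Z V) (coframe f a Z 1) i p = 0) \<and>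
         (\<forall>p\<in>U. \<forall>i. lie_form (of_frame f a Z V) (coframe f a Z 3) i p = 0) \<and>
         (\<forall>p\<in>U. V 1 p \<noteq> 0 \<or> V 3 p \<noteq> 0)) \<and>
      (\<forall>p\<in>U. \<exists>i j.
         wedge11 (d_fun (alpha a)) (d_fun (\<lambda>q. cnj (alpha a q))) i j p \<noteq> 0) \<and>
      (\<forall>p\<in>U. \<forall>i j k.
         wedge12 (d_fun (alpha a))
           (wedge11 (d_fun (\<lambda>q. cnj (alpha a q))) (d_fun (nu f a Z))) i j k p = 0))
    \<and> (invariant_count U f a Z [0, 2, 2] \<longrightarrow> (\<forall>p\<in>U. local_isometry_dim (pp_metric f) U p 2))"
proof -
  interpret pp_wave U f a Z by unfold_locales (use assms in auto)
  show ?thesis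
    using invariant_count_characterization local_isometry_dim_2 unfolding tetrad_symmetry_def by blast
qed

end
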